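(* In the phase-atlas setting of the context, for every atlas prior $q\in\Delta(\mathcal A)$, every $a\in\mathcal A$ with $q(a)>0$ and every $\delta\in(0,1)$, with an absolute constant $C$, \[ \nu_{C,a}\Bigl\{\sup_{x\in\mathcal T_a}|Z_{a,x}|\le CL_a\sqrt{\log\frac{2|\mathcal T_a|}{\delta q(a)}}\Bigr\}\ge1-\delta q(a), \] and \[ \nu_{C,a}\Bigl\{\sup_{x\in\mathcal T_{\rm full}}|Z_{a,x}|\le CL_{\rm glob}\sqrt{\log\frac{2|\mathcal T_{\rm full}|}\delta}\Bigr\}\ge1-\delta . \] Moreover, for all integers $N,K\ge2$ there are Gaussian-mixture phase atlases with $N$ phases whose coarse mixture $\nu_C$ is not log-concave, together with observable classes $\mathcal T_a\subseteq\mathcal T_{\rm full}$, for which, on a selected phase $a$ (with $q(a)$ bounded below by an absolute constant), \[ \mathbb E\sup_{x\in\mathcal T_a}|Z_{a,x}|\asymp\sqrt{\log K},\qquad\mathbb E\sup_{x\in\mathcal T_{\rm full}}|Z_{a,x}|\asymp\sqrt{\log(NK)}, \] expectations being under $\nu_{C,a}$. Hence the full-cover scale can be strictly larger. If instead $q$ is uniform over all $N$ phases, then $\log(1/q(a))=\log N$, so the selected bound already contains $\log N$.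
   Context: Let $E=E_C\oplus E_F$ be finite-dimensional Euclidean, $\mathcal A$ a finite set of phase labels, and \[ \nu(d\phi_C,d\phi_F)=\sum_{a\in\mathcal A}w_a\nu_a(d\phi_C,d\phi_F),\qquad\nu_a=Z_a^{-1}e^{-S_a(\phi_C,\phi_F)}\mathbf 1_{\Omega_{C,a}\times\Omega_{F,a}}\,d\phi_Cd\phi_F, \] with $w_a>0$, $\sum_aw_a=1$, $\Omega_{C,a}\subseteq E_C$ and $\Omega_{F,a}\subseteq E_F$ closed convex with nonempty interior, all integrals finite, $S_a$ twice continuously differentiable, and on each product chart \[ \nabla^2S_a\succeq H_a=\begin{pmatrix}A_a & B_a \\ {B_a^\top} & D_a\end{pmatrix},\qquad D_a\succ0,\qquad H_a^{\rm RG}:=A_a-B_aD_a^{-1}B_a^\top\succ0 . \] The coarse marginal on $E_C$ is $\nu_C=\sum_aw_a\nu_{C,a}$, where $\nu_{C,a}=Z_{C,a}^{-1}e^{-S_a^{\rm RG}(u)}\mathbf 1_{\Omega_{C,a}}du$ and $S_a^{\rm RG}(u)=-\log\int_{\Omega_{F,a}}e^{-S_a(u,v)}dv$. Linear observables are indexed by $x$ with vectors $v_x\in E_C$, and $Z_{a,x}:=\langle v_x,u\rangle-\mathbb E_{\nu_{C,a}}\langle v_x,u\rangle$ with $u\sim\nu_{C,a}$. $\mathcal T_{\rm full}$ is a finite observable class and $\mathcal T_a\subseteq\mathcal T_{\rm full}$ is a nonempty subfamily relevant to phase $a$. Define \[ \ell_a(x)^2:=\langle v_x,(H_a^{\rm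 RG})^{-1}v_x\rangle,\quad L_a:=\sup_{x\in\mathcal T_a}\ell_a(x),\quad L_{\rm glob}:=\sup_{b\in\mathcal A}\sup_{x\in\mathcal T_{\rm full}}\ell_b(x). \] "Gaussian-mixture phase atlas" means that the chart measures $\nu_{C,a}$ are Gaussian. $\Delta(\mathcal A)$ denotes probability measures on $\mathcal A$; $\asymp$ is up to absolute positive constants. *)

theory Defs
  imports "HOL-Probability.Probability" "Jordan_Normal_Form.Gauss_Jordan_Elimination"
    "Jordan_Normal_Form.Determinant"
begin

unbundle no inner_syntax
unbundle no vec_syntax

hide_const (open) Finite_Cartesian_Product.vec Finite_Cartesian_Product.mat Determinants.det
hide_type (open) Finite_Cartesian_Product.vec

text \<open>
  Dimensions are quantified inside the theorem (the constants must not depend on them), so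
  \<open>\<real>\<^sup>d\<close> is the carrier \<open>carrier_vec d\<close> of the type of real vectors rather than a type.
  Points of \<open>\<real>\<^sup>m \<oplus> \<real>\<^sup>n\<close> are written \<open>u @\<^sub>v v\<close>.
\<close>

definition euclid :: "nat \<Rightarrow> real vec topology" where
  "euclid d = Metric_space.mtopology (carrier_vec d)
     (\<lambda>x y. L2_set (\<lambda>i. x $ i - y $ i) {..<d})"

lemma Metric_space_euclid:
  "Metric_space (carrier_vec d) (\<lambda>x y :: real vec. L2_set (\<lambda>i. x $ i - y $ i) {..<d})"
proof
  fix x y z :: "real vec"
  show "0 \<le> L2_set (\<lambda>i. x $ i - y $ i) {..<d}" by simp
  show "L2_set (\<lambda>i. x $ i - y $ i) {..<d} = L2_set (\<lambda>i. y $ i - x $ i) {..<d}"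
    by (simp add: L2_set_def power2_commute)
  show "(L2_set (\<lambda>i. x $ i - y $ i) {..<d} = 0) = (x = y)"
    if "x \<in> carrier_vec d" "y \<in> carrier_vec d"
    using that by (subst L2_set_eq_0_iff) (auto simp: vec_eq_iff Ball_def)
  show "L2_set (\<lambda>i. x $ i - z $ i) {..<d}
      \<le> L2_set (\<lambda>i. x $ i - y $ i) {..<d} + L2_set (\<lambda>i. y $ i - z $ i) {..<d}"
    using L2_set_triangle_ineq[of "\<lambda>i. x $ i - y $ i" "\<lambda>i. y $ i - z $ i" "{..<d}"] by simp
qed

text \<open>Lebesgue measure on \<open>\<real>\<^sup>d\<close>, on the Borel sets, transported along the bijection \<open>vec d\<close>
  from extensional functions on \<open>{..<d}\<close> to \<open>carrier_vec d\<close>.\<close>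

definition leb :: "nat \<Rightarrow> real vec measure" where
  "leb d = embed_measure (\<Pi>\<^sub>M i\<in>{..<d}. lborel) (vec d)"

lemma space_leb: "space (leb d) = carrier_vec d"
proof -
  have "x \<in> vec d ` PiE {..<d} (\<lambda>_. UNIV)" if "x \<in> carrier_vec d" for x :: "real vec"
  proof (rule image_eqI)
    show "x = vec d (restrict (\<lambda>i. x $ i) {..<d})"
      using that by (intro eq_vecI) simp_all
    show "restrict (\<lambda>i. x $ i) {..<d} \<in> PiE {..<d} (\<lambda>_. UNIV)" by simp
  qed
  moreover have "vec d f \<in> carrier_vec d" for f :: "nat \<Rightarrow> real" by simp
  ultimately have "vec d ` PiE {..<d} (\<lambda>_. UNIV) = (carrier_vec d :: real vec set)"
    by blast
  then show ?thesis by (simp add: leb_def space_embed_measure space_PiM)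
qed

definition convex_vec :: "real vec set \<Rightarrow> bool" where
  "convex_vec A \<longleftrightarrow>
     (\<forall>x\<in>A. \<forall>y\<in>A. \<forall>t. 0 \<le> t \<and> t \<le> 1 \<longrightarrow> (1 - t) \<cdot>\<^sub>v x + t \<cdot>\<^sub>v y \<in> A)"

definition pos_semidef :: "nat \<Rightarrow> real mat \<Rightarrow> bool" where
  "pos_semidef d M \<longleftrightarrow> M \<in> carrier_mat d d \<and> transpose_mat M = M \<and>
     (\<forall>x\<in>carrier_vec d. 0 \<le> x \<bullet> (M *\<^sub>v x))"

definition pos_def :: "nat \<Rightarrow> real mat \<Rightarrow> bool" where
  "pos_def d M \<longleftrightarrow> M \<in> carrier_mat d d \<and> transpose_mat M = M \<and>
     (\<forall>x\<in>carrier_vec d. x \<noteq> 0\<^sub>v d \<longrightarrow> 0 < x \<bullet> (M *\<^sub>v x))"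

abbreviation inv_mat :: "real mat \<Rightarrow> real mat" where
  "inv_mat M \<equiv> the (mat_inverse M)"

definition partial_deriv :: "nat \<Rightarrow> nat \<Rightarrow> (real vec \<Rightarrow> real) \<Rightarrow> real vec \<Rightarrow> real" where
  "partial_deriv d i f z = deriv (\<lambda>t. f (z + t \<cdot>\<^sub>v unit_vec d i)) 0"

text \<open>Class \<open>C\<^sup>k\<close> on an open set \<open>U\<close>: all partial derivatives up to order \<open>k\<close> exist and are
  continuous.\<close>

primrec Ck_on :: "nat \<Rightarrow> nat \<Rightarrow> real vec set \<Rightarrow> (real vec \<Rightarrow> real) \<Rightarrow> bool" where
  "Ck_on 0 d U f \<longleftrightarrow> continuous_map (subtopology (euclid d) U) euclideanreal f"
| "Ck_on (Suc k) d U f \<longleftrightarrow> continuous_map (subtopology (euclid d) U) euclideanreal f \<and>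
     (\<forall>i<d. (\<forall>z\<in>U. (\<lambda>t. f (z + t \<cdot>\<^sub>v unit_vec d i)) differentiable (at 0)) \<and>
            Ck_on k d U (partial_deriv d i f))"

definition hessian :: "nat \<Rightarrow> (real vec \<Rightarrow> real) \<Rightarrow> real vec \<Rightarrow> real mat" where
  "hessian d f z = mat d d (\<lambda>(i, j). partial_deriv d i (partial_deriv d j f) z)"

definition gaussian_measure :: "nat \<Rightarrow> real vec measure \<Rightarrow> bool" where
  "gaussian_measure d \<mu> \<longleftrightarrow> (\<exists>b\<in>carrier_vec d. \<exists>\<Sigma>. pos_def d \<Sigma> \<and>
     \<mu> = density (leb d) (\<lambda>u. ennreal
       (exp (- ((u - b) \<bullet> (inv_mat \<Sigma> *\<^sub>v (u - b))) / 2) / sqrt ((2 * pi) ^ d * det \<Sigma>))))"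

definition log_concave_measure :: "nat \<Rightarrow> real vec measure \<Rightarrow> bool" where
  "log_concave_measure d \<mu> \<longleftrightarrow> (\<exists>f. f \<in> borel_measurable (leb d) \<and>
     (\<forall>x\<in>carrier_vec d. 0 \<le> f x) \<and>
     (\<forall>x\<in>carrier_vec d. \<forall>y\<in>carrier_vec d. \<forall>t. 0 < t \<and> t < 1 \<longrightarrow>
        f x powr (1 - t) * f y powr t \<le> f ((1 - t) \<cdot>\<^sub>v x + t \<cdot>\<^sub>v y)) \<and>
     \<mu> = density (leb d) (\<lambda>x. ennreal (f x)))"

text \<open>Phase labels and observable labels are natural numbers: only finite sets of them occur.
  \<open>blkA\<close>, \<open>blkB\<close>, \<open>blkD\<close> are the blocks of the comparison matrix, \<open>obs x\<close> is the vector of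
  the linear observable \<open>x\<close>, \<open>Tfull\<close> and \<open>Tsel a\<close> are the full and the phase-relevant
  observable classes.\<close>

record atlas =
  dimC :: nat
  dimF :: nat
  phases :: "nat set"
  weight :: "nat \<Rightarrow> real"
  OmegaC :: "nat \<Rightarrow> real vec set"
  OmegaF :: "nat \<Rightarrow> real vec set"
  action :: "nat \<Rightarrow> real vec \<Rightarrow> real"
  blkA :: "nat \<Rightarrow> real mat"
  blkB :: "nat \<Rightarrow> real mat"
  blkD :: "nat \<Rightarrow> real mat"
  obs :: "nat \<Rightarrow> real vec"
  Tfull :: "nat set"
  Tsel :: "nat \<Rightarrow> nat set"

definition HRG :: "atlas \<Rightarrow> nat \<Rightarrow> real mat" where
  "HRG X a = blkA X a - blkB X a * inv_mat (blkD X a) * transpose_mat (blkB X a)"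

definition Hmat :: "atlas \<Rightarrow> nat \<Rightarrow> real mat" where
  "Hmat X a = four_block_mat (blkA X a) (blkB X a) (transpose_mat (blkB X a)) (blkD X a)"

definition chart :: "atlas \<Rightarrow> nat \<Rightarrow> real vec set" where
  "chart X a = {u @\<^sub>v v | u v. u \<in> OmegaC X a \<and> v \<in> OmegaF X a}"

definition leb2 :: "atlas \<Rightarrow> (real vec \<times> real vec) measure" where
  "leb2 X = leb (dimC X) \<Otimes>\<^sub>M leb (dimF X)"

text \<open>The action is required to be \<open>C\<^sup>2\<close> only on some open neighbourhood of the (closed) chart;
  its values elsewhere are irrelevant.\<close>

definition phase_atlas :: "atlas \<Rightarrow> bool" where
  "phase_atlas X \<longleftrightarrow>
     finite (phases X) \<and> (\<forall>a\<in>phases X. 0 < weight X a) \<and> (\<Sum>a\<in>phases X. weight X a) = 1 \<and>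
     finite (Tfull X) \<and> (\<forall>x\<in>Tfull X. obs X x \<in> carrier_vec (dimC X)) \<and>
     (\<forall>a\<in>phases X.
        Tsel X a \<noteq> {} \<and> Tsel X a \<subseteq> Tfull X \<and>
        closedin (euclid (dimC X)) (OmegaC X a) \<and> convex_vec (OmegaC X a) \<and>
        (euclid (dimC X)) interior_of (OmegaC X a) \<noteq> {} \<and>
        closedin (euclid (dimF X)) (OmegaF X a) \<and> convex_vec (OmegaF X a) \<and>
        (euclid (dimF X)) interior_of (OmegaF X a) \<noteq> {} \<and>
        set_integrable (leb2 X) (OmegaC X a \<times> OmegaF X a) (\<lambda>(u, v). exp (- action X a (u @\<^sub>v v))) \<and>
        (\<forall>u\<in>OmegaC X a. set_integrable (leb (dimF X)) (OmegaF X a)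
           (\<lambda>v. exp (- action X a (u @\<^sub>v v)))) \<and>
        blkA X a \<in> carrier_mat (dimC X) (dimC X) \<and>
        blkB X a \<in> carrier_mat (dimC X) (dimF X) \<and>
        pos_def (dimF X) (blkD X a) \<and> pos_def (dimC X) (HRG X a) \<and>
        (\<exists>U. openin (euclid (dimC X + dimF X)) U \<and> chart X a \<subseteq> U \<and>
           Ck_on 2 (dimC X + dimF X) U (action X a)) \<and>
        (\<forall>z\<in>chart X a. pos_semidef (dimC X + dimF X)
           (hessian (dimC X + dimF X) (action X a) z - Hmat X a)))"

definition phase_density :: "atlas \<Rightarrow> nat \<Rightarrow> real vec \<times> real vec \<Rightarrow> real" where
  "phase_density X a z = indicator (OmegaC X a \<times> OmegaF X a) z *
     exp (- action X a (fst z @\<^sub>v snd z)) /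
     (LINT (u, v):(OmegaC X a \<times> OmegaF X a)|leb2 X. exp (- action X a (u @\<^sub>v v)))"

definition nu :: "atlas \<Rightarrow> (real vec \<times> real vec) measure" where
  "nu X = density (leb2 X) (\<lambda>z. ennreal (\<Sum>a\<in>phases X. weight X a * phase_density X a z))"

definition nu_C :: "atlas \<Rightarrow> real vec measure" where
  "nu_C X = distr (nu X) (leb (dimC X)) fst"

definition S_RG :: "atlas \<Rightarrow> nat \<Rightarrow> real vec \<Rightarrow> real" where
  "S_RG X a u = - ln (LINT v:OmegaF X a|leb (dimF X). exp (- action X a (u @\<^sub>v v)))"

definition nu_Ca :: "atlas \<Rightarrow> nat \<Rightarrow> real vec measure" where
  "nu_Ca X a = density (leb (dimC X)) (\<lambda>u. ennreal (indicator (OmegaC X a) u *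
     exp (- S_RG X a u) / (LINT u:OmegaC X a|leb (dimC X). exp (- S_RG X a u))))"

definition Zobs :: "atlas \<Rightarrow> nat \<Rightarrow> nat \<Rightarrow> real vec \<Rightarrow> real" where
  "Zobs X a x u = obs X x \<bullet> u - (LINT u'|nu_Ca X a. obs X x \<bullet> u')"

definition supZ :: "atlas \<Rightarrow> nat \<Rightarrow> nat set \<Rightarrow> real vec \<Rightarrow> real" where
  "supZ X a T u = (SUP x\<in>T. \<bar>Zobs X a x u\<bar>)"

definition ell :: "atlas \<Rightarrow> nat \<Rightarrow> nat \<Rightarrow> real" where
  "ell X a x = sqrt (obs X x \<bullet> (inv_mat (HRG X a) *\<^sub>v obs X x))"

definition L_sel :: "atlas \<Rightarrow> nat \<Rightarrow> real" where
  "L_sel X a = (SUP x\<in>Tsel X a. ell X a x)"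

definition L_glob :: "atlas \<Rightarrow> real" where
  "L_glob X = (SUP b\<in>phases X. SUP x\<in>Tfull X. ell X b x)"

text \<open>Priors on the phases are probability mass functions supported in \<open>phases X\<close>.\<close>

definition atlas_prior :: "atlas \<Rightarrow> nat pmf \<Rightarrow> bool" where
  "atlas_prior X q \<longleftrightarrow> set_pmf q \<subseteq> phases X"

definition gaussian_mixture_atlas :: "atlas \<Rightarrow> bool" where
  "gaussian_mixture_atlas X \<longleftrightarrow>
     phase_atlas X \<and> (\<forall>a\<in>phases X. gaussian_measure (dimC X) (nu_Ca X a))"

end

theory Submission
  imports Defs
begin

text \<open>If \<open>S\<close> minus half the quadratic form of \<open>H\<close> is convex and \<open>f\<close> is linear, apply the
  Prekopa-Leindler inequality to \<open>exp (h f - S)\<close> and \<open>exp (- h f - S)\<close>: at a midpoint the loss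
  \<open>h (f x - f y)\<close> is paid for by the quadratic gain in \<open>S\<close>, so
  \<open>E exp (h f) * E exp (- h f) \<le> exp (h\<^sup>2 l\<^sup>2)\<close> with \<open>l\<^sup>2\<close> the dual quadratic form of \<open>f\<close>. For an
  observable that depends only on the coarse variable the dual form is that of the Schur complement.
  By Jensen, centring \<open>f\<close> makes the second factor at least 1, which gives the sub-Gaussian bound, and
  Chernoff plus a union bound give both concentration estimates.

  For the lower bounds take unit covariance Gaussians in dimension \<open>N K\<close> with widely separated
  means and the coordinates as observables: \<open>Z\<close> is then a standard Gaussian vector under each phase.
  Two peaks with a valley between them contradict the inequality
  \<open>\<mu> A * \<mu> B \<le> (\<mu> ((A + B) / 2))\<^sup>2\<close> that log-concave measures satisfy.\<close>

text \<open>The marginal action \<open>S_RG\<close> is known only through an integral, so its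
  Hessian is never formed: coarse expectations are lifted to the joint space by
  \<open>nn_integral_nu_Ca\<close>, and convexity is used there. The Schur complement enters
  pointwise, as the minimum of the block form over the fluctuation displacement. The convex domains
  are harmless, since the density is extended by 0 and midpoints of chart points stay in the chart.
  The dimension is a variable of the theorem, so the midpoint inequality is proved on the line from
  Brunn-Minkowski, tensorized over finite products and carried to \<open>leb\<close>. The product
  bound also yields finiteness of exponential moments, because the opposite factor is positive.
  Discarding that factor costs a factor 2 in the exponent, h^2 l^2 where h^2 l^2 / 2 is optimal;
  Chernoff then gives C = 2. In the example every scale \<open>ell\<close> equals 1, so the
  separation comes from cardinalities alone. The means are 8 N apart, a distance growing with N
  because each peak carries mass of order 1 / N only.\<close>

hide_const (open) Order.top  \<comment> \<open>otherwise \<open>top\<close> does not denote the lattice constant\<close>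

section \<open>The Prekopa-Leindler inequality\<close>

text \<open>The translates of \<open>A / 2\<close> by \<open>Min B / 2\<close> and of \<open>B / 2\<close> by \<open>Max A / 2\<close> lie in \<open>C\<close> and share
  at most one point.\<close>

lemma brunn_minkowski_compact_real:
  fixes A B :: "real set"
  assumes "compact A" "compact B" "A \<noteq> {}" "B \<noteq> {}" and C: "C \<in> sets lborel"
    and sub: "\<And>a b. a \<in> A \<Longrightarrow> b \<in> B \<Longrightarrow> (a + b) / 2 \<in> C"
  shows "emeasure lborel A + emeasure lborel B \<le> 2 * emeasure lborel C"
proof -
  obtain a where a: "a \<in> A" "\<And>x. x \<in> A \<Longrightarrow> x \<le> a"
    using compact_attains_sup[OF assms(1,3)] by blast
  obtain b where b: "b \<in> B" "\<And>x. x \<in> B \<Longrightarrow> b \<le> x"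
    using compact_attains_inf[OF assms(2,4)] by blast
  define A' where "A' = (\<lambda>x. (1/2) * x + b/2) ` A"
  define B' where "B' = (\<lambda>x. (1/2) * x + a/2) ` B"
  have cA: "compact A'" "compact B'" unfolding A'_def B'_def
    using assms(1,2) by (auto intro!: compact_continuous_image continuous_intros)
  have half: "emeasure lborel X = 2 * emeasure lborel ((\<lambda>x. (1/2) * x + c) ` X)"
    if "compact X" for X :: "real set" and c
  proof -
    define T where "T = (\<lambda>x. (1/2) * x + c :: real)"
    have "emeasure lborel X = emeasure (density (distr lborel borel (\<lambda>y. - 2 * c + 2 * y)) (\<lambda>_. ennreal \<bar>2\<bar>)) X"
      using lborel_real_affine[of 2 "- 2 * c"] by simp
    also have "\<dots> = 2 * emeasure lborel ((\<lambda>y. - 2 * c + 2 * y) -` X)"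
      using that by (simp add: emeasure_density_const emeasure_distr borel_compact)
    also have "(\<lambda>y. - 2 * c + 2 * y) -` X = T ` X"
    proof (intro Set.set_eqI iffI)
      fix y assume "y \<in> (\<lambda>y. - 2 * c + 2 * y) -` X"
      then have "- 2 * c + 2 * y \<in> X" "y = T (- 2 * c + 2 * y)" by (auto simp: T_def field_simps)
      then show "y \<in> T ` X" by blast
    qed (auto simp: T_def)
    finally show ?thesis by (simp add: T_def)
  qed
  have "emeasure lborel A + emeasure lborel B = 2 * emeasure lborel A' + 2 * emeasure lborel B'"
    unfolding A'_def B'_def using half[OF assms(1)] half[OF assms(2)] by metis
  also have "\<dots> = 2 * (emeasure lborel (A' - {(a+b)/2}) + emeasure lborel B')"
    using cA by (subst emeasure_Diff_null_set) (auto simp: borel_compact distrib_left)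
  also have "emeasure lborel (A' - {(a+b)/2}) + emeasure lborel B' = emeasure lborel ((A' - {(a+b)/2}) \<union> B')"
  proof (rule plus_emeasure)
    have "x \<le> (a+b)/2" if "x \<in> A'" for x using that a by (auto simp: A'_def field_simps)
    moreover have "(a+b)/2 \<le> x" if "x \<in> B'" for x using that b by (auto simp: B'_def field_simps)
    ultimately show "(A' - {(a+b)/2}) \<inter> B' = {}" by force
  qed (use cA in \<open>auto simp: borel_compact\<close>)
  also have "\<dots> \<le> emeasure lborel C"
  proof (rule emeasure_mono[OF _ C])
    show "A' - {(a + b) / 2} \<union> B' \<subseteq> C"
      using sub[OF _ b(1)] sub[OF a(1)] by (auto simp: A'_def B'_def add_divide_distrib add.commute)
  qed
  finally show ?thesis by (simp add: mult_left_mono)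
qed

text \<open>Extrema are attained on compact sets, so the compact case reaches Borel sets through
  inner regularity. The closed approximation for Lebesgue measure leaves an error \<open>e\<close>,
  and cutting with growing intervals makes the closed set compact, also when its measure is
  infinite.\<close>

lemma emeasure_lborel_inner_compact:
  fixes A :: "real set"
  assumes A: "A \<in> sets lborel"
  shows "emeasure lborel A = (SUP K \<in> {K. compact K \<and> K \<subseteq> A}. emeasure lborel K)"
proof (rule antisym)
  let ?S = "SUP K \<in> {K. compact K \<and> K \<subseteq> A}. emeasure lborel K"
  show "emeasure lborel A \<le> ?S"
  proof (rule ennreal_le_epsilon)
    fix e :: real assume e: "0 < e"
    have "A \<in> sets lebesgue" using A by simp
    then obtain T where T: "closed T" "T \<subseteq> A" "emeasure lebesgue (A - T) < ennreal e"
      using sets_lebesgue_inner_closed[OF _ e] by metis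
    have bT: "T \<in> sets borel" using T(1) by (rule borel_closed)
    have "emeasure lborel A = emeasure lborel T + emeasure lborel (A - T)"
    proof -
      have "emeasure lborel T + emeasure lborel (A - T) = emeasure lborel (T \<union> (A - T))"
        using A bT by (intro plus_emeasure) auto
      also have "T \<union> (A - T) = A" using T(2) by blast
      finally show ?thesis ..
    qed
    also have "emeasure lborel (A - T) \<le> e"
      using T(3) A bT by (simp add: less_imp_le)
    also have "emeasure lborel T \<le> ?S"
    proof -
      have "emeasure lborel T = emeasure lborel (\<Union>n. T \<inter> {- real n..real n})"
      proof (rule arg_cong[where f = "emeasure lborel"], intro Set.set_eqI iffI)
        fix x assume "x \<in> T"
        moreover obtain n where "\<bar>x\<bar> \<le> real n" using real_arch_simple by blast
        ultimately show "x \<in> (\<Union>n. T \<inter> {- real n..real n})" by (auto intro!: exI[of _ n])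
      qed auto
      also have "\<dots> = (SUP n. emeasure lborel (T \<inter> {- real n..real n}))"
        using bT by (intro SUP_emeasure_incseq[symmetric]) (auto simp: incseq_def)
      also have "\<dots> \<le> ?S"
        using T by (intro SUP_least SUP_upper) (auto intro: closed_Int_compact)
      finally show ?thesis .
    qed
    finally show "emeasure lborel A \<le> ?S + ennreal e" by (simp add: add_right_mono)
  qed
  show "?S \<le> emeasure lborel A" using A by (intro SUP_least emeasure_mono) auto
qed

text \<open>\<open>C\<close> is any Borel set containing the midpoints, since the Minkowski sum of
  two Borel sets may fail to be Borel.\<close>

lemma brunn_minkowski_real:
  fixes A B :: "real set"
  assumes A: "A \<in> sets lborel" "A \<noteq> {}" and B: "B \<in> sets lborel" "B \<noteq> {}" and C: "C \<in> sets lborel"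
    and sub: "\<And>a b. a \<in> A \<Longrightarrow> b \<in> B \<Longrightarrow> (a + b) / 2 \<in> C"
  shows "emeasure lborel A + emeasure lborel B \<le> 2 * emeasure lborel C"
proof -
  obtain a b where ab: "a \<in> A" "b \<in> B" using A B by blast
  have K: "emeasure lborel K + emeasure lborel L \<le> 2 * emeasure lborel C"
    if "compact K" "K \<subseteq> A" "compact L" "L \<subseteq> B" for K L
  proof -
    \<comment> \<open>Adjoining one point of each set keeps the compact sets nonempty without
      leaving \<open>A\<close> and \<open>B\<close>.\<close>
    have "emeasure lborel K + emeasure lborel L \<le> emeasure lborel (insert a K) + emeasure lborel (insert b L)"
      using that by (intro add_mono emeasure_mono) (auto simp: borel_compact)
    also have "\<dots> \<le> 2 * emeasure lborel C"
      using that ab by (intro brunn_minkowski_compact_real C sub compact_insert) auto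
    finally show ?thesis .
  qed
  have ne: "{K. compact K \<and> K \<subseteq> X} \<noteq> {}" for X :: "real set" by blast
  show ?thesis
    unfolding emeasure_lborel_inner_compact[OF A(1)] emeasure_lborel_inner_compact[OF B(1)]
      ennreal_SUP_add_left[OF ne, symmetric] ennreal_SUP_add_right[OF ne]
    by (intro SUP_least) (use K in auto)
qed


section \<open>Layer cake formula and the Prekopa-Leindler inequality on the line\<close>

lemma nn_integral_layer_cake:
  assumes "sigma_finite_measure M" and f[measurable]: "f \<in> borel_measurable M"
  shows "(\<integral>\<^sup>+x. f x \<partial>M) = (\<integral>\<^sup>+t. emeasure M {x \<in> space M. 0 < t \<and> ennreal t < f x} \<partial>lborel)"
proof -
  interpret sigma_finite_measure M by fact
  interpret pair_sigma_finite M lborel ..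
  \<comment> \<open>The condition \<open>0 < t\<close> is written out because
    \<open>ennreal t\<close> is 0 for every t \<le> 0, which would add a half line of levels
    wherever \<open>f\<close> is positive.\<close>
  have slice: "f x = (\<integral>\<^sup>+t. indicator {t. 0 < t \<and> ennreal t < f x} t \<partial>lborel)" for x
  proof (cases "f x")
    case (real r)
    then have "{t. 0 < t \<and> ennreal t < f x} = {0<..<r}" by (auto simp: ennreal_less_iff)
    then show ?thesis using real by simp
  next
    case top
    then have "{t. 0 < t \<and> ennreal t < f x} = {0<..}" by auto
    moreover have "emeasure lborel {0::real<..} = top"
    proof (rule ccontr)
      assume "emeasure lborel {0::real<..} \<noteq> top"
      then obtain r where r: "emeasure lborel {0::real<..} = ennreal r" "0 \<le> r"
        by (cases "emeasure lborel {0::real<..}") auto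
      have "emeasure lborel {0<..<r + 1} \<le> emeasure lborel {0::real<..}"
        by (intro emeasure_mono) auto
      then show False using r by (simp add: ennreal_le_iff del: ennreal_plus)
    qed
    ultimately show ?thesis using top by simp
  qed
  have "(\<integral>\<^sup>+x. f x \<partial>M) = (\<integral>\<^sup>+x. (\<integral>\<^sup>+t. indicator {t. 0 < t \<and> ennreal t < f x} t \<partial>lborel) \<partial>M)"
    by (rule nn_integral_cong) (rule slice)
  also have "\<dots> = (\<integral>\<^sup>+t. (\<integral>\<^sup>+x. indicator {t. 0 < t \<and> ennreal t < f x} t \<partial>M) \<partial>lborel)"
  proof -
    have [measurable]: "(\<lambda>z. indicator {t. 0 < t \<and> ennreal t < f (fst z)} (snd z) :: ennreal)
        \<in> borel_measurable (M \<Otimes>\<^sub>M lborel)"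
      unfolding indicator_def by measurable
    show ?thesis by (rule Fubini'[symmetric]) (simp add: case_prod_beta')
  qed
  also have "\<dots> = (\<integral>\<^sup>+t. emeasure M {x \<in> space M. 0 < t \<and> ennreal t < f x} \<partial>lborel)"
  proof (rule nn_integral_cong)
    fix t :: real
    have "(\<integral>\<^sup>+x. indicator {t. 0 < t \<and> ennreal t < f x} t \<partial>M)
        = (\<integral>\<^sup>+x. indicator {x \<in> space M. 0 < t \<and> ennreal t < f x} x \<partial>M)"
      by (rule nn_integral_cong) (simp add: indicator_def)
    then show "(\<integral>\<^sup>+x. indicator {t. 0 < t \<and> ennreal t < f x} t \<partial>M)
        = emeasure M {x \<in> space M. 0 < t \<and> ennreal t < f x}" by simp
  qed
  finally show ?thesis .
qed

text \<open>Superlevel sets on the line bound a sum of integrals, whereas the product form is the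
  one that can be iterated over coordinates.\<close>

lemma ennreal_amgm:
  fixes a b c :: ennreal
  assumes "a + b \<le> 2 * c"
  shows "a * b \<le> c\<^sup>2"
proof (cases c)
  case top
  then show ?thesis by (simp add: power2_eq_square)
next
  case (real r)
  then have "a + b \<le> ennreal (2 * r)" using assms by (simp add: ennreal_mult)
  then have "a < top" "b < top"
    by (metis add_increasing2 ennreal_less_top le_less_trans zero_le add_increasing order_refl)+
  then obtain x y where xy: "a = ennreal x" "b = ennreal y" "0 \<le> x" "0 \<le> y"
    by (metis ennreal_enn2real enn2real_nonneg)
  have "x + y \<le> 2 * r"
    using \<open>a + b \<le> ennreal (2 * r)\<close> xy real by (simp flip: ennreal_plus)
  then have "(x + y)\<^sup>2 \<le> (2 * r)\<^sup>2" using xy by (intro power_mono) auto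
  moreover have "4 * (x * y) \<le> (x + y)\<^sup>2"
    using zero_le_power2[of "x - y"] by (simp add: power2_eq_square algebra_simps)
  ultimately have "x * y \<le> r\<^sup>2" by (simp add: power_mult_distrib)
  then show ?thesis using xy real by (simp add: ennreal_power flip: ennreal_mult)
qed

text \<open>The hypothesis and the conclusion are squared because \<^typ>\<open>ennreal\<close> has no square root.\<close>

definition prekopa_leindler :: "'a measure \<Rightarrow> ('a \<Rightarrow> 'a \<Rightarrow> 'a) \<Rightarrow> bool" where
  "prekopa_leindler M mid \<longleftrightarrow> (\<forall>x\<in>space M. \<forall>y\<in>space M. mid x y \<in> space M) \<and>
     (\<forall>f\<in>borel_measurable M. \<forall>g\<in>borel_measurable M. \<forall>h\<in>borel_measurable M.
       (\<forall>x\<in>space M. \<forall>y\<in>space M. f x * g y \<le> (h (mid x y) :: ennreal)\<^sup>2) \<longrightarrow>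
       (\<integral>\<^sup>+x. f x \<partial>M) * (\<integral>\<^sup>+x. g x \<partial>M) \<le> (\<integral>\<^sup>+x. h x \<partial>M)\<^sup>2)"

lemma prekopa_leindlerD:
  assumes "prekopa_leindler M mid" "f \<in> borel_measurable M" "g \<in> borel_measurable M"
    "h \<in> borel_measurable M"
    "\<And>x y. x \<in> space M \<Longrightarrow> y \<in> space M \<Longrightarrow> f x * g y \<le> (h (mid x y) :: ennreal)\<^sup>2"
  shows "(\<integral>\<^sup>+x. f x \<partial>M) * (\<integral>\<^sup>+x. g x \<partial>M) \<le> (\<integral>\<^sup>+x. h x \<partial>M)\<^sup>2"
  using assms unfolding prekopa_leindler_def by blast

text \<open>Brunn-Minkowski needs both sets nonempty. With both suprema equal to 1, the superlevel
  sets of \<open>f\<close> and \<open>g\<close> are nonempty for the same levels, those below 1, and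
  midpoints of their points lie in the superlevel set of \<open>h\<close>. The layer cake formula
  integrates this over the level.\<close>

lemma prekopa_leindler_lborel_normalized:
  fixes f g h :: "real \<Rightarrow> ennreal"
  assumes [measurable]: "f \<in> borel_measurable lborel" "g \<in> borel_measurable lborel"
      "h \<in> borel_measurable lborel"
    and f1: "(SUP x. f x) = 1" and g1: "(SUP x. g x) = 1"
    and fgh: "\<And>x y. f x * g y \<le> (h ((x + y) / 2))\<^sup>2"
  shows "(\<integral>\<^sup>+x. f x \<partial>lborel) * (\<integral>\<^sup>+x. g x \<partial>lborel) \<le> (\<integral>\<^sup>+x. h x \<partial>lborel)\<^sup>2"
proof (rule ennreal_amgm)
  let ?L = "\<lambda>f t. {x \<in> space lborel. 0 < t \<and> ennreal t < (f x :: ennreal)}"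
  have f_le: "f x \<le> 1" and g_le: "g x \<le> 1" for x
    using f1 g1 by (metis SUP_upper UNIV_I)+
  have "emeasure lborel (?L f t) + emeasure lborel (?L g t) \<le> 2 * emeasure lborel (?L h t)" for t
  proof (cases "0 < t \<and> t < 1")
    case True
    then have t: "ennreal t < 1" by (simp add: ennreal_less_iff flip: ennreal_1)
    show ?thesis
    proof (rule brunn_minkowski_real)
      show "?L f t \<noteq> {}" "?L g t \<noteq> {}"
        using t True less_SUP_iff[of "ennreal t" f UNIV] less_SUP_iff[of "ennreal t" g UNIV]
        unfolding f1 g1 by auto
      fix a b assume "a \<in> ?L f t" "b \<in> ?L g t"
      then have ab: "ennreal t < f a" "ennreal t < g b" by auto
      have "f a < top" "g b < top"
        using f_le g_le by (metis ennreal_one_less_top le_less_trans)+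
      then obtain p q where pq: "f a = ennreal p" "g b = ennreal q" "0 \<le> p" "0 \<le> q"
        by (metis ennreal_enn2real enn2real_nonneg)
      have "t < p" "t < q" using ab pq True by (auto simp: ennreal_less_iff)
      then have "t * t < p * q" using True by (intro mult_strict_mono) auto
      then have "(ennreal t)\<^sup>2 < f a * g b"
        using True pq by (simp add: ennreal_power ennreal_less_iff power2_eq_square flip: ennreal_mult)
      also have "\<dots> \<le> (h ((a + b) / 2))\<^sup>2" by (rule fgh)
      finally have "ennreal t < h ((a + b) / 2)"
        by (meson linorder_not_le power_mono zero_le)
      then show "(a + b) / 2 \<in> ?L h t" using True by simp
    qed measurable
  next
    \<comment> \<open>For t \<le> 0 the sets are empty by definition, and for t \<ge> 1 because
      \<open>f\<close> and \<open>g\<close> are at most 1.\<close>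
    case False
    then have "?L f t = {}" "?L g t = {}"
    proof -
      have "\<not> ennreal t < f x" "\<not> ennreal t < g x" if "0 < t" for x
      proof -
        have "1 \<le> ennreal t" using False that by (metis ennreal_1 ennreal_leI not_le)
        then show "\<not> ennreal t < f x" "\<not> ennreal t < g x"
          using f_le[of x] g_le[of x] by (meson leD le_less_trans order_trans)+
      qed
      then show "?L f t = {}" "?L g t = {}" by auto
    qed
    then show ?thesis by (simp only: emeasure_empty) simp
  qed
  then have "(\<integral>\<^sup>+t. (emeasure lborel (?L f t) + emeasure lborel (?L g t)) \<partial>lborel)
      \<le> (\<integral>\<^sup>+t. 2 * emeasure lborel (?L h t) \<partial>lborel)"
    by (intro nn_integral_mono)
  then show "(\<integral>\<^sup>+x. f x \<partial>lborel) + (\<integral>\<^sup>+x. g x \<partial>lborel) \<le> 2 * (\<integral>\<^sup>+x. h x \<partial>lborel)"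
    by (subst (1 2 3) nn_integral_layer_cake) (auto simp: nn_integral_add nn_integral_cmult sigma_finite_lborel)
qed

lemma prekopa_leindler_lborel_bounded:
  fixes f g h :: "real \<Rightarrow> ennreal"
  assumes [measurable]: "f \<in> borel_measurable lborel" "g \<in> borel_measurable lborel"
      "h \<in> borel_measurable lborel"
    and fb: "(SUP x. f x) < top" and gb: "(SUP x. g x) < top"
    and fgh: "\<And>x y. f x * g y \<le> (h ((x + y) / 2))\<^sup>2"
  shows "(\<integral>\<^sup>+x. f x \<partial>lborel) * (\<integral>\<^sup>+x. g x \<partial>lborel) \<le> (\<integral>\<^sup>+x. h x \<partial>lborel)\<^sup>2"
proof (cases "(SUP x. f x) = 0 \<or> (SUP x. g x) = 0")
  case True
  then have "(\<forall>x. f x = 0) \<or> (\<forall>x. g x = 0)"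
    by (metis SUP_upper UNIV_I le_zero_eq)
  then show ?thesis by auto
next
  case False
  obtain a b where ab: "(SUP x. f x) = ennreal a" "(SUP x. g x) = ennreal b" "0 \<le> a" "0 \<le> b"
    using fb gb by (metis ennreal_enn2real enn2real_nonneg)
  have pos: "0 < a" "0 < b" using False ab by (auto simp: less_le)
  \<comment> \<open>Scaling \<open>f\<close> by 1 / a and \<open>g\<close> by 1 / b forces
    \<open>h\<close> to be scaled by the inverse geometric mean, so that the squared hypothesis
    persists.\<close>
  define c where "c = sqrt (a * b)"
  have c: "0 < c" "c * c = a * b" using pos by (auto simp: c_def)
  let ?f = "\<lambda>x. ennreal (1/a) * f x" and ?g = "\<lambda>x. ennreal (1/b) * g x"
  let ?h = "\<lambda>x. ennreal (1/c) * h x"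
  have e: "ennreal (1/a) * ennreal (1/b) = (ennreal (1/c))\<^sup>2"
    using pos c by (simp add: power2_eq_square flip: ennreal_mult)
  have "(\<integral>\<^sup>+x. ?f x \<partial>lborel) * (\<integral>\<^sup>+x. ?g x \<partial>lborel) \<le> (\<integral>\<^sup>+x. ?h x \<partial>lborel)\<^sup>2"
  proof (rule prekopa_leindler_lborel_normalized)
    show "(SUP x. ?f x) = 1" "(SUP x. ?g x) = 1"
      using ab pos by (simp_all add: SUP_mult_left_ennreal[symmetric] flip: ennreal_mult)
    fix x y
    have "?f x * ?g y = (ennreal (1/a) * ennreal (1/b)) * (f x * g y)" by (simp add: mult_ac)
    also have "\<dots> \<le> (ennreal (1/c))\<^sup>2 * (h ((x + y) / 2))\<^sup>2"
      unfolding e by (intro mult_left_mono fgh) simp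
    finally show "?f x * ?g y \<le> (?h ((x + y) / 2))\<^sup>2" by (simp add: power_mult_distrib)
  qed measurable
  then have "(ennreal (1/a) * ennreal (1/b)) * ((\<integral>\<^sup>+x. f x \<partial>lborel) * (\<integral>\<^sup>+x. g x \<partial>lborel))
      \<le> (ennreal (1/c))\<^sup>2 * (\<integral>\<^sup>+x. h x \<partial>lborel)\<^sup>2"
    by (simp add: nn_integral_cmult power_mult_distrib) (simp add: mult_ac)
  then have "(ennreal c)\<^sup>2 * ((ennreal (1/c))\<^sup>2 * ((\<integral>\<^sup>+x. f x \<partial>lborel) * (\<integral>\<^sup>+x. g x \<partial>lborel)))
      \<le> (ennreal c)\<^sup>2 * ((ennreal (1/c))\<^sup>2 * (\<integral>\<^sup>+x. h x \<partial>lborel)\<^sup>2)"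
    unfolding e by (rule mult_left_mono) simp
  moreover have "(ennreal c)\<^sup>2 * (ennreal (1/c))\<^sup>2 = 1"
    using c by (simp flip: power_mult_distrib ennreal_mult)
  ultimately show ?thesis by (simp flip: mult.assoc)
qed

text \<open>Only \<open>f\<close> and \<open>g\<close> are truncated. This lowers the left side of
  the hypothesis, so the same \<open>h\<close> serves every pair of truncation heights, and monotone
  convergence removes them.\<close>

lemma prekopa_leindler_lborel: "prekopa_leindler lborel (\<lambda>x y :: real. (x + y) / 2)"
  unfolding prekopa_leindler_def
proof (intro conjI ballI impI)
  fix f g h :: "real \<Rightarrow> ennreal"
  assume [measurable]: "f \<in> borel_measurable lborel" "g \<in> borel_measurable lborel"
      "h \<in> borel_measurable lborel"
  assume *: "\<forall>x\<in>space lborel. \<forall>y\<in>space lborel. f x * g y \<le> (h ((x + y) / 2))\<^sup>2"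
  have trunc: "(\<integral>\<^sup>+x. k x \<partial>lborel) = (SUP n. \<integral>\<^sup>+x. min (k x) (of_nat n) \<partial>lborel)"
    if [measurable]: "k \<in> borel_measurable lborel" for k :: "real \<Rightarrow> ennreal"
  proof -
    have "(SUP n. min (k x) (of_nat n)) = k x" for x
    proof -
      have "(SUP n. min (k x) (of_nat n)) = min (k x) (SUP n. of_nat n)"
        by (simp add: inf_min[symmetric] inf_SUP)
      then show ?thesis by (simp add: ennreal_SUP_of_nat_eq_top)
    qed
    then have "(\<integral>\<^sup>+x. k x \<partial>lborel) = (\<integral>\<^sup>+x. (SUP n. min (k x) (of_nat n)) \<partial>lborel)" by simp
    also have "\<dots> = (SUP n. \<integral>\<^sup>+x. min (k x) (of_nat n) \<partial>lborel)"
      by (intro nn_integral_monotone_convergence_SUP)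
        (auto simp: incseq_def le_fun_def intro!: min.coboundedI2 of_nat_mono)
    finally show ?thesis .
  qed
  have fin: "(SUP x. min (k x) (of_nat n)) < (top::ennreal)" for k :: "real \<Rightarrow> ennreal" and n
  proof -
    have "(SUP x. min (k x) (of_nat n)) \<le> (of_nat n :: ennreal)" by (intro SUP_least) simp
    then show ?thesis by (rule le_less_trans) (rule of_nat_less_top)
  qed
  have "(\<integral>\<^sup>+x. min (f x) (of_nat n) \<partial>lborel) * (\<integral>\<^sup>+x. min (g x) (of_nat m) \<partial>lborel)
      \<le> (\<integral>\<^sup>+x. h x \<partial>lborel)\<^sup>2" for n m
  proof (rule prekopa_leindler_lborel_bounded)
    fix x y
    have "min (f x) (of_nat n) * min (g y) (of_nat m) \<le> f x * g y" by (intro mult_mono) auto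
    also have "\<dots> \<le> (h ((x + y) / 2))\<^sup>2" using * by simp
    finally show "min (f x) (of_nat n) * min (g y) (of_nat m) \<le> (h ((x + y) / 2))\<^sup>2" .
  qed (use fin in auto)
  then show "(\<integral>\<^sup>+x. f x \<partial>lborel) * (\<integral>\<^sup>+x. g x \<partial>lborel) \<le> (\<integral>\<^sup>+x. h x \<partial>lborel)\<^sup>2"
    by (subst (1 2) trunc) (auto simp: SUP_mult_left_ennreal SUP_mult_right_ennreal intro!: SUP_least)
qed simp

section \<open>Products and images of measures with the Prekopa-Leindler property\<close>

lemma prekopa_leindler_pair:
  assumes "sigma_finite_measure M" "sigma_finite_measure N"
    and M: "prekopa_leindler M midM" and N: "prekopa_leindler N midN"
  shows "prekopa_leindler (M \<Otimes>\<^sub>M N) (\<lambda>x y. (midM (fst x) (fst y), midN (snd x) (snd y)))"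
  unfolding prekopa_leindler_def
proof (intro conjI ballI impI)
  interpret N: sigma_finite_measure N by fact
  have mid: "midM x y \<in> space M" if "x \<in> space M" "y \<in> space M" for x y
    using M that by (auto simp: prekopa_leindler_def)
  show "(midM (fst x) (fst y), midN (snd x) (snd y)) \<in> space (M \<Otimes>\<^sub>M N)"
    if "x \<in> space (M \<Otimes>\<^sub>M N)" "y \<in> space (M \<Otimes>\<^sub>M N)" for x y
    using that M N by (auto simp: space_pair_measure prekopa_leindler_def)
  fix f g h :: "_ \<Rightarrow> ennreal"
  assume [measurable]: "f \<in> borel_measurable (M \<Otimes>\<^sub>M N)" "g \<in> borel_measurable (M \<Otimes>\<^sub>M N)"
      "h \<in> borel_measurable (M \<Otimes>\<^sub>M N)"
  assume *: "\<forall>x\<in>space (M \<Otimes>\<^sub>M N). \<forall>y\<in>space (M \<Otimes>\<^sub>M N).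
      f x * g y \<le> (h (midM (fst x) (fst y), midN (snd x) (snd y)))\<^sup>2"
  have "(\<integral>\<^sup>+x. \<integral>\<^sup>+y. f (x, y) \<partial>N \<partial>M) * (\<integral>\<^sup>+x. \<integral>\<^sup>+y. g (x, y) \<partial>N \<partial>M)
      \<le> (\<integral>\<^sup>+x. \<integral>\<^sup>+y. h (x, y) \<partial>N \<partial>M)\<^sup>2"
  proof (rule prekopa_leindlerD[OF M])
    \<comment> \<open>The inequality on \<open>N\<close> says exactly that the fibre integrals
      satisfy the hypothesis of the inequality on \<open>M\<close>.\<close>
    fix x x' assume [measurable]: "x \<in> space M" "x' \<in> space M"
    have [measurable]: "midM x x' \<in> space M" by (intro mid) fact+
    show "(\<integral>\<^sup>+y. f (x, y) \<partial>N) * (\<integral>\<^sup>+y. g (x', y) \<partial>N) \<le> (\<integral>\<^sup>+y. h (midM x x', y) \<partial>N)\<^sup>2"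
    proof (rule prekopa_leindlerD[OF N])
      fix y y' assume "y \<in> space N" "y' \<in> space N"
      then show "f (x, y) * g (x', y') \<le> (h (midM x x', midN y y'))\<^sup>2"
        using *[rule_format, of "(x, y)" "(x', y')"] \<open>x \<in> space M\<close> \<open>x' \<in> space M\<close>
        by (simp add: space_pair_measure)
    qed measurable
  qed measurable
  then show "(\<integral>\<^sup>+x. f x \<partial>(M \<Otimes>\<^sub>M N)) * (\<integral>\<^sup>+x. g x \<partial>(M \<Otimes>\<^sub>M N)) \<le> (\<integral>\<^sup>+x. h x \<partial>(M \<Otimes>\<^sub>M N))\<^sup>2"
    by (simp add: N.nn_integral_fst)
qed

text \<open>This moves the inequality from extensional functions to \<open>carrier_vec\<close>;
  surjectivity makes the target space closed under \<open>midN\<close>.\<close>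

lemma prekopa_leindler_distr:
  assumes M: "prekopa_leindler M midM" and T[measurable]: "T \<in> measurable M N"
    and mid: "\<And>x y. x \<in> space M \<Longrightarrow> y \<in> space M \<Longrightarrow> T (midM x y) = midN (T x) (T y)"
    and surj: "T ` space M = space N"
  shows "prekopa_leindler (distr M N T) midN"
  unfolding prekopa_leindler_def
proof (intro conjI ballI impI)
  show "midN x y \<in> space (distr M N T)" if "x \<in> space (distr M N T)" "y \<in> space (distr M N T)" for x y
  proof -
    from that have "x \<in> T ` space M" "y \<in> T ` space M" unfolding surj by simp_all
    then obtain x' y' where "x' \<in> space M" "y' \<in> space M" "x = T x'" "y = T y'" by blast
    then show ?thesis
      using M mid[of x' y'] measurable_space[OF T, of "midM x' y'"]
      by (simp add: prekopa_leindler_def)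
  qed
  fix f g h :: "_ \<Rightarrow> ennreal"
  assume "f \<in> borel_measurable (distr M N T)" "g \<in> borel_measurable (distr M N T)"
      "h \<in> borel_measurable (distr M N T)"
  then have [measurable]: "f \<in> borel_measurable N" "g \<in> borel_measurable N" "h \<in> borel_measurable N"
    by simp_all
  assume *: "\<forall>x\<in>space (distr M N T). \<forall>y\<in>space (distr M N T). f x * g y \<le> (h (midN x y))\<^sup>2"
  have "(\<integral>\<^sup>+x. f (T x) \<partial>M) * (\<integral>\<^sup>+x. g (T x) \<partial>M) \<le> (\<integral>\<^sup>+x. h (T x) \<partial>M)\<^sup>2"
    by (rule prekopa_leindlerD[OF M]) (use * surj mid in \<open>auto\<close>)
  then show "(\<integral>\<^sup>+x. f x \<partial>distr M N T) * (\<integral>\<^sup>+x. g x \<partial>distr M N T) \<le> (\<integral>\<^sup>+x. h x \<partial>distr M N T)\<^sup>2"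
    by (simp add: nn_integral_distr)
qed

lemma prekopa_leindler_PiM_lborel:
  assumes "finite I"
  shows "prekopa_leindler (\<Pi>\<^sub>M i\<in>I. lborel) (\<lambda>x y i. (x i + y i) / (2::real))"
  using assms
proof (induction I)
  case empty
  show ?case
    unfolding prekopa_leindler_def by (auto simp: PiM_empty nn_integral_count_space_finite)
next
  case (insert i I)
  interpret product_sigma_finite "\<lambda>_. lborel :: real measure" ..
  show ?case unfolding prekopa_leindler_def
  proof (intro conjI ballI impI)
    let ?M = "\<Pi>\<^sub>M i\<in>I. lborel :: real measure" and ?M' = "\<Pi>\<^sub>M i\<in>insert i I. lborel :: real measure"
    \<comment> \<open>Off the index set both entries are \<open>undefined\<close>, and the average
      of \<open>undefined\<close> with itself is \<open>undefined\<close>, so the midpoint is again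
      extensional.\<close>
    show "(\<lambda>i. (x i + y i) / 2) \<in> space ?M'" if "x \<in> space ?M'" "y \<in> space ?M'" for x y :: "_ \<Rightarrow> real"
      using that by (auto simp: space_PiM PiE_def extensional_def)
    fix f g h :: "_ \<Rightarrow> ennreal"
    assume [measurable]: "f \<in> borel_measurable ?M'" "g \<in> borel_measurable ?M'" "h \<in> borel_measurable ?M'"
    assume *: "\<forall>x\<in>space ?M'. \<forall>y\<in>space ?M'. f x * g y \<le> (h (\<lambda>i. (x i + y i) / 2))\<^sup>2"
    have sp: "x(i := r) \<in> space ?M'" if "x \<in> space ?M" for x :: "_ \<Rightarrow> real" and r
      using that by (auto simp: space_PiM PiE_def extensional_def)
    have "(\<integral>\<^sup>+x. \<integral>\<^sup>+r. f (x(i := r)) \<partial>lborel \<partial>?M) * (\<integral>\<^sup>+x. \<integral>\<^sup>+r. g (x(i := r)) \<partial>lborel \<partial>?M)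
      \<le> (\<integral>\<^sup>+x. \<integral>\<^sup>+r. h (x(i := r)) \<partial>lborel \<partial>?M)\<^sup>2"
    proof (rule prekopa_leindlerD[OF insert.IH])
      fix x y :: "_ \<Rightarrow> real" assume x: "x \<in> space ?M" and y: "y \<in> space ?M"
      have m: "(\<lambda>i. (x i + y i) / 2) \<in> space ?M"
        using insert.IH x y by (simp add: prekopa_leindler_def)
      have [measurable]: "(\<lambda>r. z(i := r)) \<in> measurable lborel ?M'" if "z \<in> space ?M" for z
        using measurable_component_update[OF that insert.hyps(2)] .
      note [measurable] = x y m
      show "(\<integral>\<^sup>+r. f (x(i := r)) \<partial>lborel) * (\<integral>\<^sup>+r. g (y(i := r)) \<partial>lborel)
          \<le> (\<integral>\<^sup>+r. h ((\<lambda>i. (x i + y i) / 2)(i := r)) \<partial>lborel)\<^sup>2"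
      proof (rule prekopa_leindlerD[OF prekopa_leindler_lborel])
        fix r s :: real
        have "f (x(i := r)) * g (y(i := s)) \<le> (h (\<lambda>j. ((x(i := r)) j + (y(i := s)) j) / 2))\<^sup>2"
          using * sp x y by blast
        also have "(\<lambda>j. ((x(i := r)) j + (y(i := s)) j) / 2) = (\<lambda>i. (x i + y i) / 2)(i := (r + s) / 2)"
          by auto
        finally show "f (x(i := r)) * g (y(i := s)) \<le> (h ((\<lambda>i. (x i + y i) / 2)(i := (r + s) / 2)))\<^sup>2" .
      qed measurable
    qed measurable
    then show "(\<integral>\<^sup>+x. f x \<partial>?M') * (\<integral>\<^sup>+x. g x \<partial>?M') \<le> (\<integral>\<^sup>+x. h x \<partial>?M')\<^sup>2"
      using insert.hyps by (simp add: product_nn_integral_insert)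
  qed
qed

section \<open>Lebesgue measure and second-order calculus on coordinate vectors\<close>

lemma inj_on_vec_PiM: "inj_on (vec d) (space (\<Pi>\<^sub>M i\<in>{..<d}. lborel :: real measure))"
proof (rule inj_onI)
  fix x y :: "nat \<Rightarrow> real"
  assume x: "x \<in> space (\<Pi>\<^sub>M i\<in>{..<d}. lborel)" and y: "y \<in> space (\<Pi>\<^sub>M i\<in>{..<d}. lborel)"
    and eq: "vec d x = vec d y"
  show "x = y"
  proof (rule extensionalityI)
    show "x \<in> extensional {..<d}" "y \<in> extensional {..<d}"
      using x y by (auto simp: space_PiM PiE_def)
    show "x i = y i" if "i \<in> {..<d}" for i
      using that eq by (metis index_vec lessThan_iff)
  qed
qed

lemma measurable_vec_leb [measurable]:
  "vec d \<in> measurable (\<Pi>\<^sub>M i\<in>{..<d}. lborel) (leb d)"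
  unfolding leb_def by (rule measurable_embed_measure2'[OF inj_on_vec_PiM])

lemma leb_eq_distr: "leb d = distr (\<Pi>\<^sub>M i\<in>{..<d}. lborel) (leb d) (vec d)"
  unfolding leb_def by (rule embed_measure_eq_distr'[OF inj_on_vec_PiM])

lemma nn_integral_leb:
  assumes "f \<in> borel_measurable (leb d)"
  shows "(\<integral>\<^sup>+u. f u \<partial>leb d) = (\<integral>\<^sup>+x. f (vec d x) \<partial>(\<Pi>\<^sub>M i\<in>{..<d}. lborel))"
  using assms by (subst leb_eq_distr) (simp add: nn_integral_distr)

lemma measurable_vec_index_leb [measurable]:
  assumes "i < d"
  shows "(\<lambda>u. u $ i) \<in> borel_measurable (leb d)"
  unfolding leb_def using assms by (intro measurable_embed_measure1) simp

lemma sigma_finite_leb: "sigma_finite_measure (leb d)"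
proof -
  let ?M = "\<Pi>\<^sub>M i\<in>{..<d}. lborel :: real measure"
  interpret finite_product_sigma_finite "\<lambda>_. lborel :: real measure" "{..<d}" by standard simp
  obtain A where A: "countable A" "A \<subseteq> sets ?M" "\<Union>A = space ?M" "\<forall>a\<in>A. emeasure ?M a \<noteq> \<infinity>"
    using sigma_finite_countable by blast
  show ?thesis
  proof
    show "\<exists>A. countable A \<and> A \<subseteq> sets (leb d) \<and> \<Union>A = space (leb d) \<and> (\<forall>a\<in>A. emeasure (leb d) a \<noteq> \<infinity>)"
    proof (intro exI[of _ "(`) (vec d) ` A"] conjI ballI)
      show "(`) (vec d) ` A \<subseteq> sets (leb d)"
        using A(2) by (auto simp: leb_def intro: in_sets_embed_measure)
      show "\<Union> ((`) (vec d) ` A) = space (leb d)"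
        using A(3) by (auto simp: leb_def space_embed_measure)
      fix a assume "a \<in> (`) (vec d) ` A"
      then obtain b where b: "b \<in> A" "a = vec d ` b" by auto
      then have "emeasure (leb d) a = emeasure ?M b"
        using A(2) unfolding leb_def by (auto intro!: emeasure_embed_measure_image' inj_on_vec_PiM)
      then show "emeasure (leb d) a \<noteq> \<infinity>" using A(4) b by simp
    qed (use A in simp)
  qed
qed

definition vec_mid :: "real vec \<Rightarrow> real vec \<Rightarrow> real vec" where
  "vec_mid x y = (1/2) \<cdot>\<^sub>v (x + y)"

lemma vec_mid_carrier [simp]:
  "x \<in> carrier_vec d \<Longrightarrow> y \<in> carrier_vec d \<Longrightarrow> vec_mid x y \<in> carrier_vec d"
  by (simp add: vec_mid_def)

lemma prekopa_leindler_leb: "prekopa_leindler (leb d) vec_mid"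
proof -
  have "prekopa_leindler (distr (\<Pi>\<^sub>M i\<in>{..<d}. lborel) (leb d) (vec d)) vec_mid"
  proof (rule prekopa_leindler_distr[OF prekopa_leindler_PiM_lborel])
    show "vec d ` space (\<Pi>\<^sub>M i\<in>{..<d}. lborel) = space (leb d)"
      by (simp add: leb_def space_embed_measure)
    show "vec d (\<lambda>i. (x i + y i) / 2) = vec_mid (vec d x) (vec d y)" for x y :: "nat \<Rightarrow> real"
      by (intro eq_vecI) (auto simp: vec_mid_def)
  qed auto
  then show ?thesis by (simp flip: leb_eq_distr)
qed

section \<open>Topology of coordinate vectors and derivatives along lines\<close>

lemma topspace_euclid [simp]: "topspace (euclid d) = carrier_vec d"
  unfolding euclid_def by (rule Metric_space.topspace_mtopology[OF Metric_space_euclid])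

text \<open>Coordinate arguments need boxes rather than balls. The distance is at most the sum of
  the \<open>d\<close> coordinate errors, and dividing \<open>r\<close> by d + 1 makes that sum
  strictly smaller than \<open>r\<close>, also for d = 0.\<close>

lemma openin_euclid_box:
  assumes "openin (euclid d) U" "z \<in> U"
  obtains e where "e > 0"
    "\<And>y. y \<in> carrier_vec d \<Longrightarrow> (\<And>i. i < d \<Longrightarrow> \<bar>y $ i - z $ i\<bar> < e) \<Longrightarrow> y \<in> U"
proof -
  interpret Metric_space "carrier_vec d" "\<lambda>x y :: real vec. L2_set (\<lambda>i. x $ i - y $ i) {..<d}"
    by (rule Metric_space_euclid)
  obtain r where r: "r > 0" "mball z r \<subseteq> U" and U: "U \<subseteq> carrier_vec d"
    using assms unfolding euclid_def openin_mtopology by blast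
  show thesis
  proof (rule that[of "r / (real d + 1)"])
    show "0 < r / (real d + 1)" using r by simp
    fix y :: "real vec" assume y: "y \<in> carrier_vec d" and
      le: "\<And>i. i < d \<Longrightarrow> \<bar>y $ i - z $ i\<bar> < r / (real d + 1)"
    have "L2_set (\<lambda>i. z $ i - y $ i) {..<d} \<le> (\<Sum>i<d. \<bar>z $ i - y $ i\<bar>)"
      by (rule L2_set_le_sum_abs)
    also have "\<dots> \<le> (\<Sum>i<d. r / (real d + 1))"
      using le by (intro sum_mono) (auto simp: abs_minus_commute less_imp_le)
    also have "\<dots> < r" using r by (simp add: field_simps)
    finally have "y \<in> mball z r" using y U assms(2) by auto
    then show "y \<in> U" using r by blast
  qed
qed

lemma emeasure_leb_box:
  "emeasure (leb d) (vec d ` (PiE {..<d} (\<lambda>i. {a i<..<b i}))) = (\<Prod>i<d. emeasure lborel {a i<..<b i})"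
  "vec d ` (PiE {..<d} (\<lambda>i. {a i<..<b i :: real})) \<in> sets (leb d)"
proof -
  interpret finite_product_sigma_finite "\<lambda>_. lborel :: real measure" "{..<d}" by standard simp
  have s: "PiE {..<d} (\<lambda>i. {a i<..<b i}) \<in> sets (\<Pi>\<^sub>M i\<in>{..<d}. lborel :: real measure)"
    by (intro sets_PiM_I_finite) auto
  then show "vec d ` (PiE {..<d} (\<lambda>i. {a i<..<b i})) \<in> sets (leb d)"
    unfolding leb_def by (rule in_sets_embed_measure)
  show "emeasure (leb d) (vec d ` (PiE {..<d} (\<lambda>i. {a i<..<b i}))) = (\<Prod>i<d. emeasure lborel {a i<..<b i})"
    unfolding leb_def using s
    by (subst emeasure_embed_measure_image'[OF inj_on_vec_PiM]) (auto simp: measure_times)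
qed

text \<open>This converts nonempty interiors of the chart domains into positive partition functions
  and positive fibre integrals.\<close>

lemma emeasure_leb_pos:
  assumes "S \<in> sets (leb d)" "(euclid d) interior_of S \<noteq> {}"
  shows "0 < emeasure (leb d) S"
proof -
  obtain z where z: "z \<in> (euclid d) interior_of S" using assms(2) by blast
  have o: "openin (euclid d) ((euclid d) interior_of S)" by simp
  have zc: "z \<in> carrier_vec d" using openin_subset[OF o] z by auto
  obtain e where e: "e > 0"
    "\<And>y. y \<in> carrier_vec d \<Longrightarrow> (\<And>i. i < d \<Longrightarrow> \<bar>y $ i - z $ i\<bar> < e) \<Longrightarrow> y \<in> (euclid d) interior_of S"
    using openin_euclid_box[OF o z] by metis
  let ?B = "vec d ` (PiE {..<d} (\<lambda>i. {z $ i - e<..<z $ i + e}))"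
  have "?B \<subseteq> (euclid d) interior_of S"
  proof
    fix y assume "y \<in> ?B"
    then obtain x where x: "y = vec d x" "x \<in> PiE {..<d} (\<lambda>i. {z $ i - e<..<z $ i + e})" by blast
    have "\<bar>y $ i - z $ i\<bar> < e" if "i < d" for i
      using PiE_mem[OF x(2), of i] that x(1) by (auto simp: abs_less_iff)
    then show "y \<in> (euclid d) interior_of S" using e(2)[of y] x(1) by simp
  qed
  then have "?B \<subseteq> S" by (rule subset_trans) (rule interior_of_subset)
  then have "emeasure (leb d) ?B \<le> emeasure (leb d) S" using assms(1) by (intro emeasure_mono)
  moreover have "0 < emeasure (leb d) ?B"
    using e(1) by (simp add: emeasure_leb_box prod_ennreal ennreal_power)
  ultimately show ?thesis by (rule order_less_le_trans[rotated])
qed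

lemma limitin_euclid:
  assumes "z \<in> carrier_vec d" "eventually (\<lambda>s. p s \<in> carrier_vec d) F"
    and lim: "\<And>i. i < d \<Longrightarrow> ((\<lambda>s. p s $ i) \<longlongrightarrow> z $ i) F"
  shows "limitin (euclid d) p z F"
proof -
  interpret Metric_space "carrier_vec d" "\<lambda>x y :: real vec. L2_set (\<lambda>i. x $ i - y $ i) {..<d}"
    by (rule Metric_space_euclid)
  have *: "((\<lambda>s. \<Sum>i<d. \<bar>p s $ i - z $ i\<bar>) \<longlongrightarrow> (\<Sum>i<d. 0)) F"
    by (intro tendsto_sum tendsto_rabs_zero Lim_null[THEN iffD1] lim) auto
  have "((\<lambda>s. L2_set (\<lambda>i. p s $ i - z $ i) {..<d}) \<longlongrightarrow> 0) F"
    by (rule tendsto_sandwich[OF _ _ tendsto_const *[simplified]]) (auto simp: L2_set_le_sum_abs)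
  then show ?thesis
    using assms unfolding euclid_def limitin_metric_dist_null by simp
qed

text \<open>\<open>Ck_on\<close> speaks of continuity in a topology, while difference quotients are
  limits along filters; coordinatewise convergence connects the two.\<close>

lemma tendsto_continuous_map_euclid:
  assumes f: "continuous_map (subtopology (euclid d) U) euclideanreal f" and U: "openin (euclid d) U"
    and z: "z \<in> U" and p: "eventually (\<lambda>s. p s \<in> carrier_vec d) F"
    and lim: "\<And>i. i < d \<Longrightarrow> ((\<lambda>s. p s $ i) \<longlongrightarrow> z $ i) F"
  shows "((\<lambda>s. f (p s)) \<longlongrightarrow> f z) F"
proof -
  have "z \<in> carrier_vec d" using openin_subset[OF U] z by auto
  then have l: "limitin (euclid d) p z F" using p lim by (rule limitin_euclid)
  then have "limitin (subtopology (euclid d) U) p z F"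
    using limitinD[OF l U z] z by (simp add: limitin_subtopology)
  from continuous_map_limit[OF f this] show ?thesis by (simp add: o_def)
qed

text \<open>The increments \<open>t * h $ k\<close> can have either sign, and a bound on the
  absolute value of the intermediate point is what squeezes it to 0.\<close>

lemma mvt_symmetric:
  fixes g g' :: "real \<Rightarrow> real"
  assumes "\<And>s. \<bar>s\<bar> \<le> \<bar>c\<bar> \<Longrightarrow> (g has_real_derivative g' s) (at s)"
  shows "\<exists>s. \<bar>s\<bar> \<le> \<bar>c\<bar> \<and> g c - g 0 = c * g' s"
proof (cases c "0 :: real" rule: linorder_cases)
  case less
  obtain z where "c < z" "z < 0" "g 0 - g c = (0 - c) * g' z"
    using MVT2[OF less, of g g'] assms less by auto
  then show ?thesis by (intro exI[of _ z]) auto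
next
  case greater
  obtain z where "0 < z" "z < c" "g c - g 0 = (c - 0) * g' z"
    using MVT2[OF greater, of g g'] assms greater by auto
  then show ?thesis by (intro exI[of _ z]) auto
qed auto

text \<open>Continuity of the partial derivatives gives the derivative along every line; the increment is
  telescoped over the coordinate directions.\<close>

lemma line_derivative:
  assumes U: "openin (euclid d) U" and z: "z \<in> U" and h: "h \<in> carrier_vec d"
    and diff: "\<And>i y. i < d \<Longrightarrow> y \<in> U \<Longrightarrow> (\<lambda>t. f (y + t \<cdot>\<^sub>v unit_vec d i)) differentiable (at 0)"
    and cont: "\<And>i. i < d \<Longrightarrow> continuous_map (subtopology (euclid d) U) euclideanreal (partial_deriv d i f)"
  shows "((\<lambda>t. f (z + t \<cdot>\<^sub>v h)) has_real_derivative (\<Sum>i<d. h $ i * partial_deriv d i f z)) (at 0)"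
proof -
  have zc: "z \<in> carrier_vec d" using openin_subset[OF U] z by auto
  obtain e where e: "e > 0"
    "\<And>y. y \<in> carrier_vec d \<Longrightarrow> (\<And>i. i < d \<Longrightarrow> \<bar>y $ i - z $ i\<bar> < e) \<Longrightarrow> y \<in> U"
    using openin_euclid_box[OF U z] by metis
  define H where "H k = vec d (\<lambda>i. if i < k then h $ i else 0)" for k
  have Hc [simp]: "H k \<in> carrier_vec d" for k by (simp add: H_def)
  have small: "eventually (\<lambda>t. \<forall>i\<in>{..<d}. \<bar>t * h $ i\<bar> < e) (at 0)"
  proof (intro eventually_ball_finite ballI)
    fix i
    have "((\<lambda>t. \<bar>t * h $ i\<bar>) \<longlongrightarrow> \<bar>0 * h $ i\<bar>) (at 0)" by (intro tendsto_intros)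
    then show "eventually (\<lambda>t. \<bar>t * h $ i\<bar> < e) (at 0)" using e(1) by (intro order_tendstoD(2)) auto
  qed simp
  have deriv_at: "((\<lambda>s. f (y + s \<cdot>\<^sub>v unit_vec d k)) has_real_derivative
      partial_deriv d k f (y + s \<cdot>\<^sub>v unit_vec d k)) (at s)"
    if "k < d" "y \<in> carrier_vec d" "y + s \<cdot>\<^sub>v unit_vec d k \<in> U" for y s k
  proof -
    have "((\<lambda>r. f ((y + s \<cdot>\<^sub>v unit_vec d k) + r \<cdot>\<^sub>v unit_vec d k)) has_real_derivative
        partial_deriv d k f (y + s \<cdot>\<^sub>v unit_vec d k)) (at 0)"
      using diff[OF that(1,3)] unfolding partial_deriv_def by (simp add: DERIV_deriv_iff_real_differentiable)
    moreover have "(y + s \<cdot>\<^sub>v unit_vec d k) + r \<cdot>\<^sub>v unit_vec d k = y + (r + s) \<cdot>\<^sub>v unit_vec d k" for r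
      using that(2) by (intro eq_vecI) (auto simp: algebra_simps)
    ultimately show ?thesis
      using DERIV_shift[of "\<lambda>s. f (y + s \<cdot>\<^sub>v unit_vec d k)" _ 0 s] by simp
  qed
  have main: "((\<lambda>t. f (z + t \<cdot>\<^sub>v H k)) has_real_derivative (\<Sum>i<k. h $ i * partial_deriv d i f z)) (at 0)"
    if "k \<le> d" for k
    using that
  proof (induction k)
    case 0
    have "z + t \<cdot>\<^sub>v H 0 = z" for t using zc by (intro eq_vecI) (auto simp: H_def)
    then show ?case by simp
  next
    case (Suc k)
    then have k: "k < d" by simp
    define P where "P t s = z + t \<cdot>\<^sub>v H k + s \<cdot>\<^sub>v unit_vec d k" for t s
    have Pc: "P t s \<in> carrier_vec d" for t s using zc by (simp add: P_def)
    have Pd: "\<bar>P t s $ i - z $ i\<bar> \<le> \<bar>t * h $ i\<bar>" if "\<bar>s\<bar> \<le> \<bar>t * h $ k\<bar>" "i < d" for t s i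
      using that zc k by (auto simp: P_def H_def)
    have PU: "P t s \<in> U" if "\<forall>i\<in>{..<d}. \<bar>t * h $ i\<bar> < e" "\<bar>s\<bar> \<le> \<bar>t * h $ k\<bar>" for t s
      using e(2)[OF Pc] Pd[OF that(2)] that(1) by (meson lessThan_iff order_le_less_trans)
    \<comment> \<open>An intermediate point is chosen for every \<open>t\<close>, with s = 0 outside
      the small range, so that its bound, and hence the limit of \<open>P t (s t)\<close>, holds
      without a side condition.\<close>
    have "\<exists>s. \<bar>s\<bar> \<le> \<bar>t * h $ k\<bar> \<and> ((\<forall>i\<in>{..<d}. \<bar>t * h $ i\<bar> < e) \<longrightarrow>
        f (P t (t * h $ k)) - f (P t 0) = t * h $ k * partial_deriv d k f (P t s))" for t
    proof (cases "\<forall>i\<in>{..<d}. \<bar>t * h $ i\<bar> < e")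
      case True
      have "\<exists>s. \<bar>s\<bar> \<le> \<bar>t * h $ k\<bar> \<and> f (P t (t * h $ k)) - f (P t 0) = t * h $ k * partial_deriv d k f (P t s)"
      proof (rule mvt_symmetric)
        fix s assume "\<bar>s\<bar> \<le> \<bar>t * h $ k\<bar>"
        then show "((\<lambda>s. f (P t s)) has_real_derivative partial_deriv d k f (P t s)) (at s)"
          using deriv_at[OF k, of "z + t \<cdot>\<^sub>v H k" s] PU[OF True, of s] zc by (simp add: P_def)
      qed
      then show ?thesis by blast
    qed (auto intro: exI[of _ 0])
    then obtain s where s: "\<And>t. \<bar>s t\<bar> \<le> \<bar>t * h $ k\<bar>"
      "\<And>t. \<forall>i\<in>{..<d}. \<bar>t * h $ i\<bar> < e \<Longrightarrow>
        f (P t (t * h $ k)) - f (P t 0) = t * h $ k * partial_deriv d k f (P t (s t))"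
      by metis
    have "((\<lambda>t. partial_deriv d k f (P t (s t))) \<longlongrightarrow> partial_deriv d k f z) (at 0)"
    proof (rule tendsto_continuous_map_euclid[OF cont[OF k] U z])
      fix i assume i: "i < d"
      have null: "((\<lambda>t. \<bar>t * h $ i\<bar>) \<longlongrightarrow> \<bar>0 * h $ i\<bar>) (at 0)" by (intro tendsto_intros)
      have "((\<lambda>t. P t (s t) $ i - z $ i) \<longlongrightarrow> 0) (at 0)"
      proof (rule Lim_null_comparison)
        show "\<forall>\<^sub>F t in at 0. norm (P t (s t) $ i - z $ i) \<le> \<bar>t * h $ i\<bar>"
          unfolding real_norm_def by (rule always_eventually, rule allI) (rule Pd[OF s(1) i])
      qed (use null in simp)
      then show "((\<lambda>t. P t (s t) $ i) \<longlongrightarrow> z $ i) (at 0)" by (rule LIM_zero_cancel)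
    qed (simp add: Pc)
    then have "((\<lambda>t. h $ k * partial_deriv d k f (P t (s t))) \<longlongrightarrow> h $ k * partial_deriv d k f z) (at 0)"
      by (rule tendsto_mult_left)
    then have lim: "((\<lambda>t. (f (P t (t * h $ k)) - f (P t 0)) / t) \<longlongrightarrow> h $ k * partial_deriv d k f z) (at 0)"
    proof (rule Lim_transform_eventually)
      show "\<forall>\<^sub>F t in at 0. h $ k * partial_deriv d k f (P t (s t)) = (f (P t (t * h $ k)) - f (P t 0)) / t"
        using small eventually_neq_at_within[of 0] by eventually_elim (simp add: s(2))
    qed
    have P0: "P t 0 = z + t \<cdot>\<^sub>v H k" and P1: "P t (t * h $ k) = z + t \<cdot>\<^sub>v H (Suc k)" for t
      using zc k by (auto simp: P_def H_def less_Suc_eq intro!: eq_vecI)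
    have z0: "z + 0 \<cdot>\<^sub>v H j = z" for j using zc by (intro eq_vecI) (auto simp: H_def)
    have "((\<lambda>t. (f (z + t \<cdot>\<^sub>v H k) - f z) / t) \<longlongrightarrow> (\<Sum>i<k. h $ i * partial_deriv d i f z)) (at 0)"
      using Suc.IH k unfolding DERIV_def by (simp add: z0)
    from tendsto_add[OF this lim]
    show ?case unfolding DERIV_def
      by (simp add: z0 P0 P1 add_divide_distrib[symmetric])
  qed
  have "H d = h" using h by (intro eq_vecI) (auto simp: H_def)
  with main[of d] show ?thesis by simp
qed

lemma Ck_on_Suc_continuous: "Ck_on k d U f \<Longrightarrow> continuous_map (subtopology (euclid d) U) euclideanreal f"
  by (cases k) auto

lemma Ck_on_line_derivative:
  assumes U: "openin (euclid d) U" and f: "Ck_on (Suc k) d U f"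
    and x: "x \<in> carrier_vec d" and h: "h \<in> carrier_vec d" and U': "x + t \<cdot>\<^sub>v h \<in> U"
  shows "((\<lambda>t. f (x + t \<cdot>\<^sub>v h)) has_real_derivative (\<Sum>i<d. h $ i * partial_deriv d i f (x + t \<cdot>\<^sub>v h))) (at t)"
proof -
  have "((\<lambda>s. f ((x + t \<cdot>\<^sub>v h) + s \<cdot>\<^sub>v h)) has_real_derivative
      (\<Sum>i<d. h $ i * partial_deriv d i f (x + t \<cdot>\<^sub>v h))) (at 0)"
    using f by (intro line_derivative[OF U U' h]) (auto intro: Ck_on_Suc_continuous)
  moreover have "(x + t \<cdot>\<^sub>v h) + s \<cdot>\<^sub>v h = x + (s + t) \<cdot>\<^sub>v h" for s
    using x h by (intro eq_vecI) (auto simp: algebra_simps)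
  ultimately show ?thesis using DERIV_shift[of "\<lambda>s. f (x + s \<cdot>\<^sub>v h)" _ 0 t] by simp
qed

text \<open>Differentiating twice along a line leaves the partial taken first, \<open>j\<close>, in
  the outer sum, while the matrix product has \<open>i\<close> there; entry (i, j) of
  \<open>hessian\<close> differentiates in \<open>j\<close> first.\<close>

lemma quadratic_form_hessian:
  assumes "h \<in> carrier_vec d"
  shows "h \<bullet> (hessian d f z *\<^sub>v h)
    = (\<Sum>j<d. h $ j * (\<Sum>i<d. h $ i * partial_deriv d i (partial_deriv d j f) z))"
proof -
  have "h \<bullet> (hessian d f z *\<^sub>v h)
      = (\<Sum>i<d. h $ i * (\<Sum>j<d. partial_deriv d i (partial_deriv d j f) z * h $ j))"
    using assms by (simp add: scalar_prod_def hessian_def atLeast0LessThan)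
  also have "\<dots> = (\<Sum>i<d. \<Sum>j<d. h $ i * h $ j * partial_deriv d i (partial_deriv d j f) z)"
    by (simp add: sum_distrib_left mult_ac)
  also have "\<dots> = (\<Sum>j<d. \<Sum>i<d. h $ i * h $ j * partial_deriv d i (partial_deriv d j f) z)"
    by (rule sum.swap)
  also have "\<dots> = (\<Sum>j<d. h $ j * (\<Sum>i<d. h $ i * partial_deriv d i (partial_deriv d j f) z))"
    by (simp add: sum_distrib_left mult_ac)
  finally show ?thesis .
qed

text \<open>Subtracting c t^2 / 2, with \<open>c\<close> the form of \<open>H\<close> at the
  increment, leaves a convex function on the segment. At the midpoint the parabola differs from its
  chord by c / 4 - c / 8, which is the eighth gained here.\<close>

lemma hessian_bound_midpoint:
  assumes U: "openin (euclid d) U" and f: "Ck_on 2 d U f"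
    and x: "x \<in> carrier_vec d" and y: "y \<in> carrier_vec d" and H: "H \<in> carrier_mat d d"
    and seg: "\<And>t. 0 \<le> t \<Longrightarrow> t \<le> 1 \<Longrightarrow> x + t \<cdot>\<^sub>v (y - x) \<in> U"
    and hess: "\<And>t. 0 \<le> t \<Longrightarrow> t \<le> 1 \<Longrightarrow> pos_semidef d (hessian d f (x + t \<cdot>\<^sub>v (y - x)) - H)"
  shows "f (vec_mid x y) \<le> (f x + f y) / 2 - ((y - x) \<bullet> (H *\<^sub>v (y - x))) / 8"
proof -
  define h where "h = y - x"
  define c where "c = h \<bullet> (H *\<^sub>v h)"
  have h: "h \<in> carrier_vec d" using x y by (simp add: h_def)
  define p where "p t = x + t \<cdot>\<^sub>v h" for t
  define f1 where "f1 t = (\<Sum>j<d. h $ j * partial_deriv d j f (p t))" for t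
  define f2 where "f2 t = (\<Sum>j<d. h $ j * (\<Sum>i<d. h $ i * partial_deriv d i (partial_deriv d j f) (p t)))" for t
  have pU: "p t \<in> U" if "t \<in> {0..1}" for t using seg that by (simp add: p_def h_def)
  have f2k: "Ck_on (Suc (Suc 0)) d U f" using f by (simp add: numeral_2_eq_2)
  have d1: "((\<lambda>t. f (p t)) has_real_derivative f1 t) (at t)" if "t \<in> {0..1}" for t
    using Ck_on_line_derivative[OF U f2k x h pU[OF that, unfolded p_def]] by (simp add: f1_def p_def)
  have d2: "(f1 has_real_derivative f2 t) (at t)" if "t \<in> {0..1}" for t
    unfolding f1_def f2_def
  proof (intro DERIV_sum DERIV_cmult)
    fix j assume "j \<in> {..<d}"
    then have "Ck_on (Suc 0) d U (partial_deriv d j f)" using f2k by auto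
    from Ck_on_line_derivative[OF U this x h pU[OF that, unfolded p_def]]
    show "((\<lambda>t. partial_deriv d j f (p t)) has_real_derivative
        (\<Sum>i<d. h $ i * partial_deriv d i (partial_deriv d j f) (p t))) (at t)"
      by (simp add: p_def)
  qed
  have f2_ge: "c \<le> f2 t" if "t \<in> {0..1}" for t
  proof -
    have Hc: "hessian d f (p t) \<in> carrier_mat d d" by (simp add: hessian_def)
    have "0 \<le> h \<bullet> ((hessian d f (p t) - H) *\<^sub>v h)"
      using hess[of t] that h by (simp add: pos_semidef_def p_def h_def)
    also have "\<dots> = h \<bullet> (hessian d f (p t) *\<^sub>v h) - c"
      using Hc H h by (simp add: minus_mult_distrib_mat_vec scalar_prod_minus_distrib c_def)
    finally show ?thesis by (simp add: quadratic_form_hessian[OF h] f2_def)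
  qed
  have conv: "convex_on {0..1} (\<lambda>t. f (p t) - c / 2 * t\<^sup>2)"
  proof (rule f''_ge0_imp_convex)
    fix t :: real assume t: "t \<in> {0..1}"
    show "((\<lambda>t. f (p t) - c / 2 * t\<^sup>2) has_real_derivative f1 t - c * t) (at t)"
      by (rule derivative_eq_intros d1[OF t] | simp)+
    show "((\<lambda>t. f1 t - c * t) has_real_derivative f2 t - c) (at t)"
      by (rule derivative_eq_intros d2[OF t] | simp)+
    show "0 \<le> f2 t - c" using f2_ge[OF t] by simp
  qed simp
  have "f (p (1/2)) - c / 2 * (1/2)\<^sup>2 \<le> (1/2) * (f (p 0) - c / 2 * 0\<^sup>2) + (1/2) * (f (p 1) - c / 2 * 1\<^sup>2)"
    using convex_onD[OF conv, of "1/2" 0 1] by simp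
  moreover have "p 0 = x" "p 1 = y" "p (1/2) = vec_mid x y"
    using x y by (auto simp: p_def h_def vec_mid_def field_simps intro!: eq_vecI)
  ultimately show ?thesis by (simp add: c_def h_def power2_eq_square field_simps)
qed

section \<open>Laplace transforms of linear observables under a phase\<close>

lemma pos_def_inverse:
  assumes M: "pos_def d M"
  shows "inv_mat M \<in> carrier_mat d d" "M * inv_mat M = 1\<^sub>m d" "inv_mat M * M = 1\<^sub>m d"
proof -
  have Mc: "M \<in> carrier_mat d d" using M by (simp add: pos_def_def)
  \<comment> \<open>\<open>inv_mat\<close> is the content of an option, so
    \<open>mat_inverse\<close> must be shown to succeed; a kernel vector would make the form
    vanish.\<close>
  have "det M \<noteq> 0"
  proof
    assume "det M = 0"
    then obtain v where v: "v \<in> carrier_vec d" "v \<noteq> 0\<^sub>v d" "M *\<^sub>v v = 0\<^sub>v d"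
      using det_0_iff_vec_prod_zero_field[OF Mc] by blast
    have "0 < v \<bullet> (M *\<^sub>v v)" using M v(1,2) by (simp add: pos_def_def)
    then show False using v by simp
  qed
  then have "M \<in> Units (ring_mat TYPE(real) d ())" by (rule det_non_zero_imp_unit[OF Mc])
  then obtain B where "mat_inverse M = Some B" using mat_inverse(1)[OF Mc] by fastforce
  then show "inv_mat M \<in> carrier_mat d d" "M * inv_mat M = 1\<^sub>m d" "inv_mat M * M = 1\<^sub>m d"
    using mat_inverse(2)[OF Mc] by auto
qed

lemma pos_def_nonneg: "pos_def d M \<Longrightarrow> x \<in> carrier_vec d \<Longrightarrow> 0 \<le> x \<bullet> (M *\<^sub>v x)"
  by (cases "x = 0\<^sub>v d") (auto simp: pos_def_def less_imp_le)

lemma pos_def_symmetric_form: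
  assumes "pos_def d M" "x \<in> carrier_vec d" "y \<in> carrier_vec d"
  shows "x \<bullet> (M *\<^sub>v y) = y \<bullet> (M *\<^sub>v x)"
proof -
  have M: "M \<in> carrier_mat d d" "transpose_mat M = M" using assms(1) by (auto simp: pos_def_def)
  have "x \<bullet> (M *\<^sub>v y) = (M *\<^sub>v x) \<bullet> y"
    using transpose_vec_mult_scalar[OF M(1) assms(3,2)] M(2) by simp
  then show ?thesis using comm_scalar_prod[of "M *\<^sub>v x" d y] M assms by simp
qed

lemma pos_def_apply_inverse:
  assumes "pos_def d M" "x \<in> carrier_vec d"
  shows "inv_mat M *\<^sub>v x \<in> carrier_vec d" "M *\<^sub>v (inv_mat M *\<^sub>v x) = x"
proof -
  have M: "M \<in> carrier_mat d d" using assms(1) by (auto simp: pos_def_def)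
  note inv = pos_def_inverse[OF assms(1)]
  show "inv_mat M *\<^sub>v x \<in> carrier_vec d" using inv(1) assms(2) by simp
  show "M *\<^sub>v (inv_mat M *\<^sub>v x) = x"
    using assoc_mult_mat_vec[OF M inv(1) assms(2)] inv(2) assms(2) by simp
qed

text \<open>The square at x + c y is the common source of the Young inequality (c = - 2 h) and of
  the Schur complement bound (c = 1).\<close>

lemma pos_def_shifted_square:
  assumes M: "pos_def d M" and x: "x \<in> carrier_vec d" and y: "y \<in> carrier_vec d"
  shows "0 \<le> x \<bullet> (M *\<^sub>v x) + 2 * c * (x \<bullet> (M *\<^sub>v y)) + c\<^sup>2 * (y \<bullet> (M *\<^sub>v y))"
proof -
  have Mc: "M \<in> carrier_mat d d" using M by (simp add: pos_def_def)
  have "0 \<le> (x + c \<cdot>\<^sub>v y) \<bullet> (M *\<^sub>v (x + c \<cdot>\<^sub>v y))"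
    using M x y by (intro pos_def_nonneg) auto
  also have "\<dots> = x \<bullet> (M *\<^sub>v x) + 2 * c * (x \<bullet> (M *\<^sub>v y)) + c\<^sup>2 * (y \<bullet> (M *\<^sub>v y))"
    using Mc x y pos_def_symmetric_form[OF M y x]
    by (simp add: mult_add_distrib_mat_vec mult_mat_vec add_scalar_prod_distrib[of _ d]
        scalar_prod_add_distrib[of _ d] smult_scalar_prod_distrib[of _ d] scalar_prod_smult_distrib[of _ d]
        power2_eq_square algebra_simps)
  finally show ?thesis .
qed

text \<open>The square is taken at p - 2 h M^-1 v; the factor 4 fits the quarter in
  \<open>action_midpoint\<close>.\<close>

lemma pos_def_young:
  assumes M: "pos_def d M" and v: "v \<in> carrier_vec d" and p: "p \<in> carrier_vec d"
  shows "4 * h * (v \<bullet> p) \<le> p \<bullet> (M *\<^sub>v p) + 4 * h\<^sup>2 * (v \<bullet> (inv_mat M *\<^sub>v v))"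
proof -
  define w where "w = inv_mat M *\<^sub>v v"
  have w: "w \<in> carrier_vec d" "M *\<^sub>v w = v" using pos_def_apply_inverse[OF M v] by (auto simp: w_def)
  have "w \<bullet> v = v \<bullet> w" "p \<bullet> v = v \<bullet> p" using w v p by (auto intro: comm_scalar_prod)
  then show ?thesis
    using pos_def_shifted_square[OF M p w(1), of "- 2 * h"] w
    by (simp add: power_mult_distrib flip: w_def)
qed

text \<open>If M w = v, then the dual form of \<open>v\<close> is the form of \<open>M\<close> at
  \<open>w\<close>.\<close>

lemma pos_def_inverse_form:
  assumes M: "pos_def d M" and v: "v \<in> carrier_vec d"
  shows "0 \<le> v \<bullet> (inv_mat M *\<^sub>v v)" "v \<bullet> (inv_mat M *\<^sub>v v) = 0 \<Longrightarrow> v = 0\<^sub>v d"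
proof -
  define w where "w = inv_mat M *\<^sub>v v"
  have w: "w \<in> carrier_vec d" "M *\<^sub>v w = v" using pos_def_apply_inverse[OF M v] by (auto simp: w_def)
  have eq: "v \<bullet> w = w \<bullet> (M *\<^sub>v w)" using w v comm_scalar_prod[of v d w] by simp
  show "0 \<le> v \<bullet> (inv_mat M *\<^sub>v v)" using pos_def_nonneg[OF M w(1)] eq by (simp add: w_def)
  assume "v \<bullet> (inv_mat M *\<^sub>v v) = 0"
  then have "w \<bullet> (M *\<^sub>v w) = 0" using eq by (simp add: w_def)
  then have "w = 0\<^sub>v d" using M w(1) unfolding pos_def_def by force
  then show "v = 0\<^sub>v d" using w(2) M by (auto simp: pos_def_def)
qed

text \<open>The right side exceeds the left by the form of \<open>D\<close> at r + D^-1 B^T p, so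
  the Schur complement is the minimum of the block form over the fluctuation part
  \<open>r\<close>.\<close>

lemma schur_complement_le:
  assumes A: "A \<in> carrier_mat m m" and B: "B \<in> carrier_mat m n" and D: "pos_def n D"
    and p: "p \<in> carrier_vec m" and r: "r \<in> carrier_vec n"
  shows "p \<bullet> ((A - B * inv_mat D * transpose_mat B) *\<^sub>v p)
    \<le> (p @\<^sub>v r) \<bullet> (four_block_mat A B (transpose_mat B) D *\<^sub>v (p @\<^sub>v r))"
proof -
  define b where "b = transpose_mat B *\<^sub>v p"
  have Dc: "D \<in> carrier_mat n n" using D by (simp add: pos_def_def)
  have Bt: "transpose_mat B \<in> carrier_mat n m" using B by simp
  have b: "b \<in> carrier_vec n" using Bt p by (simp add: b_def)
  define s where "s = inv_mat D *\<^sub>v b"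
  have s: "s \<in> carrier_vec n" "D *\<^sub>v s = b" using pos_def_apply_inverse[OF D b] by (auto simp: s_def)
  note Di = pos_def_inverse(1)[OF D]
  have adj: "b \<bullet> x = p \<bullet> (B *\<^sub>v x)" if "x \<in> carrier_vec n" for x
    unfolding b_def by (rule transpose_vec_mult_scalar[OF B that p])
  have "(B * inv_mat D * transpose_mat B) *\<^sub>v p = B *\<^sub>v s"
    using assoc_mult_mat_vec[OF mult_carrier_mat[OF B Di] Bt p] assoc_mult_mat_vec[OF B Di b]
    by (simp only: s_def b_def)
  then have L: "p \<bullet> ((A - B * inv_mat D * transpose_mat B) *\<^sub>v p) = p \<bullet> (A *\<^sub>v p) - b \<bullet> s"
    using A B Di Bt p s by (simp add: minus_mult_distrib_mat_vec scalar_prod_minus_distrib[of _ m] adj)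
  have "four_block_mat A B (transpose_mat B) D *\<^sub>v (p @\<^sub>v r) = (A *\<^sub>v p + B *\<^sub>v r) @\<^sub>v (b + D *\<^sub>v r)"
    unfolding b_def by (rule four_block_mat_mult_vec[OF A B Bt Dc p r])
  then have R: "(p @\<^sub>v r) \<bullet> (four_block_mat A B (transpose_mat B) D *\<^sub>v (p @\<^sub>v r))
      = p \<bullet> (A *\<^sub>v p) + b \<bullet> r + (r \<bullet> b + r \<bullet> (D *\<^sub>v r))"
    using A B Dc p r b
    by (simp add: scalar_prod_append[of _ m _ n] scalar_prod_add_distrib[of _ m] scalar_prod_add_distrib[of _ n] adj)
  have "r \<bullet> b = b \<bullet> r" "s \<bullet> b = b \<bullet> s" using r b s by (auto intro: comm_scalar_prod)
  then show ?thesis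
    unfolding L R using pos_def_shifted_square[OF D r s(1), of 1] s by simp
qed

lemma append_vec_minus:
  assumes "v \<in> carrier_vec n" "v' \<in> carrier_vec n" "w \<in> carrier_vec k" "w' \<in> carrier_vec k"
  shows "(v @\<^sub>v w) - (v' @\<^sub>v w') = (v - v') @\<^sub>v (w - w' :: real vec)"
  using assms by (intro eq_vecI) auto

lemma append_vec_segment:
  assumes "v \<in> carrier_vec n" "v' \<in> carrier_vec n" "w \<in> carrier_vec k" "w' \<in> carrier_vec k"
  shows "(v @\<^sub>v w) + t \<cdot>\<^sub>v ((v' @\<^sub>v w') - (v @\<^sub>v w))
    = ((1 - t) \<cdot>\<^sub>v v + t \<cdot>\<^sub>v v') @\<^sub>v ((1 - t) \<cdot>\<^sub>v w + t \<cdot>\<^sub>v w' :: real vec)"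
  using assms by (intro eq_vecI) (auto simp: algebra_simps)

lemma append_vec_mid:
  assumes "v \<in> carrier_vec n" "v' \<in> carrier_vec n" "w \<in> carrier_vec k" "w' \<in> carrier_vec k"
  shows "vec_mid (v @\<^sub>v w) (v' @\<^sub>v w') = vec_mid v v' @\<^sub>v vec_mid w w'"
  using assms unfolding vec_mid_def by (intro eq_vecI) auto

lemma convex_vec_mid:
  assumes "convex_vec A" "A \<subseteq> carrier_vec n" "x \<in> A" "y \<in> A"
  shows "vec_mid x y \<in> A"
proof -
  have "(1 - 1/2) \<cdot>\<^sub>v x + (1/2) \<cdot>\<^sub>v y \<in> A"
    using assms(1,3,4) unfolding convex_vec_def by (elim ballE allE[of _ "1/2"]) auto
  moreover have "(1 - 1/2) \<cdot>\<^sub>v x + (1/2) \<cdot>\<^sub>v y = vec_mid x y"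
  proof -
    have "x \<in> carrier_vec n" "y \<in> carrier_vec n" using assms(2-4) by auto
    then show ?thesis unfolding vec_mid_def by (intro eq_vecI) auto
  qed
  ultimately show ?thesis by simp
qed

lemma measurable_scalar_prod_leb [measurable]:
  assumes "v \<in> carrier_vec d"
  shows "(\<lambda>u. v \<bullet> u) \<in> borel_measurable (leb d)"
proof -
  have "(\<lambda>u. \<Sum>i<d. v $ i * u $ i) \<in> borel_measurable (leb d)"
    by (intro borel_measurable_sum borel_measurable_times measurable_vec_index_leb) auto
  then show ?thesis
    by (rule measurable_cong[THEN iffD1, rotated])
      (auto simp: space_leb scalar_prod_def atLeast0LessThan)
qed

section \<open>The joint density and the coarse marginal of one phase\<close>

locale atlas_phase =
  fixes X :: atlas and a :: nat
  assumes atlas: "phase_atlas X" and phase: "a \<in> phases X"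
begin

abbreviation "m \<equiv> dimC X"
abbreviation "n \<equiv> dimF X"
abbreviation "G \<equiv> HRG X a"

text \<open>Being 0 off the chart, this unnormalized density carries the convex constraints itself:
  a pair of points of which one is off the chart satisfies the Prekopa-Leindler hypothesis
  trivially.\<close>

definition F :: "real vec \<times> real vec \<Rightarrow> ennreal" where
  "F z = ennreal (indicator (OmegaC X a \<times> OmegaF X a) z * exp (- action X a (fst z @\<^sub>v snd z)))"

definition Z :: real where
  "Z = (LINT (u, v):(OmegaC X a \<times> OmegaF X a)|leb2 X. exp (- action X a (u @\<^sub>v v)))"

lemma finite_Tfull: "finite (Tfull X)"
  and obs_carrier: "x \<in> Tfull X \<Longrightarrow> obs X x \<in> carrier_vec m"
  and Tsel_nonempty: "Tsel X a \<noteq> {}" and Tsel_subset: "Tsel X a \<subseteq> Tfull X"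
  and closedC: "closedin (euclid m) (OmegaC X a)" and convexC: "convex_vec (OmegaC X a)"
  and interiorC: "(euclid m) interior_of (OmegaC X a) \<noteq> {}"
  and closedF: "closedin (euclid n) (OmegaF X a)" and convexF: "convex_vec (OmegaF X a)"
  and interiorF: "(euclid n) interior_of (OmegaF X a) \<noteq> {}"
  and int_joint: "set_integrable (leb2 X) (OmegaC X a \<times> OmegaF X a) (\<lambda>(u, v). exp (- action X a (u @\<^sub>v v)))"
  and int_fibre: "u \<in> OmegaC X a \<Longrightarrow> set_integrable (leb n) (OmegaF X a) (\<lambda>v. exp (- action X a (u @\<^sub>v v)))"
  and blkA: "blkA X a \<in> carrier_mat m m" and blkB: "blkB X a \<in> carrier_mat m n"
  and blkD: "pos_def n (blkD X a)" and posG: "pos_def m G"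
  and smooth: "\<exists>U. openin (euclid (m + n)) U \<and> chart X a \<subseteq> U \<and> Ck_on 2 (m + n) U (action X a)"
  and hess: "z \<in> chart X a \<Longrightarrow> pos_semidef (m + n) (hessian (m + n) (action X a) z - Hmat X a)"
  using atlas phase unfolding phase_atlas_def by blast+

lemma OmegaC_carrier: "OmegaC X a \<subseteq> carrier_vec m" and OmegaF_carrier: "OmegaF X a \<subseteq> carrier_vec n"
  using closedin_subset[OF closedC] closedin_subset[OF closedF] by auto

sublocale pair_sigma_finite "leb m" "leb n"
  by (intro pair_sigma_finite.intro sigma_finite_leb)

text \<open>\<open>hessian_bound_midpoint\<close> gains an eighth of the block form, doubled here to
  a quarter. The Schur complement bound then removes the fluctuation displacement, which a coarse
  observable does not see.\<close>

lemma action_midpoint: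
  assumes u: "u \<in> OmegaC X a" "u' \<in> OmegaC X a" and v: "v \<in> OmegaF X a" "v' \<in> OmegaF X a"
  shows "2 * action X a (vec_mid u u' @\<^sub>v vec_mid v v') + ((u' - u) \<bullet> (G *\<^sub>v (u' - u))) / 4
    \<le> action X a (u @\<^sub>v v) + action X a (u' @\<^sub>v v')"
proof -
  obtain U where U: "openin (euclid (m + n)) U" "chart X a \<subseteq> U" "Ck_on 2 (m + n) U (action X a)"
    using smooth by blast
  have c: "u \<in> carrier_vec m" "u' \<in> carrier_vec m" "v \<in> carrier_vec n" "v' \<in> carrier_vec n"
    using u v OmegaC_carrier OmegaF_carrier by auto
  let ?q = "(u' @\<^sub>v v') - (u @\<^sub>v v)"
  have seg: "(u @\<^sub>v v) + t \<cdot>\<^sub>v ?q \<in> chart X a" if "0 \<le> t" "t \<le> 1" for t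
  proof -
    have "(1 - t) \<cdot>\<^sub>v u + t \<cdot>\<^sub>v u' \<in> OmegaC X a" "(1 - t) \<cdot>\<^sub>v v + t \<cdot>\<^sub>v v' \<in> OmegaF X a"
      using that u v convexC convexF by (auto simp: convex_vec_def)
    then show ?thesis using c unfolding chart_def by (subst append_vec_segment[of _ m _ _ n]) blast+
  qed
  have H: "Hmat X a \<in> carrier_mat (m + n) (m + n)"
    unfolding Hmat_def using blkA blkD by (intro four_block_carrier_mat) (auto simp: pos_def_def)
  have "action X a (vec_mid (u @\<^sub>v v) (u' @\<^sub>v v'))
      \<le> (action X a (u @\<^sub>v v) + action X a (u' @\<^sub>v v')) / 2 - (?q \<bullet> (Hmat X a *\<^sub>v ?q)) / 8"
    by (rule hessian_bound_midpoint[OF U(1,3)]) (use c H seg hess U(2) in auto)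
  moreover have "(u' - u) \<bullet> (G *\<^sub>v (u' - u)) \<le> ?q \<bullet> (Hmat X a *\<^sub>v ?q)"
    using schur_complement_le[OF blkA blkB blkD, of "u' - u" "v' - v"] c
    by (simp add: append_vec_minus[of _ m _ _ n] HRG_def Hmat_def)
  moreover have "2 * s + p / 4 \<le> t" if "s \<le> t / 2 - q / 8" "p \<le> q" for s t p q :: real
    using that by simp
  ultimately show ?thesis unfolding append_vec_mid[OF c] by blast
qed

lemma measurable_F [measurable]: "F \<in> borel_measurable (leb m \<Otimes>\<^sub>M leb n)"
proof -
  have "(\<lambda>z. indicator (OmegaC X a \<times> OmegaF X a) z *\<^sub>R (case z of (u, v) \<Rightarrow> exp (- action X a (u @\<^sub>v v))))
      \<in> borel_measurable (leb m \<Otimes>\<^sub>M leb n)"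
    using int_joint unfolding set_integrable_def leb2_def by (rule borel_measurable_integrable)
  then show ?thesis unfolding F_def by (simp add: case_prod_beta')
qed

lemma F_eq_0_iff: "F z = 0 \<longleftrightarrow> z \<notin> OmegaC X a \<times> OmegaF X a"
  by (auto simp: F_def indicator_def ennreal_eq_0_iff)

lemma nn_integral_F: "(\<integral>\<^sup>+z. F z \<partial>(leb m \<Otimes>\<^sub>M leb n)) = ennreal Z"
proof -
  have "(\<integral>\<^sup>+z. F z \<partial>(leb m \<Otimes>\<^sub>M leb n)) = ennreal (LINT z|(leb m \<Otimes>\<^sub>M leb n).
      indicator (OmegaC X a \<times> OmegaF X a) z *\<^sub>R (case z of (u, v) \<Rightarrow> exp (- action X a (u @\<^sub>v v))))"
    using int_joint unfolding set_integrable_def leb2_def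
    by (subst nn_integral_eq_integral[symmetric]) (auto simp: F_def case_prod_beta' intro!: nn_integral_cong)
  then show ?thesis by (simp add: Z_def set_lebesgue_integral_def leb2_def)
qed

text \<open>\<open>F\<close> is measurable because the restricted exponential is integrable by
  assumption, and it is nonzero exactly on the chart. Sections of this measurable product recover
  its factors.\<close>

lemma sets_Omega: "OmegaC X a \<in> sets (leb m)" "OmegaF X a \<in> sets (leb n)"
proof -
  have sub: "OmegaC X a \<times> OmegaF X a \<subseteq> space (leb m \<Otimes>\<^sub>M leb n)"
    using OmegaC_carrier OmegaF_carrier by (auto simp: space_pair_measure space_leb)
  have "{z \<in> space (leb m \<Otimes>\<^sub>M leb n). F z \<noteq> 0} \<in> sets (leb m \<Otimes>\<^sub>M leb n)" by measurable
  also have "{z \<in> space (leb m \<Otimes>\<^sub>M leb n). F z \<noteq> 0} = OmegaC X a \<times> OmegaF X a"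
    using sub by (auto simp: F_eq_0_iff)
  finally have s: "OmegaC X a \<times> OmegaF X a \<in> sets (leb m \<Otimes>\<^sub>M leb n)" .
  have ne: "OmegaC X a \<noteq> {}" "OmegaF X a \<noteq> {}" using interiorC interiorF by auto
  then obtain u v where uv: "u \<in> OmegaC X a" "v \<in> OmegaF X a" by blast
  have "(\<lambda>x. (x, v)) -` (OmegaC X a \<times> OmegaF X a) = OmegaC X a"
    "Pair u -` (OmegaC X a \<times> OmegaF X a) = OmegaF X a" using uv by auto
  then show "OmegaC X a \<in> sets (leb m)" "OmegaF X a \<in> sets (leb n)"
    using sets_Pair2[OF s, of v] sets_Pair1[OF s, of u] by auto
qed

lemma Z_pos: "0 < Z"
proof -
  have "emeasure (leb m \<Otimes>\<^sub>M leb n) (OmegaC X a \<times> OmegaF X a)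
      = emeasure (leb m) (OmegaC X a) * emeasure (leb n) (OmegaF X a)"
    using sets_Omega by (intro M2.emeasure_pair_measure_Times)
  moreover have "0 < emeasure (leb m) (OmegaC X a)" "0 < emeasure (leb n) (OmegaF X a)"
    using sets_Omega interiorC interiorF by (auto intro: emeasure_leb_pos)
  ultimately have "0 < emeasure (leb m \<Otimes>\<^sub>M leb n) (OmegaC X a \<times> OmegaF X a)"
    by (simp add: ennreal_zero_less_mult_iff)
  also have "OmegaC X a \<times> OmegaF X a = {z \<in> space (leb m \<Otimes>\<^sub>M leb n). F z \<noteq> 0}"
    using OmegaC_carrier OmegaF_carrier by (auto simp: F_eq_0_iff space_pair_measure space_leb)
  finally have "(\<integral>\<^sup>+z. F z \<partial>(leb m \<Otimes>\<^sub>M leb n)) \<noteq> 0"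
    by (subst nn_integral_0_iff) auto
  then show ?thesis unfolding nn_integral_F by (simp add: ennreal_eq_0_iff)
qed

text \<open>\<open>S_RG\<close> is minus a logarithm, which the exponential undoes because the fibre
  integral is positive: the fibre domain has positive measure and the integrand does not vanish on
  it.\<close>

lemma fibre_integral:
  assumes "u \<in> OmegaC X a"
  shows "(\<integral>\<^sup>+v. F (u, v) \<partial>leb n) = ennreal (exp (- S_RG X a u))"
proof -
  have u: "u \<in> space (leb m)" using assms OmegaC_carrier by (auto simp: space_leb)
  note [measurable] = u
  define I where "I = (LINT v:OmegaF X a|leb n. exp (- action X a (u @\<^sub>v v)))"
  have I: "(\<integral>\<^sup>+v. F (u, v) \<partial>leb n) = ennreal I"
    using int_fibre[OF assms] assms unfolding set_integrable_def I_def set_lebesgue_integral_def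
    by (subst nn_integral_eq_integral[symmetric]) (auto simp: F_def indicator_def intro!: nn_integral_cong)
  have "0 < emeasure (leb n) (OmegaF X a)" using sets_Omega interiorF by (auto intro: emeasure_leb_pos)
  also have "OmegaF X a = {v \<in> space (leb n). F (u, v) \<noteq> 0}"
    using OmegaF_carrier assms by (auto simp: F_eq_0_iff space_leb)
  finally have "(\<integral>\<^sup>+v. F (u, v) \<partial>leb n) \<noteq> 0" by (subst nn_integral_0_iff) auto
  then have "0 < I" unfolding I by (simp add: ennreal_eq_0_iff)
  then show ?thesis unfolding I by (simp add: S_RG_def I_def[symmetric])
qed

lemma fibre_integral_indicator:
  "ennreal (indicator (OmegaC X a) u * exp (- S_RG X a u)) = (\<integral>\<^sup>+v. F (u, v) \<partial>leb n)"
proof (cases "u \<in> OmegaC X a")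
  case False
  then have "F (u, v) = 0" for v by (simp add: F_eq_0_iff)
  then show ?thesis using False by simp
qed (simp add: fibre_integral)

text \<open>Tonelli identifies the coarse normalizer with the joint one; \<open>enn2real\<close>
  links the Bochner integral of the definition to nonnegative integrals.\<close>

lemma Z_marginal: "(LINT u:OmegaC X a|leb m. exp (- S_RG X a u)) = Z"
proof -
  have eq: "indicator (OmegaC X a) u * exp (- S_RG X a u) = enn2real (\<integral>\<^sup>+v. F (u, v) \<partial>leb n)" for u
    by (subst fibre_integral_indicator[symmetric]) (simp add: indicator_def)
  have "(LINT u:OmegaC X a|leb m. exp (- S_RG X a u)) = (LINT u|leb m. enn2real (\<integral>\<^sup>+v. F (u, v) \<partial>leb n))"
    by (simp add: set_lebesgue_integral_def eq)
  also have "\<dots> = enn2real (\<integral>\<^sup>+u. ennreal (enn2real (\<integral>\<^sup>+v. F (u, v) \<partial>leb n)) \<partial>leb m)"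
    by (intro integral_eq_nn_integral) auto
  also have "(\<integral>\<^sup>+u. ennreal (enn2real (\<integral>\<^sup>+v. F (u, v) \<partial>leb n)) \<partial>leb m) = (\<integral>\<^sup>+u. \<integral>\<^sup>+v. F (u, v) \<partial>leb n \<partial>leb m)"
    by (simp add: eq[symmetric] fibre_integral_indicator)
  also have "\<dots> = ennreal Z" by (simp add: M2.nn_integral_fst nn_integral_F)
  finally show ?thesis using Z_pos by simp
qed

lemma nu_Ca_eq: "nu_Ca X a = density (leb m) (\<lambda>u. (\<integral>\<^sup>+v. F (u, v) \<partial>leb n) * ennreal (1 / Z))"
proof -
  have "ennreal (indicator (OmegaC X a) u * exp (- S_RG X a u) / Z)
      = (\<integral>\<^sup>+v. F (u, v) \<partial>leb n) * ennreal (1 / Z)" for u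
    unfolding fibre_integral_indicator[symmetric] using Z_pos
    by (simp add: indicator_def flip: ennreal_mult)
  then show ?thesis unfolding nu_Ca_def Z_marginal by simp
qed

lemma space_nu_Ca [simp]: "space (nu_Ca X a) = carrier_vec m"
  and sets_nu_Ca [simp, measurable_cong]: "sets (nu_Ca X a) = sets (leb m)"
  by (simp_all add: nu_Ca_def space_leb)

text \<open>This is the passage to the joint space, where the Hessian bound of the original action
  is available.\<close>

lemma nn_integral_nu_Ca:
  assumes [measurable]: "g \<in> borel_measurable (leb m)"
  shows "(\<integral>\<^sup>+u. g u \<partial>nu_Ca X a) = (\<integral>\<^sup>+z. F z * g (fst z) \<partial>(leb m \<Otimes>\<^sub>M leb n)) * ennreal (1 / Z)"
proof -
  have "(\<integral>\<^sup>+u. g u \<partial>nu_Ca X a) = (\<integral>\<^sup>+u. ((\<integral>\<^sup>+v. F (u, v) * g u \<partial>leb n)) * ennreal (1 / Z) \<partial>leb m)"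
    unfolding nu_Ca_eq
  proof (subst nn_integral_density)
    have "(\<integral>\<^sup>+v. F (u, v) * g u \<partial>leb n) = (\<integral>\<^sup>+v. F (u, v) \<partial>leb n) * g u" if [measurable]: "u \<in> space (leb m)" for u
      by (intro nn_integral_multc) measurable
    then show "(\<integral>\<^sup>+u. (\<integral>\<^sup>+v. F (u, v) \<partial>leb n) * ennreal (1 / Z) * g u \<partial>leb m)
        = (\<integral>\<^sup>+u. (\<integral>\<^sup>+v. F (u, v) * g u \<partial>leb n) * ennreal (1 / Z) \<partial>leb m)"
      by (intro nn_integral_cong) (simp add: mult_ac)
  qed measurable
  also have "\<dots> = (\<integral>\<^sup>+u. (\<integral>\<^sup>+v. F (u, v) * g u \<partial>leb n) \<partial>leb m) * ennreal (1 / Z)"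
    by (intro nn_integral_multc) measurable
  also have "(\<integral>\<^sup>+u. (\<integral>\<^sup>+v. F (u, v) * g u \<partial>leb n) \<partial>leb m) = (\<integral>\<^sup>+z. F z * g (fst z) \<partial>(leb m \<Otimes>\<^sub>M leb n))"
    by (subst M2.nn_integral_fst[symmetric]) auto
  finally show ?thesis .
qed

lemma prob_space_nu_Ca: "prob_space (nu_Ca X a)"
proof
  have "emeasure (nu_Ca X a) (space (nu_Ca X a)) = (\<integral>\<^sup>+u. 1 \<partial>nu_Ca X a)" by simp
  also have "\<dots> = ennreal Z * ennreal (1 / Z)"
    by (subst nn_integral_nu_Ca) (auto simp: nn_integral_F)
  also have "\<dots> = 1" using Z_pos by (simp flip: ennreal_mult)
  finally show "emeasure (nu_Ca X a) (space (nu_Ca X a)) = 1" .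
qed

lemma measure_nu_Ca_space [simp]: "measure (nu_Ca X a) (carrier_vec m) = 1"
  using prob_space.prob_space[OF prob_space_nu_Ca] by simp

lemma laplace_product_bound:
  assumes w: "w \<in> carrier_vec m"
  shows "(\<integral>\<^sup>+u. ennreal (exp (h * (w \<bullet> u))) \<partial>nu_Ca X a) * (\<integral>\<^sup>+u. ennreal (exp (- h * (w \<bullet> u))) \<partial>nu_Ca X a)
    \<le> ennreal (exp (h\<^sup>2 * (w \<bullet> (inv_mat G *\<^sub>v w))))"
proof -
  note [measurable] = measurable_scalar_prod_leb[OF w]
  define c where "c = h\<^sup>2 * (w \<bullet> (inv_mat G *\<^sub>v w))"
  let ?f = "\<lambda>h z. F z * ennreal (exp (h * (w \<bullet> fst z)))"
  have "(\<integral>\<^sup>+z. ?f h z \<partial>(leb m \<Otimes>\<^sub>M leb n)) * (\<integral>\<^sup>+z. ?f (- h) z \<partial>(leb m \<Otimes>\<^sub>M leb n))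
      \<le> (\<integral>\<^sup>+z. F z * ennreal (exp (c / 2)) \<partial>(leb m \<Otimes>\<^sub>M leb n))\<^sup>2"
  proof (rule prekopa_leindlerD[OF prekopa_leindler_pair[OF sigma_finite_leb sigma_finite_leb
          prekopa_leindler_leb prekopa_leindler_leb]])
    fix z z' assume zs: "z \<in> space (leb m \<Otimes>\<^sub>M leb n)" "z' \<in> space (leb m \<Otimes>\<^sub>M leb n)"
    obtain u v u' v' where z: "z = (u, v)" "z' = (u', v')" by (metis surj_pair)
    show "?f h z * ?f (- h) z'
        \<le> (F (vec_mid (fst z) (fst z'), vec_mid (snd z) (snd z')) * ennreal (exp (c / 2)))\<^sup>2"
    proof (cases "F z = 0 \<or> F z' = 0")
      case False
      then have O: "u \<in> OmegaC X a" "v \<in> OmegaF X a" "u' \<in> OmegaC X a" "v' \<in> OmegaF X a"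
        by (auto simp: F_eq_0_iff z)
      have uc: "u \<in> carrier_vec m" "u' \<in> carrier_vec m" using O OmegaC_carrier by auto
      have mid: "vec_mid u u' \<in> OmegaC X a" "vec_mid v v' \<in> OmegaF X a"
        using O convexC convexF OmegaC_carrier OmegaF_carrier by (auto intro: convex_vec_mid)
      let ?S = "action X a" and ?mid = "vec_mid u u' @\<^sub>v vec_mid v v'"
      \<comment> \<open>The tilts contribute \<open>h\<close> times the difference of the observable
        at the two points. Young pays for it with the quarter gained in
        \<open>action_midpoint\<close> and leaves \<open>c\<close>, which the squared right side
        carries as twice c / 2.\<close>
      have "4 * (- h) * (w \<bullet> (u' - u)) \<le> (u' - u) \<bullet> (G *\<^sub>v (u' - u)) + 4 * (- h)\<^sup>2 * (w \<bullet> (inv_mat G *\<^sub>v w))"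
        using pos_def_young[OF posG w, of "u' - u" "- h"] uc by simp
      moreover have "w \<bullet> (u' - u) = w \<bullet> u' - w \<bullet> u" using w uc by (simp add: scalar_prod_minus_distrib[of _ m])
      ultimately have "h * (w \<bullet> u) - h * (w \<bullet> u') \<le> ((u' - u) \<bullet> (G *\<^sub>v (u' - u))) / 4 + c"
        by (simp add: c_def algebra_simps)
      with action_midpoint[OF O(1,3,2,4)]
      have "- ?S (u @\<^sub>v v) + h * (w \<bullet> u) + (- ?S (u' @\<^sub>v v') + - h * (w \<bullet> u')) \<le> 2 * (- ?S ?mid + c / 2)"
        by simp
      then have "exp (- ?S (u @\<^sub>v v) + h * (w \<bullet> u) + (- ?S (u' @\<^sub>v v') + - h * (w \<bullet> u'))) \<le> exp (2 * (- ?S ?mid + c / 2))"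
        by simp
      also have "\<dots> = (exp (- ?S ?mid) * exp (c / 2))\<^sup>2"
        by (simp add: exp_add[symmetric] power2_eq_square)
      also have "exp (- ?S (u @\<^sub>v v) + h * (w \<bullet> u) + (- ?S (u' @\<^sub>v v') + - h * (w \<bullet> u')))
          = (exp (- ?S (u @\<^sub>v v)) * exp (h * (w \<bullet> u))) * (exp (- ?S (u' @\<^sub>v v')) * exp (- h * (w \<bullet> u')))"
        by (simp only: exp_add)
      finally have "ennreal ((exp (- ?S (u @\<^sub>v v)) * exp (h * (w \<bullet> u))) * (exp (- ?S (u' @\<^sub>v v')) * exp (- h * (w \<bullet> u'))))
          \<le> ennreal ((exp (- ?S ?mid) * exp (c / 2))\<^sup>2)" by (rule ennreal_leI)
      then show ?thesis
        using O mid by (simp add: z F_def ennreal_mult ennreal_power[symmetric])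
    qed auto
  qed measurable
  then have "(\<integral>\<^sup>+z. ?f h z \<partial>(leb m \<Otimes>\<^sub>M leb n)) * (\<integral>\<^sup>+z. ?f (- h) z \<partial>(leb m \<Otimes>\<^sub>M leb n))
      \<le> (ennreal Z * ennreal (exp (c / 2)))\<^sup>2"
    by (simp add: nn_integral_multc nn_integral_F)
  then have "((\<integral>\<^sup>+z. ?f h z \<partial>(leb m \<Otimes>\<^sub>M leb n)) * (\<integral>\<^sup>+z. ?f (- h) z \<partial>(leb m \<Otimes>\<^sub>M leb n))) * (ennreal (1 / Z))\<^sup>2
      \<le> (ennreal Z * ennreal (exp (c / 2)))\<^sup>2 * (ennreal (1 / Z))\<^sup>2"
    by (rule mult_right_mono) simp
  also have "\<dots> = ennreal (exp c)"
    using Z_pos by (simp add: power2_eq_square field_simps exp_add[symmetric] flip: ennreal_mult)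
  finally show ?thesis
    by (subst (1 2) nn_integral_nu_Ca) (auto simp: c_def power2_eq_square mult_ac)
qed

text \<open>In the finite product of the two transforms the opposite one cannot vanish, as its
  integrand is positive; hence the transform itself cannot be infinite.\<close>

lemma exp_observable_integrable:
  assumes w: "w \<in> carrier_vec m"
  shows "integrable (nu_Ca X a) (\<lambda>u. exp (h * (w \<bullet> u)))"
proof -
  interpret prob_space "nu_Ca X a" by (rule prob_space_nu_Ca)
  note [measurable] = measurable_scalar_prod_leb[OF w]
  have "(\<integral>\<^sup>+u. ennreal (exp (- h * (w \<bullet> u))) \<partial>nu_Ca X a) \<noteq> 0"
  proof
    assume "(\<integral>\<^sup>+u. ennreal (exp (- h * (w \<bullet> u))) \<partial>nu_Ca X a) = 0"
    then have "AE u in nu_Ca X a. ennreal (exp (- h * (w \<bullet> u))) = 0"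
      by (subst (asm) nn_integral_0_iff_AE) auto
    then have "AE u in nu_Ca X a. False" by eventually_elim (simp add: ennreal_eq_0_iff not_le)
    then show False by simp
  qed
  then have "(\<integral>\<^sup>+u. ennreal (exp (h * (w \<bullet> u))) \<partial>nu_Ca X a) \<noteq> top"
    using laplace_product_bound[OF w, of h] by (auto simp: ennreal_top_mult top_unique)
  then show ?thesis by (intro integrableI_bounded) (auto simp: less_top)
qed

text \<open>The exponential moments at 1 and - 1 together dominate the absolute value.\<close>

lemma observable_integrable:
  assumes w: "w \<in> carrier_vec m"
  shows "integrable (nu_Ca X a) (\<lambda>u. w \<bullet> u)"
proof (rule Bochner_Integration.integrable_bound)
  note [measurable] = measurable_scalar_prod_leb[OF w]
  show "integrable (nu_Ca X a) (\<lambda>u. exp (1 * (w \<bullet> u)) + exp (- 1 * (w \<bullet> u)))"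
    by (intro Bochner_Integration.integrable_add exp_observable_integrable w)
  show "AE u in nu_Ca X a. norm (w \<bullet> u) \<le> norm (exp (1 * (w \<bullet> u)) + exp (- 1 * (w \<bullet> u)))"
  proof (intro AE_I2)
    fix u
    have "\<bar>t\<bar> \<le> exp t + exp (- t)" for t :: real
      using exp_ge_add_one_self[of t] exp_ge_add_one_self[of "- t"] exp_gt_zero[of t] exp_gt_zero[of "- t"]
      by linarith
    then show "norm (w \<bullet> u) \<le> norm (exp (1 * (w \<bullet> u)) + exp (- 1 * (w \<bullet> u)))"
      by (simp add: abs_of_nonneg)
  qed
qed (use measurable_scalar_prod_leb[OF w] in \<open>simp add: measurable_cong_sets[OF sets_nu_Ca refl]\<close>)

lemma measurable_Zobs [measurable]:
  "x \<in> Tfull X \<Longrightarrow> Zobs X a x \<in> borel_measurable (leb m)"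
  unfolding Zobs_def using measurable_scalar_prod_leb[OF obs_carrier] by measurable

lemma ell_nonneg: "x \<in> Tfull X \<Longrightarrow> 0 \<le> ell X a x"
  and ell_square: "x \<in> Tfull X \<Longrightarrow> (ell X a x)\<^sup>2 = obs X x \<bullet> (inv_mat G *\<^sub>v obs X x)"
  using pos_def_inverse_form(1)[OF posG obs_carrier] by (auto simp: ell_def)

lemma Zobs_laplace:
  assumes x: "x \<in> Tfull X"
  shows "integrable (nu_Ca X a) (\<lambda>u. exp (h * Zobs X a x u))"
    "(LINT u|nu_Ca X a. exp (h * Zobs X a x u)) \<le> exp (h\<^sup>2 * (ell X a x)\<^sup>2)"
proof -
  interpret prob_space "nu_Ca X a" by (rule prob_space_nu_Ca)
  let ?w = "obs X x"
  note w = obs_carrier[OF x]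
  note [measurable] = measurable_scalar_prod_leb[OF w]
  define e where "e = (LINT u|nu_Ca X a. ?w \<bullet> u)"
  have Z_eq: "exp (h * Zobs X a x u) = exp (h * (?w \<bullet> u)) * exp (- h * e)" for h u
    by (simp add: Zobs_def e_def algebra_simps flip: exp_add)
  show int: "integrable (nu_Ca X a) (\<lambda>u. exp (h * Zobs X a x u))" for h
    unfolding Z_eq by (intro integrable_mult_left exp_observable_integrable w)
  \<comment> \<open>Jensen in tangent-line form: the centred observable has mean 0, so 1 + t \<le>
    exp t integrates to this bound.\<close>
  have "1 \<le> (LINT u|nu_Ca X a. exp (- h * Zobs X a x u))"
  proof -
    have "integrable (nu_Ca X a) (Zobs X a x)" unfolding Zobs_def
      by (intro Bochner_Integration.integrable_diff observable_integrable w) simp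
    moreover have "(LINT u|nu_Ca X a. Zobs X a x u) = 0"
      unfolding Zobs_def using observable_integrable[OF w] by simp
    ultimately have "(LINT u|nu_Ca X a. 1 + - h * Zobs X a x u) = 1" by simp
    moreover have "(LINT u|nu_Ca X a. 1 + - h * Zobs X a x u) \<le> (LINT u|nu_Ca X a. exp (- h * Zobs X a x u))"
    proof (intro integral_mono int Bochner_Integration.integrable_add integrable_mult_right)
      show "1 + - h * Zobs X a x u \<le> exp (- h * Zobs X a x u)" for u
        by (rule exp_ge_add_one_self)
    qed (use \<open>integrable (nu_Ca X a) (Zobs X a x)\<close> in auto)
    ultimately show ?thesis by simp
  qed
  moreover have "(LINT u|nu_Ca X a. exp (h * Zobs X a x u)) * (LINT u|nu_Ca X a. exp (- h * Zobs X a x u))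
      \<le> exp (h\<^sup>2 * (ell X a x)\<^sup>2)"
  proof -
    have eq: "ennreal (LINT u|nu_Ca X a. exp (h * Zobs X a x u))
        = (\<integral>\<^sup>+u. ennreal (exp (h * (?w \<bullet> u))) \<partial>nu_Ca X a) * ennreal (exp (- h * e))" for h
      by (subst nn_integral_eq_integral[symmetric, OF int])
        (auto simp: Z_eq ennreal_mult nn_integral_multc)
    have "ennreal ((LINT u|nu_Ca X a. exp (h * Zobs X a x u)) * (LINT u|nu_Ca X a. exp (- h * Zobs X a x u)))
        = ((\<integral>\<^sup>+u. ennreal (exp (h * (?w \<bullet> u))) \<partial>nu_Ca X a) * (\<integral>\<^sup>+u. ennreal (exp (- h * (?w \<bullet> u))) \<partial>nu_Ca X a))
          * (ennreal (exp (- h * e)) * ennreal (exp (- (- h) * e)))"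
      by (subst ennreal_mult) (auto simp only: eq mult_ac intro!: integral_nonneg_AE, auto)
    \<comment> \<open>The factors produced by the mean \<open>e\<close> are reciprocal, so centring
      leaves the product bound unchanged.\<close>
    also have "ennreal (exp (- h * e)) * ennreal (exp (- (- h) * e)) = 1"
      by (simp flip: ennreal_mult exp_add)
    also have "(\<integral>\<^sup>+u. ennreal (exp (h * (?w \<bullet> u))) \<partial>nu_Ca X a) * (\<integral>\<^sup>+u. ennreal (exp (- h * (?w \<bullet> u))) \<partial>nu_Ca X a) * 1
        \<le> ennreal (exp (h\<^sup>2 * (ell X a x)\<^sup>2))"
      using laplace_product_bound[OF w, of h] by (simp add: ell_square[OF x])
    finally show ?thesis by (simp add: ennreal_le_iff)
  qed
  moreover have "0 \<le> (LINT u|nu_Ca X a. exp (h * Zobs X a x u))" by (intro integral_nonneg_AE) auto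
  ultimately show "(LINT u|nu_Ca X a. exp (h * Zobs X a x u)) \<le> exp (h\<^sup>2 * (ell X a x)\<^sup>2)"
    using mult_left_mono[of 1 "LINT u|nu_Ca X a. exp (- h * Zobs X a x u)" "LINT u|nu_Ca X a. exp (h * Zobs X a x u)"]
    by simp
qed

end

section \<open>Suprema of observables and mixtures of phases\<close>

context atlas_phase
begin

text \<open>Chernoff with exponent h^2 L^2 at the threshold 2 L sqrt l: the choice h = sqrt l / L
  gives exp (- 2 l + l). The 2 in the threshold becomes the constant C of the theorem, and the sign
  \<open>s\<close> covers both tails.\<close>

lemma Zobs_upper_tail:
  assumes x: "x \<in> Tfull X" and L: "0 < L" "ell X a x \<le> L" and l: "0 \<le> l" and s: "s = 1 \<or> s = -1"
  shows "measure (nu_Ca X a) {u \<in> carrier_vec m. 2 * L * sqrt l < s * Zobs X a x u} \<le> exp (- l)"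
proof -
  interpret prob_space "nu_Ca X a" by (rule prob_space_nu_Ca)
  have [measurable]: "Zobs X a x \<in> borel_measurable (nu_Ca X a)"
    using measurable_Zobs[OF x] by (simp add: measurable_cong_sets[OF sets_nu_Ca refl])
  define A where "A = {u \<in> space (nu_Ca X a). 2 * L * sqrt l < s * Zobs X a x u}"
  have A[measurable]: "A \<in> sets (nu_Ca X a)" unfolding A_def by measurable
  define h where "h = sqrt l / L"
  have h: "0 \<le> h" "h * (2 * L * sqrt l) = 2 * l" "h\<^sup>2 * L\<^sup>2 = l"
    using L l by (auto simp: h_def power_divide)
  have "measure (nu_Ca X a) A = (LINT u|nu_Ca X a. indicator A u)"
    using A sets.sets_into_space[OF A] by (simp add: Int_absorb2)
  also have "\<dots> \<le> (LINT u|nu_Ca X a. exp (- 2 * l) * exp ((h * s) * Zobs X a x u))"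
  proof (intro integral_mono)
    show "integrable (nu_Ca X a) (\<lambda>u. exp (- 2 * l) * exp ((h * s) * Zobs X a x u))"
      by (intro integrable_mult_right Zobs_laplace(1) x)
    fix u
    show "indicat_real A u \<le> exp (- 2 * l) * exp ((h * s) * Zobs X a x u)"
    proof (cases "u \<in> A")
      case True
      then have "h * (2 * L * sqrt l) \<le> h * (s * Zobs X a x u)"
        using h(1) by (intro mult_left_mono) (auto simp: A_def)
      then have "0 \<le> - 2 * l + (h * s) * Zobs X a x u" using h(2) by (simp add: mult.assoc)
      then have "1 \<le> exp (- 2 * l + (h * s) * Zobs X a x u)" by simp
      then show ?thesis using True by (simp only: exp_add indicator_simps)
    qed simp
    show "integrable (nu_Ca X a) (indicat_real A)"
      by (rule integrable_real_indicator[OF A]) (simp add: less_top[symmetric])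
  qed
  also have "\<dots> = exp (- 2 * l) * (LINT u|nu_Ca X a. exp ((h * s) * Zobs X a x u))" by simp
  also have "\<dots> \<le> exp (- 2 * l) * exp ((h * s)\<^sup>2 * (ell X a x)\<^sup>2)"
    by (intro mult_left_mono Zobs_laplace(2) x) simp
  also have "(h * s)\<^sup>2 = h\<^sup>2" using s by auto
  also have "exp (- 2 * l) * exp (h\<^sup>2 * (ell X a x)\<^sup>2) \<le> exp (- 2 * l) * exp (h\<^sup>2 * L\<^sup>2)"
    using L ell_nonneg[OF x] by (intro mult_left_mono) (auto intro!: mult_left_mono power_mono)
  also have "\<dots> = exp (- l)" using h(3) by (simp flip: exp_add)
  finally show ?thesis by (simp add: A_def)
qed

text \<open>The Chernoff parameter divides by the scale bound, which may be 0. When the scale of an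
  observable is 0, definiteness of the dual form makes its vector zero.\<close>

lemma Zobs_eq_0:
  assumes x: "x \<in> Tfull X" and "ell X a x = 0" and u: "u \<in> carrier_vec m"
  shows "Zobs X a x u = 0"
proof -
  have "obs X x = 0\<^sub>v m"
    using pos_def_inverse_form(2)[OF posG obs_carrier[OF x]] ell_square[OF x] assms(2) by simp
  moreover have "(LINT u'|nu_Ca X a. 0\<^sub>v m \<bullet> u') = (LINT u'|nu_Ca X a. 0)"
    by (intro Bochner_Integration.integral_cong) auto
  ultimately show ?thesis using u by (simp add: Zobs_def)
qed

lemma Zobs_tail:
  assumes x: "x \<in> Tfull X" and L: "ell X a x \<le> L" and l: "0 \<le> l"
  shows "measure (nu_Ca X a) {u \<in> carrier_vec m. 2 * L * sqrt l < \<bar>Zobs X a x u\<bar>} \<le> 2 * exp (- l)"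
proof (cases "ell X a x = 0")
  case True
  then have "0 \<le> 2 * L * sqrt l" using L l by simp
  then have "{u \<in> carrier_vec m. 2 * L * sqrt l < \<bar>Zobs X a x u\<bar>} = {}"
    using Zobs_eq_0[OF x True] by auto
  then show ?thesis by (simp only: measure_empty) simp
next
  case False
  then have L0: "0 < L" using L ell_nonneg[OF x] by simp
  interpret prob_space "nu_Ca X a" by (rule prob_space_nu_Ca)
  have [measurable]: "Zobs X a x \<in> borel_measurable (nu_Ca X a)"
    using measurable_Zobs[OF x] by (simp add: measurable_cong_sets[OF sets_nu_Ca refl])
  let ?A = "\<lambda>s. {u \<in> space (nu_Ca X a). 2 * L * sqrt l < s * Zobs X a x u}"
  have "{u \<in> carrier_vec m. 2 * L * sqrt l < \<bar>Zobs X a x u\<bar>} \<subseteq> ?A 1 \<union> ?A (-1)" by auto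
  then have "measure (nu_Ca X a) {u \<in> carrier_vec m. 2 * L * sqrt l < \<bar>Zobs X a x u\<bar>}
      \<le> measure (nu_Ca X a) (?A 1 \<union> ?A (-1))"
    by (intro finite_measure_mono) measurable
  also have "\<dots> \<le> measure (nu_Ca X a) (?A 1) + measure (nu_Ca X a) (?A (-1))"
    by (rule measure_Un_le) measurable
  also have "\<dots> \<le> exp (- l) + exp (- l)"
    using Zobs_upper_tail[OF x L0 L l, of 1] Zobs_upper_tail[OF x L0 L l, of "-1"] by (intro add_mono) auto
  finally show ?thesis by simp
qed

section \<open>Suprema over finite observable classes\<close>

lemma supZ_le_iff:
  assumes "finite T" "T \<noteq> {}"
  shows "supZ X a T u \<le> c \<longleftrightarrow> (\<forall>x\<in>T. \<bar>Zobs X a x u\<bar> \<le> c)"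
  unfolding supZ_def using assms by (intro cSUP_le_iff) auto

lemma measurable_supZ:
  assumes "T \<subseteq> Tfull X"
  shows "supZ X a T \<in> borel_measurable (nu_Ca X a)"
proof -
  have T: "finite T" using assms finite_Tfull by (rule finite_subset)
  have [measurable]: "Zobs X a x \<in> borel_measurable (nu_Ca X a)" if "x \<in> T" for x
    using measurable_Zobs[of x] assms that by (auto simp: measurable_cong_sets[OF sets_nu_Ca refl])
  show ?thesis unfolding supZ_def
    by (intro borel_measurable_cSUP) (use T in \<open>auto intro: countable_finite\<close>)
qed

lemma supZ_tail:
  assumes T: "T \<subseteq> Tfull X" "T \<noteq> {}" and L: "\<And>x. x \<in> T \<Longrightarrow> ell X a x \<le> L" and e: "0 < e" "e \<le> 1"
  shows "1 - e \<le> measure (nu_Ca X a) {u \<in> space (nu_Ca X a).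
    supZ X a T u \<le> 2 * L * sqrt (ln (2 * real (card T) / e))}"
proof -
  interpret prob_space "nu_Ca X a" by (rule prob_space_nu_Ca)
  have fT: "finite T" using T(1) finite_Tfull by (rule finite_subset)
  then have c: "1 \<le> real (card T)" using T(2) by (simp add: Suc_le_eq card_gt_0_iff)
  \<comment> \<open>Chosen so that \<open>card T\<close> two-sided tails of size 2 exp (- l) add up
    to \<open>e\<close>.\<close>
  define l where "l = ln (2 * real (card T) / e)"
  have "1 \<le> 2 * real (card T) / e" using c e by (simp add: field_simps)
  then have l: "0 \<le> l" "real (card T) * (2 * exp (- l)) = e"
    using c e by (auto simp: l_def exp_minus)
  note [measurable] = measurable_supZ[OF T(1)]
  have Zm[measurable]: "Zobs X a x \<in> borel_measurable (nu_Ca X a)" if "x \<in> T" for x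
    using measurable_Zobs[of x] T that by (auto simp: measurable_cong_sets[OF sets_nu_Ca refl])
  let ?G = "{u \<in> space (nu_Ca X a). supZ X a T u \<le> 2 * L * sqrt l}"
  let ?B = "\<lambda>x. {u \<in> space (nu_Ca X a). 2 * L * sqrt l < \<bar>Zobs X a x u\<bar>}"
  have G: "?G \<in> sets (nu_Ca X a)" by measurable
  have Bm: "?B x \<in> sets (nu_Ca X a)" if "x \<in> T" for x using that by measurable
  have "1 - measure (nu_Ca X a) ?G = measure (nu_Ca X a) (space (nu_Ca X a) - ?G)"
    using prob_compl[OF G] by simp
  also have "space (nu_Ca X a) - ?G = (\<Union>x\<in>T. ?B x)"
    using supZ_le_iff[OF fT T(2)] by (auto simp: not_le)
  also have "measure (nu_Ca X a) \<dots> \<le> (\<Sum>x\<in>T. measure (nu_Ca X a) (?B x))"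
    using fT Bm by (intro finite_measure_subadditive_finite) blast+
  also have "\<dots> \<le> (\<Sum>x\<in>T. 2 * exp (- l))"
    using Zobs_tail[OF _ L l(1)] T(1) by (intro sum_mono) auto
  also have "\<dots> = e" using l(2) by simp
  finally show ?thesis unfolding l_def[symmetric] by linarith
qed

lemma supZ_integrable:
  assumes T: "T \<subseteq> Tfull X" "T \<noteq> {}"
  shows "integrable (nu_Ca X a) (supZ X a T)"
proof (rule Bochner_Integration.integrable_bound)
  interpret prob_space "nu_Ca X a" by (rule prob_space_nu_Ca)
  have fT: "finite T" using T(1) finite_Tfull by (rule finite_subset)
  show "integrable (nu_Ca X a) (\<lambda>u. \<Sum>x\<in>T. \<bar>Zobs X a x u\<bar>)"
    unfolding Zobs_def using T(1)
    by (intro Bochner_Integration.integrable_sum integrable_abs Bochner_Integration.integrable_diff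
        observable_integrable obs_carrier) auto
  show "supZ X a T \<in> borel_measurable (nu_Ca X a)" by (rule measurable_supZ[OF T(1)])
  have "\<bar>supZ X a T u\<bar> \<le> (\<Sum>x\<in>T. \<bar>Zobs X a x u\<bar>)" for u
  proof -
    obtain x where "x \<in> T" using T(2) by blast
    then have "0 \<le> supZ X a T u"
      using supZ_le_iff[OF fT T(2), of u "supZ X a T u"] by (meson abs_ge_zero order_refl order_trans)
    moreover have "supZ X a T u \<le> (\<Sum>x\<in>T. \<bar>Zobs X a x u\<bar>)"
      using fT by (auto simp: supZ_le_iff[OF fT T(2)] intro: member_le_sum)
    ultimately show ?thesis by simp
  qed
  then show "AE u in nu_Ca X a. norm (supZ X a T u) \<le> norm (\<Sum>x\<in>T. \<bar>Zobs X a x u\<bar>)"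
    by (intro AE_I2) (simp add: sum_nonneg)
qed

text \<open>The usual exponential maximal inequality, with the logarithm replaced by a tangent: y
  \<le> exp y / M + 2 l - 1 is the tangent to exp at 2 l, where M = exp (2 l). Over both signs and
  all of \<open>T\<close>, the expected exponentials total at most 2 card T exp l = M. Hence the
  expectation of \<open>h\<close> times the supremum is at most 2 l = 2 h^2.\<close>

lemma supZ_expectation_le:
  assumes T: "T \<subseteq> Tfull X" "T \<noteq> {}" and L: "\<And>x. x \<in> T \<Longrightarrow> ell X a x \<le> 1"
  shows "(LINT u|nu_Ca X a. supZ X a T u) \<le> 2 * sqrt (ln (2 * real (card T)))"
proof -
  interpret prob_space "nu_Ca X a" by (rule prob_space_nu_Ca)
  have fT: "finite T" using T(1) finite_Tfull by (rule finite_subset)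
  then have c: "1 \<le> real (card T)" using T(2) by (simp add: Suc_le_eq card_gt_0_iff)
  define l where "l = ln (2 * real (card T))"
  define h where "h = sqrt l"
  have l: "0 < l" using c by (simp add: l_def)
  have h: "0 < h" "h\<^sup>2 = l" using l by (auto simp: h_def)
  define M where "M = exp (2 * l)"
  have M: "0 < M" by (simp add: M_def)
  define g where "g u = (\<Sum>x\<in>T. exp (h * Zobs X a x u) + exp ((- h) * Zobs X a x u)) / M + (2 * l - 1)" for u
  have ig: "integrable (nu_Ca X a) g"
    unfolding g_def using T(1)
    by (intro Bochner_Integration.integrable_add integrable_divide Bochner_Integration.integrable_sum Zobs_laplace(1)) auto
  have le: "h * supZ X a T u \<le> g u" for u
  proof -
    have "\<bar>Zobs X a x u\<bar> \<le> g u / h" if x: "x \<in> T" for x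
    proof -
      let ?z = "Zobs X a x u"
      have "exp (h * \<bar>?z\<bar>) \<le> exp (h * ?z) + exp ((- h) * ?z)" by (cases "0 \<le> ?z") (auto simp: abs_if)
      also have "\<dots> \<le> (\<Sum>x\<in>T. exp (h * Zobs X a x u) + exp ((- h) * Zobs X a x u))"
        using fT x by (intro member_le_sum[of x T "\<lambda>x. exp (h * Zobs X a x u) + exp ((- h) * Zobs X a x u)"]) (auto intro!: add_nonneg_nonneg)
      finally have "exp (h * \<bar>?z\<bar>) / M \<le> g u - (2 * l - 1)" using M by (simp add: g_def divide_right_mono)
      moreover have "1 + (h * \<bar>?z\<bar> - 2 * l) \<le> exp (h * \<bar>?z\<bar>) / M"
        using exp_ge_add_one_self[of "h * \<bar>?z\<bar> - 2 * l"] by (simp add: M_def exp_diff)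
      ultimately have "h * \<bar>?z\<bar> \<le> g u" by linarith
      then show ?thesis using h(1) by (simp add: field_simps)
    qed
    then have "supZ X a T u \<le> g u / h" by (simp add: supZ_le_iff[OF fT T(2)])
    then show ?thesis using h(1) by (simp add: field_simps)
  qed
  have "h * (LINT u|nu_Ca X a. supZ X a T u) = (LINT u|nu_Ca X a. h * supZ X a T u)" by simp
  also have "\<dots> \<le> (LINT u|nu_Ca X a. g u)"
    using le by (intro integral_mono ig integrable_mult_right supZ_integrable T)
  also have "\<dots> = (\<Sum>x\<in>T. (LINT u|nu_Ca X a. exp (h * Zobs X a x u)) + (LINT u|nu_Ca X a. exp ((- h) * Zobs X a x u))) / M
      + (2 * l - 1)"
  proof -
    have i: "integrable (nu_Ca X a) (\<lambda>u. exp (k * Zobs X a x u))" if "x \<in> T" for x k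
      using T(1) that by (intro Zobs_laplace(1)) auto
    then have i2: "integrable (nu_Ca X a) (\<lambda>u. exp (h * Zobs X a x u) + exp ((- h) * Zobs X a x u))" if "x \<in> T" for x
      using that by (intro Bochner_Integration.integrable_add)
    have "(LINT u|nu_Ca X a. g u) = (LINT u|nu_Ca X a. (\<Sum>x\<in>T. exp (h * Zobs X a x u) + exp ((- h) * Zobs X a x u)) / M)
        + (LINT u|nu_Ca X a. 2 * l - 1)"
      unfolding g_def using i2 by (intro Bochner_Integration.integral_add integrable_divide Bochner_Integration.integrable_sum) auto
    also have "(LINT u|nu_Ca X a. (\<Sum>x\<in>T. exp (h * Zobs X a x u) + exp ((- h) * Zobs X a x u)) / M)
        = (\<Sum>x\<in>T. (LINT u|nu_Ca X a. exp (h * Zobs X a x u) + exp ((- h) * Zobs X a x u))) / M"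
      using i2 by (subst integral_divide_zero, subst Bochner_Integration.integral_sum) auto
    also have "(\<Sum>x\<in>T. (LINT u|nu_Ca X a. exp (h * Zobs X a x u) + exp ((- h) * Zobs X a x u)))
        = (\<Sum>x\<in>T. (LINT u|nu_Ca X a. exp (h * Zobs X a x u)) + (LINT u|nu_Ca X a. exp ((- h) * Zobs X a x u)))"
      using i by (intro sum.cong refl Bochner_Integration.integral_add)
    finally show ?thesis by simp
  qed
  also have "\<dots> \<le> (\<Sum>x\<in>T. exp l + exp l) / M + (2 * l - 1)"
  proof -
    have "(LINT u|nu_Ca X a. exp (k * Zobs X a x u)) \<le> exp l" if x: "x \<in> T" and k: "k\<^sup>2 = l" for x k
    proof -
      have xf: "x \<in> Tfull X" using x T(1) by blast
      have "(ell X a x)\<^sup>2 \<le> 1" using ell_nonneg[OF xf] L[OF x] by (simp add: power_le_one)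
      then have "k\<^sup>2 * (ell X a x)\<^sup>2 \<le> l" using l k by (simp add: mult_left_le)
      then show ?thesis using Zobs_laplace(2)[OF xf, of k] by (meson exp_le_cancel_iff order_trans)
    qed
    from this[of _ h] this[of _ "- h"] show ?thesis
      using h(2) M by (intro add_mono divide_right_mono sum_mono) auto
  qed
  also have "(\<Sum>x\<in>T. exp l + exp l) = 2 * real (card T) * exp l" by simp
  also have "\<dots> = M" using c by (simp add: M_def l_def exp_double power2_eq_square)
  also have "M / M + (2 * l - 1) = h * (2 * h)" using M h by (simp add: power2_eq_square)
  finally show ?thesis using h(1) by (simp add: h_def l_def)
qed

section \<open>Phase densities, scales and the coarse mixture\<close>

lemma phase_density_eq: "ennreal (phase_density X a z) = F z * ennreal (1 / Z)"
  using Z_pos by (simp add: phase_density_def F_def Z_def[symmetric] flip: ennreal_mult)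

lemma phase_density_nonneg: "0 \<le> phase_density X a z"
  using Z_pos by (simp add: phase_density_def Z_def[symmetric])

lemma measurable_phase_density: "phase_density X a \<in> borel_measurable (leb m \<Otimes>\<^sub>M leb n)"
proof -
  have "phase_density X a z = enn2real (F z * ennreal (1 / Z))" for z
    by (simp flip: phase_density_eq add: phase_density_nonneg)
  then have "phase_density X a = (\<lambda>z. enn2real (F z * ennreal (1 / Z)))" by blast
  then show ?thesis by simp
qed

lemma ell_le_L_sel: "x \<in> Tsel X a \<Longrightarrow> ell X a x \<le> L_sel X a"
  unfolding L_sel_def using finite_subset[OF Tsel_subset finite_Tfull] by (intro cSUP_upper) auto

lemma ell_le_L_glob:
  assumes "x \<in> Tfull X"
  shows "ell X a x \<le> L_glob X"
proof -
  have "ell X a x \<le> (SUP x\<in>Tfull X. ell X a x)" using assms finite_Tfull by (intro cSUP_upper) auto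
  also have "\<dots> \<le> L_glob X"
    unfolding L_glob_def using atlas phase by (intro cSUP_upper) (auto simp: phase_atlas_def)
  finally show ?thesis .
qed

end

lemma atlas_phaseI: "phase_atlas X \<Longrightarrow> a \<in> phases X \<Longrightarrow> atlas_phase X a"
  by unfold_locales

text \<open>\<open>nu_C\<close> is the image of the joint mixture rather than a sum of the
  \<open>nu_Ca\<close>, so the decomposition is derived by integrating the joint densities phase by
  phase.\<close>

lemma emeasure_nu_C:
  assumes X: "phase_atlas X" and A[measurable]: "A \<in> sets (leb (dimC X))"
  shows "emeasure (nu_C X) A = (\<Sum>a\<in>phases X. ennreal (weight X a) * emeasure (nu_Ca X a) A)"
proof -
  let ?M = "leb (dimC X) \<Otimes>\<^sub>M leb (dimF X)"
  let ?D = "\<lambda>z. ennreal (\<Sum>a\<in>phases X. weight X a * phase_density X a z)"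
  have w: "0 \<le> weight X a" if "a \<in> phases X" for a
    using X that by (auto simp: phase_atlas_def intro: less_imp_le)
  note ph = atlas_phaseI[OF X]
  have [measurable]: "phase_density X a \<in> borel_measurable ?M" if "a \<in> phases X" for a
    using atlas_phase.measurable_phase_density[OF ph[OF that]] .
  have [measurable]: "atlas_phase.F X a \<in> borel_measurable ?M" if "a \<in> phases X" for a
    using atlas_phase.measurable_F[OF ph[OF that]] .
  have D[measurable]: "?D \<in> borel_measurable ?M" by measurable
  have "emeasure (nu_C X) A = emeasure (nu X) (fst -` A \<inter> space (nu X))"
    unfolding nu_C_def by (intro emeasure_distr A) (simp add: nu_def leb2_def)
  also have "\<dots> = (\<integral>\<^sup>+z. ?D z * indicator (fst -` A \<inter> space ?M) z \<partial>?M)"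
    unfolding nu_def leb2_def by (subst emeasure_density[OF D]) auto
  also have "\<dots> = (\<integral>\<^sup>+z. (\<Sum>a\<in>phases X. ennreal (weight X a) *
      ((atlas_phase.F X a z * indicator A (fst z)) * ennreal (1 / atlas_phase.Z X a))) \<partial>?M)"
  proof (rule nn_integral_cong)
    fix z assume z: "z \<in> space ?M"
    have "?D z = (\<Sum>a\<in>phases X. ennreal (weight X a * phase_density X a z))"
      using w atlas_phase.phase_density_nonneg[OF ph] by (intro sum_ennreal[symmetric] mult_nonneg_nonneg) auto
    also have "\<dots> = (\<Sum>a\<in>phases X. ennreal (weight X a) * (atlas_phase.F X a z * ennreal (1 / atlas_phase.Z X a)))"
      using w atlas_phase.phase_density_nonneg[OF ph] atlas_phase.phase_density_eq[OF ph]
      by (intro sum.cong refl) (simp add: ennreal_mult)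
    finally show "?D z * indicator (fst -` A \<inter> space ?M) z = (\<Sum>a\<in>phases X. ennreal (weight X a) *
      ((atlas_phase.F X a z * indicator A (fst z)) * ennreal (1 / atlas_phase.Z X a)))"
      using z by (simp add: indicator_def sum_distrib_right)
  qed
  also have "\<dots> = (\<Sum>a\<in>phases X. ennreal (weight X a) *
      ((\<integral>\<^sup>+z. atlas_phase.F X a z * indicator A (fst z) \<partial>?M) * ennreal (1 / atlas_phase.Z X a)))"
    by (subst nn_integral_sum) (auto simp: nn_integral_cmult nn_integral_multc)
  also have "\<dots> = (\<Sum>a\<in>phases X. ennreal (weight X a) * emeasure (nu_Ca X a) A)"
  proof (intro sum.cong refl arg_cong2[where f = "(*)"])
    fix a assume a: "a \<in> phases X"
    have "emeasure (nu_Ca X a) A = (\<integral>\<^sup>+u. indicator A u \<partial>nu_Ca X a)"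
      using A by (simp add: atlas_phase.sets_nu_Ca[OF ph[OF a]])
    then show "(\<integral>\<^sup>+z. atlas_phase.F X a z * indicator A (fst z) \<partial>?M) * ennreal (1 / atlas_phase.Z X a)
        = emeasure (nu_Ca X a) A"
      by (simp add: atlas_phase.nn_integral_nu_Ca[OF ph[OF a]])
  qed
  finally show ?thesis .
qed

text \<open>Prekopa-Leindler applied to the density restricted to the three sets. A density is
  determined only up to null sets, so log-concavity is tested on masses of sets instead of point
  values.\<close>

lemma log_concave_measure_midpoint:
  assumes lc: "log_concave_measure d \<mu>"
    and [measurable]: "A \<in> sets (leb d)" "B \<in> sets (leb d)" "C \<in> sets (leb d)"
    and mid: "\<And>x y. x \<in> A \<Longrightarrow> y \<in> B \<Longrightarrow> vec_mid x y \<in> C"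
  shows "emeasure \<mu> A * emeasure \<mu> B \<le> (emeasure \<mu> C)\<^sup>2"
proof -
  obtain f where f: "f \<in> borel_measurable (leb d)" "\<forall>x\<in>carrier_vec d. 0 \<le> f x"
    "\<forall>x\<in>carrier_vec d. \<forall>y\<in>carrier_vec d. \<forall>t. 0 < t \<and> t < 1 \<longrightarrow>
        f x powr (1 - t) * f y powr t \<le> f ((1 - t) \<cdot>\<^sub>v x + t \<cdot>\<^sub>v y)"
    "\<mu> = density (leb d) (\<lambda>x. ennreal (f x))"
    using lc unfolding log_concave_measure_def by blast
  note [measurable] = f(1)
  have half: "f x * f y \<le> (f (vec_mid x y))\<^sup>2" if xy: "x \<in> carrier_vec d" "y \<in> carrier_vec d" for x y
  proof -
    have "f x powr (1 - 1/2) * f y powr (1/2) \<le> f ((1 - 1/2) \<cdot>\<^sub>v x + (1/2) \<cdot>\<^sub>v y)"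
      using f(3)[rule_format, of x y "1/2"] xy by simp
    moreover have "(1 - 1/2) \<cdot>\<^sub>v x + (1/2) \<cdot>\<^sub>v y = vec_mid x y"
      using xy unfolding vec_mid_def by (intro eq_vecI) auto
    ultimately have "sqrt (f x) * sqrt (f y) \<le> f (vec_mid x y)"
      using f(2) xy by (simp add: powr_half_sqrt)
    then have "(sqrt (f x) * sqrt (f y))\<^sup>2 \<le> (f (vec_mid x y))\<^sup>2"
      using f(2) xy by (intro power_mono) auto
    then show ?thesis using f(2) xy by (simp add: power_mult_distrib)
  qed
  have "(\<integral>\<^sup>+x. ennreal (f x) * indicator A x \<partial>leb d) * (\<integral>\<^sup>+x. ennreal (f x) * indicator B x \<partial>leb d)
      \<le> (\<integral>\<^sup>+x. ennreal (f x) * indicator C x \<partial>leb d)\<^sup>2"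
  proof (rule prekopa_leindlerD[OF prekopa_leindler_leb])
    fix x y assume "x \<in> space (leb d)" "y \<in> space (leb d)"
    then have xy: "x \<in> carrier_vec d" "y \<in> carrier_vec d" by (auto simp: space_leb)
    have "ennreal (f x) * ennreal (f y) \<le> (ennreal (f (vec_mid x y)))\<^sup>2"
      using half[OF xy] f(2) xy by (simp add: ennreal_power flip: ennreal_mult)
    then show "ennreal (f x) * indicator A x * (ennreal (f y) * indicator B y)
        \<le> (ennreal (f (vec_mid x y)) * indicator C (vec_mid x y))\<^sup>2"
      using mid[of x y] by (auto simp: indicator_def)
  qed measurable
  then show ?thesis unfolding f(4) by (simp add: emeasure_density)
qed

section \<open>Standard Gaussian vectors\<close>

lemma continuous_map_euclid_index:
  assumes "i < d"
  shows "continuous_map (euclid d) euclideanreal (\<lambda>z. z $ i)"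
proof -
  interpret Metric_space "carrier_vec d" "\<lambda>x y :: real vec. L2_set (\<lambda>i. x $ i - y $ i) {..<d}"
    by (rule Metric_space_euclid)
  show ?thesis unfolding continuous_map_def
  proof (intro conjI allI impI)
    fix V :: "real set" assume "openin euclideanreal V"
    then have V: "open V" by simp
    show "openin (euclid d) {x \<in> topspace (euclid d). x $ i \<in> V}"
      unfolding topspace_euclid unfolding euclid_def openin_mtopology
    proof (intro conjI allI impI)
      fix x :: "real vec" assume x: "x \<in> {x \<in> carrier_vec d. x $ i \<in> V}"
      then obtain e where e: "e > 0" "\<And>y. dist y (x $ i) < e \<Longrightarrow> y \<in> V"
        using V unfolding open_dist by blast
      show "\<exists>r>0. mball x r \<subseteq> {x \<in> carrier_vec d. x $ i \<in> V}"
      proof (intro exI[of _ e] conjI subsetI)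
        fix y assume y: "y \<in> mball x e"
        have "\<bar>x $ i - y $ i\<bar> \<le> L2_set (\<lambda>i. \<bar>x $ i - y $ i\<bar>) {..<d}"
          using assms by (intro member_le_L2_set) auto
        also have "\<dots> = L2_set (\<lambda>i. x $ i - y $ i) {..<d}" by (simp add: L2_set_def)
        finally have "dist (y $ i) (x $ i) < e" using y by (simp add: dist_real_def abs_minus_commute)
        then show "y \<in> {x \<in> carrier_vec d. x $ i \<in> V}" using e(2) y by simp
      qed (use e in simp)
    qed auto
  qed auto
qed

text \<open>The potential of the unit-covariance Gaussian with mean \<open>c\<close>. Its Hessian is
  the identity, so the matrix bound of an atlas will hold with equality.\<close>

definition quad :: "nat \<Rightarrow> (nat \<Rightarrow> real) \<Rightarrow> real vec \<Rightarrow> real" where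
  "quad d c z = (\<Sum>i<d. (z $ i - c i)\<^sup>2) / 2"

lemma quad_partial_derivative:
  assumes i: "i < d" and z: "z \<in> carrier_vec d"
  shows "((\<lambda>t. quad d c (z + t \<cdot>\<^sub>v unit_vec d i)) has_real_derivative (z $ i - c i)) (at 0)"
proof -
  have eq: "quad d c (z + t \<cdot>\<^sub>v unit_vec d i) = (\<Sum>j<d. (z $ j + t * (if j = i then 1 else 0) - c j)\<^sup>2) / 2" for t
    unfolding quad_def using z i by (intro arg_cong2[where f = "(/)"] sum.cong refl) auto
  have der: "((\<lambda>t. (\<Sum>j<d. (z $ j + t * (if j = i then 1 else 0) - c j)\<^sup>2) / 2) has_real_derivative
      (\<Sum>j<d. (if j = i then 2 * (z $ j - c j) else 0)) / 2) (at 0)"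
    by (intro DERIV_cdivide DERIV_sum) (auto intro!: derivative_eq_intros)
  have "(\<Sum>j<d. (if j = i then 2 * (z $ j - c j) else 0)) / 2 = z $ i - c i"
    using i by (simp add: field_simps)
  with der show ?thesis unfolding eq by (simp only:)
qed

lemma partial_deriv_quad: "i < d \<Longrightarrow> z \<in> carrier_vec d \<Longrightarrow> partial_deriv d i (quad d c) z = z $ i - c i"
  unfolding partial_deriv_def by (rule DERIV_imp_deriv) (rule quad_partial_derivative)

lemma quad_second_partial_derivative:
  assumes "i < d" "j < d" "z \<in> carrier_vec d"
  shows "((\<lambda>t. partial_deriv d j (quad d c) (z + t \<cdot>\<^sub>v unit_vec d i)) has_real_derivative
    (if i = j then 1 else 0)) (at 0)"
proof -
  have "partial_deriv d j (quad d c) (z + t \<cdot>\<^sub>v unit_vec d i) = z $ j + t * (if i = j then 1 else 0) - c j" for t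
    using assms by (subst partial_deriv_quad) auto
  moreover have "((\<lambda>t. z $ j + t * (if i = j then 1 else 0) - c j) has_real_derivative (if i = j then 1 else 0)) (at 0)"
    by (auto intro!: derivative_eq_intros)
  ultimately show ?thesis by simp
qed

lemma partial_deriv_partial_deriv_quad:
  "i < d \<Longrightarrow> j < d \<Longrightarrow> z \<in> carrier_vec d \<Longrightarrow>
    partial_deriv d i (partial_deriv d j (quad d c)) z = (if i = j then 1 else 0)"
  unfolding partial_deriv_def[of d i "partial_deriv d j (quad d c)"]
  by (rule DERIV_imp_deriv) (rule quad_second_partial_derivative)

lemma hessian_quad: "z \<in> carrier_vec d \<Longrightarrow> hessian d (quad d c) z = 1\<^sub>m d"
  unfolding hessian_def by (intro eq_matI) (auto simp: partial_deriv_partial_deriv_quad)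

lemma Ck_on_quad: "Ck_on 2 d (carrier_vec d) (quad d c)"
proof -
  let ?U = "carrier_vec d :: real vec set"
  have coord: "continuous_map (subtopology (euclid d) ?U) euclideanreal (\<lambda>z. z $ i - c i)" if "i < d" for i
    using that by (intro continuous_map_diff continuous_map_from_subtopology continuous_map_euclid_index) auto
  have q: "continuous_map (subtopology (euclid d) ?U) euclideanreal (quad d c)"
    unfolding quad_def
    by (intro continuous_map_real_divide continuous_map_sum continuous_map_real_pow coord) auto
  have p: "continuous_map (subtopology (euclid d) ?U) euclideanreal (partial_deriv d i (quad d c))" if "i < d" for i
    by (rule continuous_map_eq[OF coord[OF that]]) (simp add: partial_deriv_quad that)
  have pp: "continuous_map (subtopology (euclid d) ?U) euclideanreal (partial_deriv d i (partial_deriv d j (quad d c)))"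
    if "i < d" "j < d" for i j
    by (rule continuous_map_eq[of _ _ "\<lambda>_. if i = j then 1 else 0"])
      (simp_all add: partial_deriv_partial_deriv_quad that)
  have dq: "(\<lambda>t. quad d c (z + t \<cdot>\<^sub>v unit_vec d i)) differentiable (at 0)"
    if "i < d" "z \<in> ?U" for i z
    using quad_partial_derivative[OF that] unfolding real_differentiable_def by blast
  have dp: "(\<lambda>t. partial_deriv d j (quad d c) (z + t \<cdot>\<^sub>v unit_vec d i)) differentiable (at 0)"
    if "i < d" "j < d" "z \<in> ?U" for i j z
    using quad_second_partial_derivative[OF that] unfolding real_differentiable_def by blast
  show ?thesis
    using q p pp dq dp by (simp add: numeral_2_eq_2)
qed

section \<open>Product structure and tails of the standard Gaussian\<close>

lemma nn_integral_leb_prod: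
  assumes f: "\<And>i. i < d \<Longrightarrow> f i \<in> borel_measurable borel"
  shows "(\<integral>\<^sup>+u. (\<Prod>i<d. f i (u $ i)) \<partial>leb d) = (\<Prod>i<d. \<integral>\<^sup>+x. f i x \<partial>lborel)"
proof -
  interpret product_sigma_finite "\<lambda>_. lborel :: real measure" ..
  have "(\<lambda>u. \<Prod>i<d. f i (u $ i)) \<in> borel_measurable (leb d)"
    using f by (intro borel_measurable_prod_ennreal measurable_compose[OF measurable_vec_index_leb]) auto
  then have "(\<integral>\<^sup>+u. (\<Prod>i<d. f i (u $ i)) \<partial>leb d) = (\<integral>\<^sup>+x. (\<Prod>i<d. f i (vec d x $ i)) \<partial>(\<Pi>\<^sub>M i\<in>{..<d}. lborel))"
    by (rule nn_integral_leb)
  also have "\<dots> = (\<integral>\<^sup>+x. (\<Prod>i<d. f i (x i)) \<partial>(\<Pi>\<^sub>M i\<in>{..<d}. lborel))"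
    by (intro nn_integral_cong prod.cong refl) simp
  also have "\<dots> = (\<Prod>i<d. \<integral>\<^sup>+x. f i x \<partial>lborel)"
    using f by (intro product_nn_integral_prod) auto
  finally show ?thesis .
qed

text \<open>The density is written as a product so that box probabilities factor;
  \<open>prod_normal_density\<close> turns it into the exponential of \<open>quad\<close>.\<close>

definition std_gaussian :: "nat \<Rightarrow> (nat \<Rightarrow> real) \<Rightarrow> real vec measure" where
  "std_gaussian d c = density (leb d) (\<lambda>u. ennreal (\<Prod>i<d. normal_density (c i) 1 (u $ i)))"

lemma space_std_gaussian [simp]: "space (std_gaussian d c) = carrier_vec d"
  and sets_std_gaussian [simp, measurable_cong]: "sets (std_gaussian d c) = sets (leb d)"
  by (simp_all add: std_gaussian_def space_leb)

lemma prod_normal_density: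
  "(\<Prod>i<d. normal_density (c i) 1 (u $ i)) = exp (- quad d c u) / sqrt (2 * pi) ^ d"
proof -
  have "(\<Prod>i<d. normal_density (c i) 1 (u $ i)) = (\<Prod>i<d. exp (- ((u $ i - c i)\<^sup>2 / 2)) / sqrt (2 * pi))"
    by (simp add: normal_density_def)
  also have "\<dots> = (\<Prod>i<d. exp (- ((u $ i - c i)\<^sup>2 / 2))) / sqrt (2 * pi) ^ d"
    by (simp add: prod_dividef)
  also have "(\<Prod>i<d. exp (- ((u $ i - c i)\<^sup>2 / 2))) = exp (- quad d c u)"
    by (simp add: exp_sum[symmetric] quad_def sum_negf sum_divide_distrib)
  finally show ?thesis .
qed

lemma measurable_quad [measurable]: "quad d c \<in> borel_measurable (leb d)"
proof -
  have "(\<lambda>u. (\<Sum>i<d. (u $ i - c i)\<^sup>2) / 2) \<in> borel_measurable (leb d)"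
    by (intro borel_measurable_divide borel_measurable_sum borel_measurable_power borel_measurable_diff
        measurable_vec_index_leb) auto
  then show ?thesis by (simp add: quad_def[abs_def])
qed

text \<open>Independence of the coordinates: each one outside \<open>T\<close> integrates to
  1.\<close>

lemma emeasure_std_gaussian_box:
  assumes T: "T \<subseteq> {..<d}" and A: "\<And>i. A i \<in> sets borel"
  shows "{u \<in> carrier_vec d. \<forall>i\<in>T. u $ i \<in> A i} \<in> sets (leb d)"
    "emeasure (std_gaussian d c) {u \<in> carrier_vec d. \<forall>i\<in>T. u $ i \<in> A i}
      = (\<Prod>i\<in>T. emeasure (density lborel (normal_density (c i) 1)) (A i))"
proof -
  have fT: "finite T" using T by (rule finite_subset) simp
  let ?S = "{u \<in> space (leb d). \<forall>i\<in>T. u $ i \<in> A i}"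
  have S: "?S \<in> sets (leb d)"
  proof (rule sets.sets_Collect_finite_All[OF _ fT])
    fix i assume "i \<in> T"
    then have [measurable]: "(\<lambda>u. u $ i) \<in> borel_measurable (leb d)"
      using T by (intro measurable_vec_index_leb) auto
    note [measurable] = A[of i]
    show "{u \<in> space (leb d). u $ i \<in> A i} \<in> sets (leb d)" by measurable
  qed
  then show "{u \<in> carrier_vec d. \<forall>i\<in>T. u $ i \<in> A i} \<in> sets (leb d)" by (simp add: space_leb)
  let ?f = "\<lambda>i x. ennreal (normal_density (c i) 1 x) * (if i \<in> T then indicator (A i) x else 1)"
  have "emeasure (std_gaussian d c) ?S
      = (\<integral>\<^sup>+u. ennreal (\<Prod>i<d. normal_density (c i) 1 (u $ i)) * indicator ?S u \<partial>leb d)"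
    unfolding std_gaussian_def using S by (intro emeasure_density) (auto simp: prod_normal_density)
  also have "\<dots> = (\<integral>\<^sup>+u. (\<Prod>i<d. ?f i (u $ i)) \<partial>leb d)"
  proof (rule nn_integral_cong)
    fix u assume u: "u \<in> space (leb d)"
    have "(\<Prod>i<d. (if i \<in> T then indicator (A i) (u $ i) else 1) :: ennreal) = (\<Prod>i\<in>T. indicator (A i) (u $ i))"
      using T by (simp add: prod.inter_restrict[symmetric] Int_absorb1)
    also have "\<dots> = indicator ?S u"
    proof (cases "\<forall>i\<in>T. u $ i \<in> A i")
      case False
      then show ?thesis using fT by (auto simp: indicator_def intro!: prod_zero)
    qed (use u in \<open>simp add: indicator_def\<close>)
    finally show "ennreal (\<Prod>i<d. normal_density (c i) 1 (u $ i)) * indicator ?S u = (\<Prod>i<d. ?f i (u $ i))"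
      by (simp only: prod.distrib) (simp add: prod_ennreal normal_density_nonneg)
  qed
  also have "\<dots> = (\<Prod>i<d. \<integral>\<^sup>+x. ?f i x \<partial>lborel)"
    using A by (intro nn_integral_leb_prod) auto
  also have "\<dots> = (\<Prod>i<d. if i \<in> T then emeasure (density lborel (normal_density (c i) 1)) (A i) else 1)"
  proof (rule prod.cong[OF refl])
    fix i
    show "(\<integral>\<^sup>+x. ?f i x \<partial>lborel) = (if i \<in> T then emeasure (density lborel (normal_density (c i) 1)) (A i) else 1)"
    proof (cases "i \<in> T")
      case False
      have "(\<integral>\<^sup>+x. ennreal (normal_density (c i) 1 x) \<partial>lborel) = ennreal 1"
        by (subst nn_integral_eq_integral) (auto simp: normal_density_nonneg)
      then show ?thesis using False by simp
    qed (use A in \<open>simp add: emeasure_density\<close>)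
  qed
  also have "\<dots> = (\<Prod>i\<in>T. emeasure (density lborel (normal_density (c i) 1)) (A i))"
    using T by (simp add: prod.inter_restrict[symmetric] Int_absorb1)
  finally show "emeasure (std_gaussian d c) {u \<in> carrier_vec d. \<forall>i\<in>T. u $ i \<in> A i}
      = (\<Prod>i\<in>T. emeasure (density lborel (normal_density (c i) 1)) (A i))"
    by (simp add: space_leb)
qed

lemma prob_space_std_gaussian: "prob_space (std_gaussian d c)"
proof
  show "emeasure (std_gaussian d c) (space (std_gaussian d c)) = 1"
    using emeasure_std_gaussian_box(2)[of "{}" d "\<lambda>_. UNIV" c] by simp
qed

text \<open>Boxes that constrain a single coordinate identify its law as normal with mean
  \<open>c i\<close>.\<close>

lemma std_gaussian_mean:
  assumes i: "i < d"
  shows "(LINT u|std_gaussian d c. u $ i) = c i"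
proof -
  interpret prob_space "std_gaussian d c" by (rule prob_space_std_gaussian)
  have X: "(\<lambda>u. u $ i) \<in> measurable (std_gaussian d c) lborel"
    using measurable_vec_index_leb[OF i] by (simp add: measurable_cong_sets[OF sets_std_gaussian sets_lborel])
  have "distr (std_gaussian d c) lborel (\<lambda>u. u $ i) = density lborel (normal_density (c i) 1)"
  proof (rule measure_eqI)
    fix B assume "B \<in> sets (distr (std_gaussian d c) lborel (\<lambda>u. u $ i))"
    then have B: "B \<in> sets borel" by simp
    have "emeasure (distr (std_gaussian d c) lborel (\<lambda>u. u $ i)) B
        = emeasure (std_gaussian d c) {u \<in> carrier_vec d. \<forall>j\<in>{i}. u $ j \<in> B}"
      using B by (subst emeasure_distr[OF X]) (auto intro!: arg_cong[where f = "emeasure _"])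
    also have "\<dots> = emeasure (density lborel (normal_density (c i) 1)) B"
      using i B by (subst emeasure_std_gaussian_box(2)) auto
    finally show "emeasure (distr (std_gaussian d c) lborel (\<lambda>u. u $ i)) B
        = emeasure (density lborel (normal_density (c i) 1)) B" .
  qed simp
  then have "distributed (std_gaussian d c) lborel (\<lambda>u. u $ i) (normal_density (c i) 1)"
    using X by (simp add: distributed_def)
  from normal_distributed_expectation[OF _ this] show ?thesis by simp
qed

lemma pos_def_one: "pos_def d (1\<^sub>m d)"
  unfolding pos_def_def
proof (intro conjI ballI impI)
  fix x :: "real vec" assume x: "x \<in> carrier_vec d" "x \<noteq> 0\<^sub>v d"
  then obtain i where i: "i < d" "x $ i \<noteq> 0" by (auto simp: vec_eq_iff)
  have "0 < (\<Sum>i\<in>{0..<d}. x $ i * x $ i)"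
    using i by (intro sum_pos2[of _ i]) (auto simp: less_le)
  then show "0 < x \<bullet> (1\<^sub>m d *\<^sub>v x)" using x by (simp add: scalar_prod_def)
qed auto

lemma inv_mat_one: "inv_mat (1\<^sub>m d) = 1\<^sub>m d"
  using pos_def_inverse(1,2)[OF pos_def_one[of d]] by simp

lemma gaussian_measure_std_gaussian: "gaussian_measure d (std_gaussian d c)"
proof -
  note one = pos_def_one[of d] and inv = inv_mat_one[of d]
  let ?b = "vec d c"
  have dens: "exp (- ((u - ?b) \<bullet> (inv_mat (1\<^sub>m d) *\<^sub>v (u - ?b))) / 2) / sqrt ((2 * pi) ^ d * det (1\<^sub>m d))
      = (\<Prod>i<d. normal_density (c i) 1 (u $ i))" if u: "u \<in> carrier_vec d" for u
  proof -
    have "(u - ?b) \<bullet> (inv_mat (1\<^sub>m d) *\<^sub>v (u - ?b)) = (u - ?b) \<bullet> (u - ?b)" using u by (simp add: inv)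
    also have "\<dots> = (\<Sum>i<d. (u $ i - c i)\<^sup>2)"
      using u by (simp add: scalar_prod_def atLeast0LessThan power2_eq_square)
    finally show ?thesis by (simp add: prod_normal_density quad_def real_sqrt_power real_sqrt_mult power_mult_distrib)
  qed
  have m: "(\<lambda>u. ennreal (\<Prod>i<d. normal_density (c i) 1 (u $ i))) \<in> borel_measurable (leb d)"
    by (simp add: prod_normal_density)
  have "std_gaussian d c = density (leb d) (\<lambda>u. ennreal
       (exp (- ((u - ?b) \<bullet> (inv_mat (1\<^sub>m d) *\<^sub>v (u - ?b))) / 2) / sqrt ((2 * pi) ^ d * det (1\<^sub>m d))))"
    unfolding std_gaussian_def
  proof (rule density_cong[OF m])
    show "(\<lambda>u. ennreal (exp (- ((u - ?b) \<bullet> (inv_mat (1\<^sub>m d) *\<^sub>v (u - ?b))) / 2) / sqrt ((2 * pi) ^ d * det (1\<^sub>m d))))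
        \<in> borel_measurable (leb d)"
      using m by (rule measurable_cong[THEN iffD1, rotated]) (simp only: dens space_leb)
  qed (rule AE_I2, simp only: dens space_leb)
  then show ?thesis unfolding gaussian_measure_def using one by (intro bexI[of _ ?b]) auto
qed

text \<open>The missing mass is already found in the adjacent unit interval. With t^2 = ln k one has
  (t + 1)^2 \<le> 2 (t^2 + 1), so the density there is at least 1 / (k e sqrt (2 pi)); both e and
  sqrt (2 pi) are at most 3, whence the 9.\<close>

lemma normal_interval_le:
  fixes c k :: real
  assumes k: "1 \<le> k"
  shows "emeasure (density lborel (normal_density c 1)) {c - sqrt (ln k)..c + sqrt (ln k)} \<le> ennreal (1 - 1 / (9 * k))"
proof -
  interpret prob_space "density lborel (normal_density c 1)" by (rule prob_space_normal_density) simp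
  let ?P = "density lborel (normal_density c 1)"
  define t where "t = sqrt (ln k)"
  have t: "0 \<le> t" "t\<^sup>2 = ln k" using k by (auto simp: t_def)
  let ?I = "{c - t..c + t}" and ?J = "{c + t<..c + t + 1}"
  have low: "1 / (9 * k) \<le> normal_density c 1 x" if "x \<in> ?J" for x
  proof -
    have "(x - c)\<^sup>2 \<le> (t + 1)\<^sup>2" using that t by (intro power_mono) auto
    also have "\<dots> \<le> 2 * (t\<^sup>2 + 1)" using zero_le_power2[of "t - 1"] by (simp add: power2_eq_square algebra_simps)
    finally have "exp (- (ln k + 1)) \<le> exp (- (x - c)\<^sup>2 / 2)" using t(2) by simp
    then have "exp (- (ln k + 1)) / sqrt (2 * pi) \<le> exp (- (x - c)\<^sup>2 / 2) / sqrt (2 * pi)"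
      by (rule divide_right_mono) simp
    moreover have "exp (- (ln k + 1)) / sqrt (2 * pi) = 1 / (k * exp 1) / sqrt (2 * pi)"
      using k by (simp add: exp_minus exp_diff inverse_eq_divide)
    moreover have "1 / (9 * k) \<le> 1 / (k * exp 1) / sqrt (2 * pi)"
    proof -
      have "sqrt (2 * pi) \<le> sqrt 9" using pi_less_4 by (intro real_sqrt_le_mono) simp
      then have s: "sqrt (2 * pi) \<le> 3" by simp
      have "exp 1 * sqrt (2 * pi) \<le> 3 * 3" using s exp_le by (intro mult_mono) auto
      then have "k * (exp 1 * sqrt (2 * pi)) \<le> k * 9" using k by (intro mult_left_mono) auto
      then show ?thesis using k by (simp add: field_simps)
    qed
    ultimately have "1 / (9 * k) \<le> exp (- (x - c)\<^sup>2 / 2) / sqrt (2 * pi)" by linarith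
    then show ?thesis by (simp add: normal_density_def)
  qed
  have "ennreal (1 / (9 * k)) = (\<integral>\<^sup>+x. ennreal (1 / (9 * k)) * indicator ?J x \<partial>lborel)"
    by (simp add: nn_integral_cmult)
  also have "\<dots> \<le> (\<integral>\<^sup>+x. ennreal (normal_density c 1 x) * indicator ?J x \<partial>lborel)"
    using low by (intro nn_integral_mono) (auto simp: indicator_def intro!: ennreal_leI)
  also have "\<dots> = emeasure ?P ?J" by (simp add: emeasure_density)
  finally have J: "1 / (9 * k) \<le> measure ?P ?J" using k by (simp add: emeasure_eq_measure)
  have "measure ?P ?I + measure ?P ?J = measure ?P (?I \<union> ?J)"
    by (intro finite_measure_Union[symmetric]) auto
  also have "\<dots> \<le> 1" by (rule prob_le_1)
  finally show ?thesis using J by (simp add: emeasure_eq_measure t_def ennreal_leI)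
qed

lemma normal_chebyshev:
  fixes c r :: real
  assumes r: "0 < r"
  shows "emeasure (density lborel (normal_density c 1)) {x. r \<le> \<bar>x - c\<bar>} \<le> ennreal (1 / r\<^sup>2)"
proof -
  have [measurable]: "{x. r \<le> \<bar>x - c\<bar>} \<in> sets borel" by measurable
  have "emeasure (density lborel (normal_density c 1)) {x. r \<le> \<bar>x - c\<bar>}
      = (\<integral>\<^sup>+x. ennreal (normal_density c 1 x) * indicator {x. r \<le> \<bar>x - c\<bar>} x \<partial>lborel)"
    by (simp add: emeasure_density)
  also have "\<dots> \<le> (\<integral>\<^sup>+x. ennreal (normal_density c 1 x * (x - c)\<^sup>2 / r\<^sup>2) \<partial>lborel)"
  proof (rule nn_integral_mono)
    fix x
    show "ennreal (normal_density c 1 x) * indicator {x. r \<le> \<bar>x - c\<bar>} x \<le> ennreal (normal_density c 1 x * (x - c)\<^sup>2 / r\<^sup>2)"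
    proof (cases "r \<le> \<bar>x - c\<bar>")
      case True
      then have "r\<^sup>2 \<le> (x - c)\<^sup>2" using r by (metis abs_le_square_iff abs_of_pos)
      then have "normal_density c 1 x * r\<^sup>2 \<le> normal_density c 1 x * (x - c)\<^sup>2"
        by (intro mult_left_mono normal_density_nonneg)
      then have "normal_density c 1 x \<le> normal_density c 1 x * (x - c)\<^sup>2 / r\<^sup>2"
        using r by (simp add: pos_le_divide_eq)
      then show ?thesis using True by (simp add: ennreal_leI)
    qed simp
  qed
  also have "\<dots> = ennreal (LINT x|lborel. normal_density c 1 x * (x - c)\<^sup>2 / r\<^sup>2)"
    using integrable_normal_moment[of 1 c 2]
    by (intro nn_integral_eq_integral integrable_divide) (auto simp: normal_density_nonneg)
  also have "(LINT x|lborel. normal_density c 1 x * (x - c)\<^sup>2 / r\<^sup>2) = 1 / r\<^sup>2"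
    using integral_normal_moment_even[of 1 c 1] by simp
  finally show ?thesis .
qed

section \<open>A Gaussian mixture with disjoint observable blocks\<close>

text \<open>A zero-dimensional fibre is one point of mass 1, so integrating it out is evaluation at
  \<open>vNil\<close>.\<close>

lemma leb_0: "leb 0 = count_space {vNil}"
proof -
  have "leb 0 = embed_measure (count_space {\<lambda>_. undefined}) (vec 0)"
    by (simp add: leb_def PiM_empty)
  also have "\<dots> = count_space (vec 0 ` {\<lambda>_. undefined :: real})"
    by (rule embed_measure_count_space') simp
  also have "vec 0 ` {\<lambda>_. undefined :: real} = {vNil}" by (auto intro: eq_vecI)
  finally show ?thesis .
qed

lemma append_vNil: "dim_vec v = 0 \<Longrightarrow> u @\<^sub>v v = u"
  by (intro eq_vecI) auto

lemma nn_integral_exp_quad: "(\<integral>\<^sup>+u. ennreal (exp (- quad d c u)) \<partial>leb d) = ennreal (sqrt (2 * pi) ^ d)"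
proof -
  have "1 = emeasure (std_gaussian d c) (space (std_gaussian d c))"
    using prob_space.emeasure_space_1[OF prob_space_std_gaussian] by simp
  also have "\<dots> = (\<integral>\<^sup>+u. ennreal (exp (- quad d c u)) * ennreal (1 / sqrt (2 * pi) ^ d) \<partial>leb d)"
    unfolding std_gaussian_def
    by (subst emeasure_density) (auto simp: prod_normal_density intro!: nn_integral_cong simp flip: ennreal_mult)
  also have "\<dots> = (\<integral>\<^sup>+u. ennreal (exp (- quad d c u)) \<partial>leb d) * ennreal (1 / sqrt (2 * pi) ^ d)"
    by (rule nn_integral_multc) measurable
  finally have "ennreal (sqrt (2 * pi) ^ d) = (\<integral>\<^sup>+u. ennreal (exp (- quad d c u)) \<partial>leb d)
      * (ennreal (1 / sqrt (2 * pi) ^ d) * ennreal (sqrt (2 * pi) ^ d))"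
    by (metis mult.assoc mult.left_neutral)
  also have "ennreal (1 / sqrt (2 * pi) ^ d) * ennreal (sqrt (2 * pi) ^ d) = 1"
    by (simp flip: ennreal_mult)
  finally show ?thesis by simp
qed

text \<open>The spacing grows with \<open>N\<close> because every peak is weighted by 1 / N, and
  Chebyshev then leaves mass of order 1 / N^2 only between the first two peaks.\<close>

definition centre :: "nat \<Rightarrow> nat \<Rightarrow> nat \<Rightarrow> real" where
  "centre N b i = (if i = 0 then 8 * real N * real b else 0)"

text \<open>The fibre space has dimension 0, so the coarse measure is the full one.  Distinct phases are
  centred far apart on the first coordinate axis, and phase \<open>b\<close> sees its own block of \<open>K\<close> coordinates.\<close>

definition mixture_atlas :: "nat \<Rightarrow> nat \<Rightarrow> atlas" where
  "mixture_atlas N K = \<lparr>dimC = N * K, dimF = 0, phases = {..<N}, weight = \<lambda>_. 1 / real N,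
     OmegaC = \<lambda>_. carrier_vec (N * K), OmegaF = \<lambda>_. carrier_vec 0,
     action = \<lambda>b. quad (N * K) (centre N b),
     blkA = \<lambda>_. 1\<^sub>m (N * K), blkB = \<lambda>_. 0\<^sub>m (N * K) 0, blkD = \<lambda>_. 1\<^sub>m 0,
     obs = unit_vec (N * K), Tfull = {..<N * K}, Tsel = \<lambda>b. {b * K..<b * K + K}\<rparr>"

lemma mixture_atlas_simps [simp]:
  "dimC (mixture_atlas N K) = N * K" "dimF (mixture_atlas N K) = 0" "phases (mixture_atlas N K) = {..<N}"
  "weight (mixture_atlas N K) b = 1 / real N"
  "OmegaC (mixture_atlas N K) b = carrier_vec (N * K)" "OmegaF (mixture_atlas N K) b = carrier_vec 0"
  "action (mixture_atlas N K) b = quad (N * K) (centre N b)"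
  "blkA (mixture_atlas N K) b = 1\<^sub>m (N * K)" "blkB (mixture_atlas N K) b = 0\<^sub>m (N * K) 0"
  "blkD (mixture_atlas N K) b = 1\<^sub>m 0" "obs (mixture_atlas N K) = unit_vec (N * K)"
  "Tfull (mixture_atlas N K) = {..<N * K}" "Tsel (mixture_atlas N K) b = {b * K..<b * K + K}"
  by (simp_all add: mixture_atlas_def)

lemma HRG_mixture_atlas: "HRG (mixture_atlas N K) b = 1\<^sub>m (N * K)"
  unfolding HRG_def by (intro eq_matI) (auto simp: inv_mat_one scalar_prod_def)

lemma Hmat_mixture_atlas: "Hmat (mixture_atlas N K) b = 1\<^sub>m (N * K)"
  unfolding Hmat_def by (intro eq_matI) auto

lemma phase_atlas_mixture_atlas:
  assumes "2 \<le> N" "2 \<le> K"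
  shows "phase_atlas (mixture_atlas N K)"
proof -
  let ?X = "mixture_atlas N K" and ?d = "N * K"
  have closed: "closedin (euclid d) (carrier_vec d)" for d
    using closedin_topspace[of "euclid d"] by simp
  have interior: "(euclid d) interior_of (carrier_vec d) \<noteq> {}" for d
  proof -
    have "(euclid d) interior_of (carrier_vec d) = carrier_vec d"
      using interior_of_topspace[of "euclid d"] by simp
    moreover have "0\<^sub>v d \<in> (carrier_vec d :: real vec set)" by simp
    ultimately show ?thesis by blast
  qed
  have convex: "convex_vec (carrier_vec d)" for d by (auto simp: convex_vec_def)
  interpret P: pair_sigma_finite "leb ?d" "leb 0"
    by (intro pair_sigma_finite.intro sigma_finite_leb)
  have joint: "set_integrable (leb2 ?X) (carrier_vec ?d \<times> carrier_vec 0)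
      (\<lambda>(u, v). exp (- action ?X b (u @\<^sub>v v)))" for b
  proof -
    let ?q = "quad ?d (centre N b)"
    have "integrable (leb ?d \<Otimes>\<^sub>M leb 0) (\<lambda>z. exp (- ?q (fst z)))"
    proof (rule integrableI_bounded)
      have "(\<integral>\<^sup>+z. ennreal (norm (exp (- ?q (fst z)))) \<partial>(leb ?d \<Otimes>\<^sub>M leb 0))
          = (\<integral>\<^sup>+u. \<integral>\<^sup>+v. ennreal (exp (- ?q u)) \<partial>leb 0 \<partial>leb ?d)"
        by (subst P.M2.nn_integral_fst[symmetric]) auto
      also have "\<dots> = (\<integral>\<^sup>+u. ennreal (exp (- ?q u)) \<partial>leb ?d)"
        by (simp add: leb_0)
      finally show "(\<integral>\<^sup>+z. ennreal (norm (exp (- ?q (fst z)))) \<partial>(leb ?d \<Otimes>\<^sub>M leb 0)) < \<infinity>"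
        by (simp add: nn_integral_exp_quad)
    qed measurable
    then show ?thesis unfolding set_integrable_def leb2_def
      by (rule Bochner_Integration.integrable_cong[THEN iffD1, rotated -1])
        (auto simp: space_pair_measure space_leb append_vNil)
  qed
  have fibre: "set_integrable (leb 0) (carrier_vec 0) (\<lambda>v. exp (- action ?X b (u @\<^sub>v v)))" for b u
    unfolding set_integrable_def leb_0 by (rule integrable_count_space) simp
  have hess: "pos_semidef (?d + 0) (hessian (?d + 0) (action ?X b) z - Hmat ?X b)" if "z \<in> chart ?X b" for b z
  proof -
    have z: "z \<in> carrier_vec ?d" using that by (auto simp: chart_def append_vNil)
    have "hessian (?d + 0) (action ?X b) z - Hmat ?X b = 0\<^sub>m ?d ?d"
      using z by (simp add: hessian_quad Hmat_mixture_atlas)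
    moreover have "0\<^sub>m ?d ?d *\<^sub>v x = 0\<^sub>v ?d" if "x \<in> carrier_vec ?d" for x :: "real vec"
      using that by (intro eq_vecI) auto
    ultimately show ?thesis by (auto simp: pos_semidef_def)
  qed
  have smooth: "\<exists>U. openin (euclid (?d + 0)) U \<and> chart ?X b \<subseteq> U \<and> Ck_on 2 (?d + 0) U (action ?X b)" for b
  proof (intro exI[of _ "carrier_vec ?d"] conjI)
    show "openin (euclid (?d + 0)) (carrier_vec ?d)" using openin_topspace[of "euclid ?d"] by simp
    show "chart ?X b \<subseteq> carrier_vec ?d" by (auto simp: chart_def append_vNil)
    show "Ck_on 2 (?d + 0) (carrier_vec ?d) (action ?X b)" using Ck_on_quad by simp
  qed
  have sel: "b * K + K \<le> N * K" if "b < N" for b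
    using mult_le_mono1[of "Suc b" N K] that by simp
  show ?thesis
    unfolding phase_atlas_def
  proof (intro conjI ballI)
    fix b assume b: "b \<in> phases ?X"
    show "Tsel ?X b \<noteq> {}" using assms by simp
    show "Tsel ?X b \<subseteq> Tfull ?X" using sel[of b] b by auto
    show "pos_def (dimF ?X) (blkD ?X b)" using pos_def_one by simp
    show "pos_def (dimC ?X) (HRG ?X b)" using pos_def_one by (simp add: HRG_mixture_atlas)
  qed (use assms closed interior convex joint fibre hess smooth in auto)
qed

lemma atlas_phase_mixture_atlas:
  "2 \<le> N \<Longrightarrow> 2 \<le> K \<Longrightarrow> b < N \<Longrightarrow> atlas_phase (mixture_atlas N K) b"
  by (simp add: atlas_phaseI phase_atlas_mixture_atlas)

lemma nu_Ca_mixture_atlas: "nu_Ca (mixture_atlas N K) b = std_gaussian (N * K) (centre N b)"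
proof -
  let ?d = "N * K" let ?q = "quad ?d (centre N b)"
  have S: "S_RG (mixture_atlas N K) b u = ?q u" for u
    unfolding S_RG_def set_lebesgue_integral_def
    by (simp add: leb_0 lebesgue_integral_count_space_finite append_vNil)
  have "(LINT u:carrier_vec ?d|leb ?d. exp (- ?q u)) = (LINT u|leb ?d. exp (- ?q u))"
    unfolding set_lebesgue_integral_def
    by (rule Bochner_Integration.integral_cong) (auto simp: space_leb)
  also have "\<dots> = sqrt (2 * pi) ^ ?d"
    by (subst integral_eq_nn_integral) (auto simp: nn_integral_exp_quad)
  finally have Z: "(LINT u:carrier_vec ?d|leb ?d. exp (- ?q u)) = sqrt (2 * pi) ^ ?d" .
  have [measurable]: "carrier_vec ?d \<in> sets (leb ?d)"
    using sets.top[of "leb ?d"] by (simp add: space_leb)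
  show ?thesis
    unfolding nu_Ca_def std_gaussian_def S mixture_atlas_simps Z prod_normal_density
    by (rule density_cong; measurable?) (auto simp: space_leb)
qed

lemma Zobs_mixture_atlas:
  assumes "i < N * K" "u \<in> carrier_vec (N * K)"
  shows "Zobs (mixture_atlas N K) b i u = u $ i - centre N b i"
proof -
  have "(LINT u'|std_gaussian (N * K) (centre N b). unit_vec (N * K) i \<bullet> u')
      = (LINT u'|std_gaussian (N * K) (centre N b). u' $ i)"
    using assms(1) by (intro Bochner_Integration.integral_cong) auto
  then show ?thesis
    using assms by (simp add: Zobs_def nu_Ca_mixture_atlas std_gaussian_mean)
qed

lemma ell_mixture_atlas: "i < N * K \<Longrightarrow> ell (mixture_atlas N K) b i = 1"
  by (simp add: ell_def HRG_mixture_atlas inv_mat_one)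

text \<open>Both scales being 1, a gap between the selected and the full bounds can come from
  cardinalities and the prior only.\<close>

lemma L_mixture_atlas:
  assumes "2 \<le> N" "2 \<le> K"
  shows "b < N \<Longrightarrow> L_sel (mixture_atlas N K) b = 1" "L_glob (mixture_atlas N K) = 1"
proof -
  have "{..<N} \<noteq> {}" "{..<N * K} \<noteq> {}" using assms by (auto simp: lessThan_empty_iff)
  moreover have "(SUP i\<in>{..<N * K}. ell (mixture_atlas N K) b i) = (SUP i\<in>{..<N * K}. 1)" for b
    by (intro SUP_cong refl) (simp add: ell_mixture_atlas)
  ultimately show "L_glob (mixture_atlas N K) = 1" by (simp add: L_glob_def)
  assume b: "b < N"
  have "b * K + K \<le> N * K" using mult_le_mono1[of "Suc b" N K] b by simp
  then have "(SUP i\<in>{b * K..<b * K + K}. ell (mixture_atlas N K) b i) = (SUP i\<in>{b * K..<b * K + K}. 1)"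
    by (intro SUP_cong refl) (simp add: ell_mixture_atlas)
  also have "\<dots> = 1" using assms by (intro cSUP_const) auto
  finally show "L_sel (mixture_atlas N K) b = 1" by (simp add: L_sel_def)
qed

lemma prod_emeasure_power_le:
  fixes f :: "'a \<Rightarrow> ennreal"
  assumes "finite T" "\<And>i. i \<in> T \<Longrightarrow> f i \<le> ennreal p" "0 \<le> p"
  shows "prod f T \<le> ennreal (p ^ card T)"
  using assms
proof (induction T)
  case (insert i T)
  have "f i * prod f T \<le> ennreal p * ennreal (p ^ card T)"
    using insert by (intro mult_mono) auto
  then show ?case using insert by (simp add: ennreal_mult[symmetric])
qed simp

text \<open>With k = card T, independence bounds the probability that all coordinates stay within
  sqrt (ln k) of their means by (1 - 1 / (9 k))^k \<le> exp (- 1 / 9). Off that event the supremum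
  is at least sqrt (ln k), and on it at least 0.\<close>

lemma supZ_mixture_atlas_lower:
  assumes NK: "2 \<le> N" "2 \<le> K" and b: "b < N" and T: "T \<subseteq> {..<N * K}" "T \<noteq> {}"
  shows "(1 - exp (- 1 / 9)) * sqrt (ln (real (card T)))
    \<le> (LINT u|nu_Ca (mixture_atlas N K) b. supZ (mixture_atlas N K) b T u)"
proof -
  let ?X = "mixture_atlas N K" and ?d = "N * K"
  interpret atlas_phase ?X b using NK b by (rule atlas_phase_mixture_atlas)
  interpret prob_space "nu_Ca ?X b" by (rule prob_space_nu_Ca)
  have fT: "finite T" using T(1) by (rule finite_subset) simp
  define k where "k = real (card T)"
  have k: "1 \<le> k" using fT T(2) by (simp add: k_def Suc_le_eq card_gt_0_iff)
  define t where "t = sqrt (ln k)"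
  have t: "0 \<le> t" using k by (simp add: t_def)
  define A where "A = {u \<in> carrier_vec ?d. \<forall>i\<in>T. u $ i \<in> {centre N b i - t..centre N b i + t}}"
  have A: "A \<in> sets (nu_Ca ?X b)"
    using emeasure_std_gaussian_box(1)[OF T(1), of "\<lambda>i. {centre N b i - t..centre N b i + t}"]
    by (simp add: A_def nu_Ca_mixture_atlas)
  have "emeasure (nu_Ca ?X b) A
      = (\<Prod>i\<in>T. emeasure (density lborel (normal_density (centre N b i) 1)) {centre N b i - t..centre N b i + t})"
    unfolding A_def nu_Ca_mixture_atlas by (rule emeasure_std_gaussian_box(2)[OF T(1)]) simp
  also have "\<dots> \<le> ennreal ((1 - 1 / (9 * k)) ^ card T)"
  proof (rule prod_emeasure_power_le[OF fT])
    show "emeasure (density lborel (normal_density (centre N b i) 1)) {centre N b i - t..centre N b i + t}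
        \<le> ennreal (1 - 1 / (9 * k))" for i
      unfolding t_def by (rule normal_interval_le[OF k])
    show "0 \<le> 1 - 1 / (9 * k)" using k by (simp add: field_simps)
  qed
  also have "(1 - 1 / (9 * k)) ^ card T \<le> exp (- 1 / (9 * k)) ^ card T"
    using exp_ge_add_one_self[of "- 1 / (9 * k)"] k by (intro power_mono) (auto simp: field_simps)
  also have "exp (- 1 / (9 * k)) ^ card T = exp (k * (- 1 / (9 * k)))"
    by (simp add: exp_of_nat_mult[symmetric] k_def)
  also have "k * (- 1 / (9 * k)) = - 1 / 9" using k by simp
  finally have pA: "measure (nu_Ca ?X b) A \<le> exp (- 1 / 9)" by (simp add: emeasure_eq_measure ennreal_leI)
  have "(1 - exp (- 1 / 9)) * t \<le> (1 - measure (nu_Ca ?X b) A) * t"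
    using pA t by (intro mult_right_mono) auto
  also have "\<dots> = (LINT u|nu_Ca ?X b. t - t * indicator A u)"
  proof -
    have "integrable (nu_Ca ?X b) (indicator A :: _ \<Rightarrow> real)"
      by (rule integrable_real_indicator[OF A]) (simp add: less_top[symmetric])
    moreover have "(LINT u|nu_Ca ?X b. indicat_real A u) = measure (nu_Ca ?X b) A"
      using sets.sets_into_space[OF A] by (simp add: Int_absorb2)
    ultimately show ?thesis
      using measure_nu_Ca_space by (simp add: algebra_simps)
  qed
  also have "\<dots> \<le> (LINT u|nu_Ca ?X b. supZ ?X b T u)"
  proof (intro integral_mono supZ_integrable)
    show "integrable (nu_Ca ?X b) (\<lambda>u. t - t * indicator A u)"
      by (intro Bochner_Integration.integrable_diff integrable_mult_right integrable_real_indicator A)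
        (auto simp: less_top[symmetric])
    fix u assume "u \<in> space (nu_Ca ?X b)"
    then have u: "u \<in> carrier_vec ?d" by simp
    obtain i where i: "i \<in> T" using T(2) by blast
    have nonneg: "0 \<le> supZ ?X b T u"
      using i supZ_le_iff[OF fT T(2), of u "supZ ?X b T u"] by (meson abs_ge_zero order_refl order_trans)
    show "t - t * indicator A u \<le> supZ ?X b T u"
    proof (cases "u \<in> A")
      case False
      have "t \<le> supZ ?X b T u"
      proof (rule ccontr)
        assume "\<not> t \<le> supZ ?X b T u"
        then have "supZ ?X b T u \<le> t" by simp
        then have "\<forall>i\<in>T. \<bar>u $ i - centre N b i\<bar> \<le> t"
          using supZ_le_iff[OF fT T(2)] T(1) Zobs_mixture_atlas[OF _ u] by (metis lessThan_iff subsetD)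
        then have "u \<in> A" using u unfolding A_def by (force simp: abs_le_iff)
        then show False using False by simp
      qed
      then show ?thesis using False by simp
    qed (use nonneg in simp)
  qed (use T in auto)
  finally show ?thesis by (simp add: t_def k_def)
qed

text \<open>Three slabs in coordinate 0 are compared, around the first two centres and around their
  midpoint. Their equal widths make midpoints of points of the outer slabs fall into the middle
  one.\<close>

lemma not_log_concave_mixture_atlas:
  assumes NK: "2 \<le> N" "2 \<le> K"
  shows "\<not> log_concave_measure (N * K) (nu_C (mixture_atlas N K))"
proof
  assume lc: "log_concave_measure (N * K) (nu_C (mixture_atlas N K))"
  let ?X = "mixture_atlas N K" and ?d = "N * K"
  have d: "0 < ?d" using NK by simp
  define S where "S c = {u \<in> carrier_vec ?d. \<forall>i\<in>{0}. u $ i \<in> {c - 2..c + 2}}" for c :: real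
  have S[measurable]: "S c \<in> sets (leb ?d)" for c
    unfolding S_def using d by (intro emeasure_std_gaussian_box(1)) auto
  have phase: "emeasure (nu_Ca ?X b) (S c) = emeasure (density lborel (normal_density (8 * real N * real b) 1)) {c - 2..c + 2}" for b c
    unfolding S_def nu_Ca_mixture_atlas using d
    by (subst emeasure_std_gaussian_box(2)) (auto simp: centre_def)
  have mix: "emeasure (nu_C ?X) (S c) = (\<Sum>b<N. ennreal (1 / real N) * emeasure (nu_Ca ?X b) (S c))" for c
    using emeasure_nu_C[OF phase_atlas_mixture_atlas[OF NK], of "S c"] by simp
  \<comment> \<open>By Chebyshev at radius 2, a phase keeps mass at least 3 / 4 in its own slab, and
    its weight is 1 / N.\<close>
  have peak: "ennreal (3 / (4 * real N)) \<le> emeasure (nu_C ?X) (S (8 * real N * real b))" if "b < N" for b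
  proof -
    let ?c = "8 * real N * real b"
    let ?P = "density lborel (normal_density ?c 1)"
    interpret prob_space ?P by (rule prob_space_normal_density) simp
    have eq: "ennreal (3 / (4 * real N)) = ennreal (1 / real N) * ennreal (3 / 4)"
      by (simp add: mult.commute flip: ennreal_mult)
    have "ennreal (3 / 4) \<le> emeasure ?P {?c - 2..?c + 2}"
    proof -
      have "1 = measure ?P (space ?P)" by (rule prob_space[symmetric])
      also have "\<dots> \<le> measure ?P ({?c - 2..?c + 2} \<union> {x. 2 \<le> \<bar>x - ?c\<bar>})"
        by (intro finite_measure_mono) (auto simp: abs_le_iff)
      also have "\<dots> \<le> measure ?P {?c - 2..?c + 2} + measure ?P {x. 2 \<le> \<bar>x - ?c\<bar>}"
        by (rule measure_Un_le) auto
      also have "measure ?P {x. 2 \<le> \<bar>x - ?c\<bar>} \<le> 1 / 4"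
        using normal_chebyshev[of 2 ?c] by (simp add: emeasure_eq_measure)
      finally show ?thesis by (simp add: emeasure_eq_measure ennreal_leI)
    qed
    then have "ennreal (1 / real N) * ennreal (3 / 4) \<le> ennreal (1 / real N) * emeasure (nu_Ca ?X b) (S ?c)"
      unfolding phase by (rule mult_left_mono) simp
    also have "\<dots> \<le> emeasure (nu_C ?X) (S ?c)"
      unfolding mix using that by (intro member_le_sum) auto
    finally show ?thesis unfolding eq .
  qed
  have valley: "emeasure (nu_C ?X) (S (4 * real N)) \<le> ennreal (1 / (9 * (real N)\<^sup>2))"
  proof -
    have "emeasure (nu_Ca ?X b) (S (4 * real N)) \<le> ennreal (1 / (9 * (real N)\<^sup>2))" for b
    proof -
      let ?c = "8 * real N * real b"
      \<comment> \<open>For N \<ge> 2 the slab around 4 N keeps distance at least 4 N - 2 \<ge> 3 N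
        from every centre.\<close>
      have "3 * real N \<le> \<bar>x - ?c\<bar>" if "x \<in> {4 * real N - 2..4 * real N + 2}" for x
      proof (cases "b = 0")
        case False
        then have "8 * real N * 1 \<le> ?c" by (intro mult_left_mono) auto
        moreover have "2 \<le> real N" "x \<le> 4 * real N + 2" using NK that by auto
        ultimately have "3 * real N \<le> ?c - x" by linarith
        then show ?thesis by linarith
      qed (use that NK in auto)
      then have "emeasure (density lborel (normal_density ?c 1)) {4 * real N - 2..4 * real N + 2}
          \<le> emeasure (density lborel (normal_density ?c 1)) {x. 3 * real N \<le> \<bar>x - ?c\<bar>}"
        by (intro emeasure_mono) auto
      also have "\<dots> \<le> ennreal (1 / (3 * real N)\<^sup>2)" using NK by (intro normal_chebyshev) simp
      finally show ?thesis unfolding phase by (simp add: power_mult_distrib)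
    qed
    then have "emeasure (nu_C ?X) (S (4 * real N)) \<le> (\<Sum>b<N. ennreal (1 / real N) * ennreal (1 / (9 * (real N)\<^sup>2)))"
      unfolding mix by (intro sum_mono mult_left_mono) auto
    also have "\<dots> = ennreal (1 / (9 * (real N)\<^sup>2))"
      using NK by (simp add: ennreal_of_nat_eq_real_of_nat flip: ennreal_mult)
    finally show ?thesis .
  qed
  have "ennreal (3 / (4 * real N)) \<le> emeasure (nu_C ?X) (S 0)"
    "ennreal (3 / (4 * real N)) \<le> emeasure (nu_C ?X) (S (8 * real N))"
    using peak[of 0] peak[of 1] NK by simp_all
  then have "ennreal (3 / (4 * real N)) * ennreal (3 / (4 * real N))
      \<le> emeasure (nu_C ?X) (S 0) * emeasure (nu_C ?X) (S (8 * real N))"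
    by (rule mult_mono) simp_all
  also have "\<dots> \<le> (emeasure (nu_C ?X) (S (4 * real N)))\<^sup>2"
    by (rule log_concave_measure_midpoint[OF lc S S S]) (use d in \<open>auto simp: S_def vec_mid_def\<close>)
  also have "\<dots> \<le> (ennreal (1 / (9 * (real N)\<^sup>2)))\<^sup>2" using valley by (rule power_mono) simp
  finally have "ennreal (3 / (4 * real N)) * ennreal (3 / (4 * real N)) \<le> (ennreal (1 / (9 * (real N)\<^sup>2)))\<^sup>2" .
  then have "(3 / (4 * real N))\<^sup>2 \<le> (1 / (9 * (real N)\<^sup>2))\<^sup>2"
    by (simp add: ennreal_power power2_eq_square flip: ennreal_mult)
  then have "3 / (4 * real N) \<le> 1 / (9 * (real N)\<^sup>2)" by (rule power2_le_imp_le) simp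
  then have "27 * real N \<le> 4" using NK by (simp add: field_simps power2_eq_square)
  then show False using NK by simp
qed

section \<open>Concentration bounds and two-sided bounds for expected suprema\<close>

lemma sub_gaussian_concentration:
  assumes X: "phase_atlas X" "a \<in> phases X" and q: "0 < pmf q a" and \<delta>: "0 < \<delta>" "\<delta> < 1"
  shows "measure (nu_Ca X a) {u \<in> space (nu_Ca X a). supZ X a (Tsel X a) u
        \<le> 2 * L_sel X a * sqrt (ln (2 * real (card (Tsel X a)) / (\<delta> * pmf q a)))} \<ge> 1 - \<delta> * pmf q a"
    "measure (nu_Ca X a) {u \<in> space (nu_Ca X a). supZ X a (Tfull X) u
        \<le> 2 * L_glob X * sqrt (ln (2 * real (card (Tfull X)) / \<delta>))} \<ge> 1 - \<delta>"
proof -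
  interpret atlas_phase X a using X by (rule atlas_phaseI)
  \<comment> \<open>\<open>supZ_tail\<close> takes a failure level of at most 1: \<delta> q(a) for
    the selected class and \<delta> for the full class.\<close>
  have "\<delta> * pmf q a \<le> 1 * 1" using \<delta> by (intro mult_mono pmf_le_1) auto
  then show "measure (nu_Ca X a) {u \<in> space (nu_Ca X a). supZ X a (Tsel X a) u
        \<le> 2 * L_sel X a * sqrt (ln (2 * real (card (Tsel X a)) / (\<delta> * pmf q a)))} \<ge> 1 - \<delta> * pmf q a"
    using q \<delta> by (intro supZ_tail Tsel_subset Tsel_nonempty ell_le_L_sel) auto
  show "measure (nu_Ca X a) {u \<in> space (nu_Ca X a). supZ X a (Tfull X) u
        \<le> 2 * L_glob X * sqrt (ln (2 * real (card (Tfull X)) / \<delta>))} \<ge> 1 - \<delta>"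
    using \<delta> Tsel_subset Tsel_nonempty by (intro supZ_tail ell_le_L_glob) auto
qed

text \<open>With at least two observables, ln 2 \<le> ln (card T) absorbs the factor 2 inside the
  logarithm at the cost of sqrt 2.\<close>

lemma supZ_mixture_atlas_bounds:
  assumes NK: "2 \<le> N" "2 \<le> K" and T: "T \<subseteq> {..<N * K}" "2 \<le> card T"
  shows "(LINT u|nu_Ca (mixture_atlas N K) 0. supZ (mixture_atlas N K) 0 T u)
    \<in> {(1 - exp (- 1 / 9)) * sqrt (ln (real (card T))) .. 2 * sqrt 2 * sqrt (ln (real (card T)))}"
proof -
  interpret atlas_phase "mixture_atlas N K" 0 using NK by (intro atlas_phase_mixture_atlas) auto
  have ne: "T \<noteq> {}" using T(2) by auto
  have "(LINT u|nu_Ca (mixture_atlas N K) 0. supZ (mixture_atlas N K) 0 T u) \<le> 2 * sqrt (ln (2 * real (card T)))"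
    using T(1) ne by (intro supZ_expectation_le) (auto simp: ell_mixture_atlas)
  also have "\<dots> \<le> 2 * sqrt (2 * ln (real (card T)))"
  proof -
    have "ln (2 * real (card T)) = ln 2 + ln (real (card T))" using T(2) by (simp add: ln_mult)
    also have "ln 2 \<le> ln (real (card T))" using T(2) by simp
    finally show ?thesis by simp
  qed
  finally show ?thesis
    using supZ_mixture_atlas_lower[OF NK _ T(1) ne, of 0] NK by (simp add: real_sqrt_mult)
qed

theorem propositionA6:
  shows
    "(\<exists>C>0. \<forall>X q a \<delta>.
        phase_atlas X \<and> atlas_prior X q \<and> a \<in> phases X \<and> 0 < pmf q a \<and> 0 < \<delta> \<and> \<delta> < 1 \<longrightarrow>
          measure (nu_Ca X a) {u \<in> space (nu_Ca X a). supZ X a (Tsel X a) u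
              \<le> C * L_sel X a * sqrt (ln (2 * real (card (Tsel X a)) / (\<delta> * pmf q a)))}
            \<ge> 1 - \<delta> * pmf q a \<and>
          measure (nu_Ca X a) {u \<in> space (nu_Ca X a). supZ X a (Tfull X) u
              \<le> C * L_glob X * sqrt (ln (2 * real (card (Tfull X)) / \<delta>))}
            \<ge> 1 - \<delta>) \<and>
     (\<exists>c0>0. \<exists>c1>0. \<exists>c2>0. \<exists>X q a.
        (\<forall>N\<ge>2. \<forall>K\<ge>2.
          gaussian_mixture_atlas (X N K) \<and> card (phases (X N K)) = N \<and>
          \<not> log_concave_measure (dimC (X N K)) (nu_C (X N K)) \<and>
          a N K \<in> phases (X N K) \<and> atlas_prior (X N K) (q N K) \<and> c0 \<le> pmf (q N K) (a N K) \<and>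
          card (Tsel (X N K) (a N K)) = K \<and> card (Tfull (X N K)) = N * K \<and>
          L_sel (X N K) (a N K) = 1 \<and> L_glob (X N K) = 1 \<and>
          (LINT u|nu_Ca (X N K) (a N K). supZ (X N K) (a N K) (Tsel (X N K) (a N K)) u)
            \<in> {c1 * sqrt (ln (real K)) .. c2 * sqrt (ln (real K))} \<and>
          (LINT u|nu_Ca (X N K) (a N K). supZ (X N K) (a N K) (Tfull (X N K)) u)
            \<in> {c1 * sqrt (ln (real (N * K))) .. c2 * sqrt (ln (real (N * K)))}) \<and>
        (\<exists>N\<ge>2. \<exists>K\<ge>2.
          (LINT u|nu_Ca (X N K) (a N K). supZ (X N K) (a N K) (Tsel (X N K) (a N K)) u)
            < (LINT u|nu_Ca (X N K) (a N K). supZ (X N K) (a N K) (Tfull (X N K)) u) \<and>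
          (\<forall>\<delta>. 0 < \<delta> \<and> \<delta> < 1 \<longrightarrow>
             L_sel (X N K) (a N K)
                * sqrt (ln (2 * real (card (Tsel (X N K) (a N K))) / (\<delta> * pmf (q N K) (a N K))))
             < L_glob (X N K) * sqrt (ln (2 * real (card (Tfull (X N K))) / \<delta>))))) \<and>
     (\<forall>X N a. phase_atlas X \<and> card (phases X) = N \<and> a \<in> phases X \<longrightarrow>
        ln (1 / pmf (pmf_of_set (phases X)) a) = ln (real N) \<and>
        (\<forall>\<delta>. 0 < \<delta> \<and> \<delta> < 1 \<longrightarrow>
           ln (2 * real (card (Tsel X a)) / (\<delta> * pmf (pmf_of_set (phases X)) a))
             = ln (2 * real (card (Tsel X a)) / \<delta>) + ln (real N)))"
proof (intro conjI)
  show "\<exists>C>0. \<forall>X q a \<delta>.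
        phase_atlas X \<and> atlas_prior X q \<and> a \<in> phases X \<and> 0 < pmf q a \<and> 0 < \<delta> \<and> \<delta> < 1 \<longrightarrow>
          measure (nu_Ca X a) {u \<in> space (nu_Ca X a). supZ X a (Tsel X a) u
              \<le> C * L_sel X a * sqrt (ln (2 * real (card (Tsel X a)) / (\<delta> * pmf q a)))}
            \<ge> 1 - \<delta> * pmf q a \<and>
          measure (nu_Ca X a) {u \<in> space (nu_Ca X a). supZ X a (Tfull X) u
              \<le> C * L_glob X * sqrt (ln (2 * real (card (Tfull X)) / \<delta>))}
            \<ge> 1 - \<delta>"
    \<comment> \<open>The constant 2 is the Chernoff threshold factor of
      \<open>Zobs_upper_tail\<close>.\<close>
    using sub_gaussian_concentration by (intro exI[of _ 2]) auto
next
  define c1 c2 :: real where "c1 = 1 - exp (- 1 / 9)" and "c2 = 2 * sqrt 2"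
  define E where "E N K T = (LINT u|nu_Ca (mixture_atlas N K) 0. supZ (mixture_atlas N K) 0 T u)" for N K T
  have c: "0 < c1" "0 < c2" by (auto simp: c1_def c2_def)
  have sel: "E N K {0..<K} \<in> {c1 * sqrt (ln (real K)) .. c2 * sqrt (ln (real K))}"
    and full: "E N K {..<N * K} \<in> {c1 * sqrt (ln (real (N * K))) .. c2 * sqrt (ln (real (N * K)))}"
    if NK: "2 \<le> N" "2 \<le> K" for N K
  proof -
    have "K \<le> N * K" "2 \<le> N * K" using NK mult_le_mono[of 1 N 2 K] by auto
    then show "E N K {0..<K} \<in> {c1 * sqrt (ln (real K)) .. c2 * sqrt (ln (real K))}"
      "E N K {..<N * K} \<in> {c1 * sqrt (ln (real (N * K))) .. c2 * sqrt (ln (real (N * K)))}"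
      using supZ_mixture_atlas_bounds[OF NK, of "{0..<K}"] supZ_mixture_atlas_bounds[OF NK, of "{..<N * K}"] NK(2)
      unfolding E_def c1_def c2_def by (simp_all add: lessThan_atLeast0)
  qed
  \<comment> \<open>The lower and upper constants differ, so the two ranges may overlap for small
    \<open>N\<close>. For K = 2 the selected value stays bounded while the full one grows, so
    \<open>N\<close> is taken beyond the point where c1 sqrt (ln (2 N)) exceeds c2 sqrt (ln
    2).\<close>
  have gap: "\<exists>N\<ge>2. E N 2 {0..<2} < E N 2 {..<N * 2}"
  proof -
    define s where "s = c2 * sqrt (ln 2) / c1"
    obtain N0 :: nat where N0: "exp (s\<^sup>2) < real N0" using reals_Archimedean2 by blast
    define N where "N = max 2 N0"
    have N: "2 \<le> N" "exp (s\<^sup>2) < real (N * 2)" using N0 by (auto simp: N_def max_def)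
    have "s\<^sup>2 < ln (real (N * 2))" 
    proof -
      have "ln (exp (s\<^sup>2)) < ln (real (N * 2))"
        using N(2) by (rule ln_less_cancel_iff[THEN iffD2, rotated 2]) (use N(1) in auto)
      then show ?thesis by (simp only: ln_exp)
    qed
    then have "s < sqrt (ln (real (N * 2)))" by (rule real_less_rsqrt)
    then have "c2 * sqrt (ln 2) < c1 * sqrt (ln (real (N * 2)))"
      using c by (simp add: s_def field_simps)
    then show ?thesis using sel[OF N(1), of 2] full[OF N(1), of 2] N(1) by (intro exI[of _ N]) auto
  qed
  show "\<exists>c0>0. \<exists>c1>0. \<exists>c2>0. \<exists>X q a.
        (\<forall>N\<ge>2. \<forall>K\<ge>2.
          gaussian_mixture_atlas (X N K) \<and> card (phases (X N K)) = N \<and>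
          \<not> log_concave_measure (dimC (X N K)) (nu_C (X N K)) \<and>
          a N K \<in> phases (X N K) \<and> atlas_prior (X N K) (q N K) \<and> c0 \<le> pmf (q N K) (a N K) \<and>
          card (Tsel (X N K) (a N K)) = K \<and> card (Tfull (X N K)) = N * K \<and>
          L_sel (X N K) (a N K) = 1 \<and> L_glob (X N K) = 1 \<and>
          (LINT u|nu_Ca (X N K) (a N K). supZ (X N K) (a N K) (Tsel (X N K) (a N K)) u)
            \<in> {c1 * sqrt (ln (real K)) .. c2 * sqrt (ln (real K))} \<and>
          (LINT u|nu_Ca (X N K) (a N K). supZ (X N K) (a N K) (Tfull (X N K)) u)
            \<in> {c1 * sqrt (ln (real (N * K))) .. c2 * sqrt (ln (real (N * K)))}) \<and>
        (\<exists>N\<ge>2. \<exists>K\<ge>2.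
          (LINT u|nu_Ca (X N K) (a N K). supZ (X N K) (a N K) (Tsel (X N K) (a N K)) u)
            < (LINT u|nu_Ca (X N K) (a N K). supZ (X N K) (a N K) (Tfull (X N K)) u) \<and>
          (\<forall>\<delta>. 0 < \<delta> \<and> \<delta> < 1 \<longrightarrow>
             L_sel (X N K) (a N K)
                * sqrt (ln (2 * real (card (Tsel (X N K) (a N K))) / (\<delta> * pmf (q N K) (a N K))))
             < L_glob (X N K) * sqrt (ln (2 * real (card (Tfull (X N K))) / \<delta>))))"
  \<comment> \<open>The prior is the point mass at phase 0, so the selected phase has probability 1
    and the bound 1 serves all \<open>N\<close> and \<open>K\<close>.\<close>
  proof (rule exI[of _ "1::real"], rule conjI, simp, rule exI[of _ c1], rule conjI, rule c(1),
      rule exI[of _ c2], rule conjI, rule c(2), rule exI[of _ mixture_atlas],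
      rule exI[of _ "\<lambda>_ _. return_pmf (0::nat)"], rule exI[of _ "\<lambda>_ _. 0::nat"], rule conjI)
    show "\<forall>N\<ge>2. \<forall>K\<ge>2.
          gaussian_mixture_atlas (mixture_atlas N K) \<and> card (phases (mixture_atlas N K)) = N \<and>
          \<not> log_concave_measure (dimC (mixture_atlas N K)) (nu_C (mixture_atlas N K)) \<and>
          0 \<in> phases (mixture_atlas N K) \<and> atlas_prior (mixture_atlas N K) (return_pmf 0) \<and>
          1 \<le> pmf (return_pmf 0) (0::nat) \<and>
          card (Tsel (mixture_atlas N K) 0) = K \<and> card (Tfull (mixture_atlas N K)) = N * K \<and>
          L_sel (mixture_atlas N K) 0 = 1 \<and> L_glob (mixture_atlas N K) = 1 \<and>
          (LINT u|nu_Ca (mixture_atlas N K) 0. supZ (mixture_atlas N K) 0 (Tsel (mixture_atlas N K) 0) u)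
            \<in> {c1 * sqrt (ln (real K)) .. c2 * sqrt (ln (real K))} \<and>
          (LINT u|nu_Ca (mixture_atlas N K) 0. supZ (mixture_atlas N K) 0 (Tfull (mixture_atlas N K)) u)
            \<in> {c1 * sqrt (ln (real (N * K))) .. c2 * sqrt (ln (real (N * K)))}"
    proof (intro allI impI)
      fix N K :: nat assume NK: "2 \<le> N" "2 \<le> K"
      have "gaussian_mixture_atlas (mixture_atlas N K)"
        by (simp add: gaussian_mixture_atlas_def phase_atlas_mixture_atlas[OF NK] nu_Ca_mixture_atlas
            gaussian_measure_std_gaussian)
      then show "gaussian_mixture_atlas (mixture_atlas N K) \<and> card (phases (mixture_atlas N K)) = N \<and>
          \<not> log_concave_measure (dimC (mixture_atlas N K)) (nu_C (mixture_atlas N K)) \<and>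
          0 \<in> phases (mixture_atlas N K) \<and> atlas_prior (mixture_atlas N K) (return_pmf 0) \<and>
          1 \<le> pmf (return_pmf 0) (0::nat) \<and>
          card (Tsel (mixture_atlas N K) 0) = K \<and> card (Tfull (mixture_atlas N K)) = N * K \<and>
          L_sel (mixture_atlas N K) 0 = 1 \<and> L_glob (mixture_atlas N K) = 1 \<and>
          (LINT u|nu_Ca (mixture_atlas N K) 0. supZ (mixture_atlas N K) 0 (Tsel (mixture_atlas N K) 0) u)
            \<in> {c1 * sqrt (ln (real K)) .. c2 * sqrt (ln (real K))} \<and>
          (LINT u|nu_Ca (mixture_atlas N K) 0. supZ (mixture_atlas N K) 0 (Tfull (mixture_atlas N K)) u)
            \<in> {c1 * sqrt (ln (real (N * K))) .. c2 * sqrt (ln (real (N * K)))}"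
        using not_log_concave_mixture_atlas[OF NK] L_mixture_atlas[OF NK] sel[OF NK] full[OF NK] NK
        by (simp add: atlas_prior_def E_def)
    qed
    obtain N where N: "2 \<le> N" "E N 2 {0..<2} < E N 2 {..<N * 2}" using gap by blast
    have two: "{0..<2::nat} = {0..<Suc (Suc 0)}" by (simp add: numeral_2_eq_2)
    \<comment> \<open>With K = 2 and the point-mass prior, the selected argument is 4 / \<delta>,
      against 4 N / \<delta> for the full class.\<close>
    have *: "sqrt (ln (4 / \<delta>)) < sqrt (ln (2 * real (N * 2) / \<delta>))" if "0 < \<delta>" "\<delta> < 1" for \<delta> :: real
      using that N(1) by (simp add: divide_strict_right_mono)
    show "\<exists>N\<ge>2. \<exists>K\<ge>2.
          (LINT u|nu_Ca (mixture_atlas N K) 0. supZ (mixture_atlas N K) 0 (Tsel (mixture_atlas N K) 0) u)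
            < (LINT u|nu_Ca (mixture_atlas N K) 0. supZ (mixture_atlas N K) 0 (Tfull (mixture_atlas N K)) u) \<and>
          (\<forall>\<delta>. 0 < \<delta> \<and> \<delta> < 1 \<longrightarrow>
             L_sel (mixture_atlas N K) 0
                * sqrt (ln (2 * real (card (Tsel (mixture_atlas N K) 0)) / (\<delta> * pmf (return_pmf 0) (0::nat))))
             < L_glob (mixture_atlas N K) * sqrt (ln (2 * real (card (Tfull (mixture_atlas N K))) / \<delta>)))"
    proof (rule exI[of _ N], rule conjI[OF N(1)], rule exI[of _ "2::nat"], rule conjI[OF order_refl])
    qed (use N L_mixture_atlas[of N 2] * in \<open>simp add: E_def two\<close>)
  qed
next
  show "\<forall>X N a. phase_atlas X \<and> card (phases X) = N \<and> a \<in> phases X \<longrightarrow>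
        ln (1 / pmf (pmf_of_set (phases X)) a) = ln (real N) \<and>
        (\<forall>\<delta>. 0 < \<delta> \<and> \<delta> < 1 \<longrightarrow>
           ln (2 * real (card (Tsel X a)) / (\<delta> * pmf (pmf_of_set (phases X)) a))
             = ln (2 * real (card (Tsel X a)) / \<delta>) + ln (real N))"
  proof (intro allI impI)
    fix X N a assume *: "phase_atlas X \<and> card (phases X) = N \<and> a \<in> phases X"
    then interpret atlas_phase X a by (intro atlas_phaseI) auto
    have fin: "finite (phases X)" using atlas by (simp add: phase_atlas_def)
    then have N: "0 < N" using * phase by (auto simp: card_gt_0_iff)
    have p: "pmf (pmf_of_set (phases X)) a = 1 / real N"
      using * fin by (subst pmf_of_set) auto
    have c: "0 < card (Tsel X a)"
      using finite_subset[OF Tsel_subset finite_Tfull] Tsel_nonempty by (simp add: card_gt_0_iff)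
    \<comment> \<open>Dividing by the uniform probability multiplies the argument by
      \<open>N\<close>, and the logarithm splits because the class is nonempty.\<close>
    have "ln (2 * real (card (Tsel X a)) / \<delta> * real N) = ln (2 * real (card (Tsel X a)) / \<delta>) + ln (real N)"
      if "0 < \<delta>" for \<delta>
      using c N that by (intro ln_mult_pos) auto
    then show "ln (1 / pmf (pmf_of_set (phases X)) a) = ln (real N) \<and>
        (\<forall>\<delta>. 0 < \<delta> \<and> \<delta> < 1 \<longrightarrow>
           ln (2 * real (card (Tsel X a)) / (\<delta> * pmf (pmf_of_set (phases X)) a))
             = ln (2 * real (card (Tsel X a)) / \<delta>) + ln (real N))"
      by (simp add: p)
  qed
qed

end
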